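(* Let $\mathcal{H}$ be a complex separable Hilbert space, let $X\subset\mathbb{R}^d$ be a relatively separated set, and let $\nu$ be an admissible weight on $\mathbb{R}^d$ satisfying the weak growth condition $$\nu(x)\ge C(1+|x|)^{\delta}\qquad (x\in\mathbb{R}^d)\quad\text{for some } \delta\in(0,1],\ C>0 .$$ Then $$r_{\mathcal{S}^1_\nu}(A)=r_{\mathcal{B}(\ell^2(X;\mathcal{H}))}(A)\qquad\text{for all } A=A^*\in\mathcal{S}^1_\nu .$$ In particular, $\mathcal{S}^1_\nu=\mathcal{S}^1_\nu(X)$ is inverse-closed in $\mathcal{B}(\ell^2(X;\mathcal{H}))$, and $\mathcal{S}^1_\nu$ is a symmetric Banach algebra.
   Context: $|\cdot|$ is the Euclidean norm on $\mathbb{R}^d$. A countable set $X\subset\mathbb{R}^d$ is relatively separated if $\sup_{x\in\mathbb{R}^d}|X\cap(x+[0,1]^d)|<\infty$ (cardinality). $\ell^2(X;\mathcal{H})$ is the Hilbert space of families $(f_k)_{k\in X}$ in $\mathcal{H}$ with $\sum_k\|f_k\|^2<\infty$. A weight is a continuous function $\nu:\mathbb{R}^d\to(0,\infty)$. It is admissible if (a) $\nu(x)=e^{\rho(\|x\|)}$ for some norm $\|\cdot\|$ on $\mathbb{R}^d$ and some continuous concave $\rho:[0,\infty)\to[0,\infty)$ with $\rho(0)=0$, and (b) $\lim_{n\to\infty}\nu(nz)^{1/n}=1$ for all $z\in\mathbb{R}^d$ (GRS-condition). $\mathcal{S}^1_\nu(X)$ is the space of matrices $A=[A_{k,l}]_{k,l\in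 X}$ with entries in $\mathcal{B}(\mathcal{H})$ for which $$\|A\|_{\mathcal{S}^1_\nu}=\max\Big\{\sup_{k\in X}\sum_{l\in X}\|A_{k,l}\|\nu(k-l),\ \sup_{l\in X}\sum_{k\in X}\|A_{k,l}\|\nu(k-l)\Big\}<\infty .$$ A matrix acts on families by $A(f_l)_{l}=(\sum_{l\in X}A_{k,l}f_l)_{k}$; this identifies $\mathcal{S}^1_\nu$ with a subalgebra of $\mathcal{B}(\ell^2(X;\mathcal{H}))$. Multiplication is matrix multiplication, $[AB]_{k,l}=\sum_{n}A_{k,n}B_{n,l}$, and the involution is $[A^*]_{k,l}=(A_{l,k})^*$; the identity is the diagonal matrix with entries $\mathcal{I}_{\mathcal{B}(\mathcal{H})}$. For a unital Banach algebra $\mathcal{A}$, $\sigma_{\mathcal{A}}(A)$ is the spectrum and $r_{\mathcal{A}}(A)$ the spectral radius of $A$ in $\mathcal{A}$. $\mathcal{A}\subseteq\mathcal{B}$ (common identity) is inverse-closed in $\mathcal{B}$ if $A\in\mathcal{A}$ invertible in $\mathcal{B}$ implies $A^{-1}\in\mathcal{A}$. A unital Banach algebra with involution is symmetric if $\sigma_{\mathcal{A}}(A^*A)\subseteq[0,\infty)$ for all $A\in\mathcal{A}$. *)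

theory Defs
  imports "HOL-Analysis.Analysis" "HOL-Algebra.Module"
begin

section \<open>Complex Hilbert spaces\<close>

text \<open>The real structure of a complex Hilbert space is the one inherited from \<open>banach\<close>; the axioms
  \<open>scaleR_scaleC\<close> and \<open>cinner_self\<close> tie it to the complex one. The inner product is linear in its
  first argument. Separability is not part of the class.\<close>

class complex_hilbert_space = banach +
  fixes scaleC :: "complex \<Rightarrow> 'a \<Rightarrow> 'a"  (infixr "*\<^sub>C" 75)
    and cinner :: "'a \<Rightarrow> 'a \<Rightarrow> complex"
  assumes scaleR_scaleC: "r *\<^sub>R x = complex_of_real r *\<^sub>C x"
    and scaleC_add_right: "c *\<^sub>C (x + y) = c *\<^sub>C x + c *\<^sub>C y"
    and scaleC_add_left: "(c + d) *\<^sub>C x = c *\<^sub>C x + d *\<^sub>C x"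
    and scaleC_scaleC: "c *\<^sub>C (d *\<^sub>C x) = (c * d) *\<^sub>C x"
    and cinner_commute: "cinner x y = cnj (cinner y x)"
    and cinner_add_left: "cinner (x + y) z = cinner x z + cinner y z"
    and cinner_scaleC_left: "cinner (c *\<^sub>C x) y = c * cinner x y"
    and cinner_self: "cinner x x = complex_of_real ((norm x)\<^sup>2)"

instantiation complex :: complex_hilbert_space
begin

definition scaleC_complex :: "complex \<Rightarrow> complex \<Rightarrow> complex"
  where "scaleC_complex c x = c * x"

definition cinner_complex :: "complex \<Rightarrow> complex \<Rightarrow> complex"
  where "cinner_complex x y = x * cnj y"

instance
  by standard
    (auto simp: scaleC_complex_def cinner_complex_def algebra_simps scaleR_conv_of_real
      complex_norm_square [symmetric] simp del: of_real_power)

end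

text \<open>The bounded operators on a complex Hilbert space are represented inside the library type of
  bounded real-linear maps, whose norm is the operator norm.\<close>

definition bounded_clinear_ops :: "('h::complex_hilbert_space \<Rightarrow>\<^sub>L 'h) set"
  where "bounded_clinear_ops = {T. \<forall>c x. blinfun_apply T (c *\<^sub>C x) = c *\<^sub>C blinfun_apply T x}"

definition adj :: "('h::complex_hilbert_space \<Rightarrow>\<^sub>L 'h) \<Rightarrow> ('h \<Rightarrow>\<^sub>L 'h)"
  where "adj T = (THE S. \<forall>x y. cinner (blinfun_apply T x) y = cinner x (blinfun_apply S y))"


section \<open>Complex algebras\<close>

text \<open>A complex algebra is represented by the library record \<open>module\<close> (a ring with a scalar
  multiplication), with all operations relative to its carrier.\<close>

definition complex_ring :: "complex ring"
  where "complex_ring = \<lparr>carrier = UNIV, mult = (*), one = 1, zero = 0, add = (+)\<rparr>"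

definition spectrum :: "(complex, 'a, 'm) module_scheme \<Rightarrow> 'a \<Rightarrow> complex set"
  where "spectrum A a = {z. (z \<odot>\<^bsub>A\<^esub> \<one>\<^bsub>A\<^esub>) \<ominus>\<^bsub>A\<^esub> a \<notin> Units A}"

text \<open>Taken in \<open>[0,\<infinity>]\<close>, so that the zero algebra (where the spectrum is empty) gives \<open>0\<close>.\<close>

definition spectral_radius :: "(complex, 'a, 'm) module_scheme \<Rightarrow> 'a \<Rightarrow> ennreal"
  where "spectral_radius A a = (SUP z\<in>spectrum A a. ennreal (cmod z))"

text \<open>Inclusions of algebras are rendered by explicit embeddings \<open>\<phi>\<close>, since matrices
  and the operators that they induce are objects of different types. Note that \<open>ring_hom\<close> includes
  preservation of the identity.\<close>

definition algebra_embedding ::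
    "('a \<Rightarrow> 'b) \<Rightarrow> (complex, 'a, 'm) module_scheme \<Rightarrow> (complex, 'b, 'n) module_scheme \<Rightarrow> bool"
  where "algebra_embedding \<phi> A B \<longleftrightarrow>
    \<phi> \<in> ring_hom A B \<and>
    (\<forall>c. \<forall>a\<in>carrier A. \<phi> (c \<odot>\<^bsub>A\<^esub> a) = c \<odot>\<^bsub>B\<^esub> \<phi> a) \<and>
    inj_on \<phi> (carrier A)"

definition inverse_closed ::
    "('a \<Rightarrow> 'b) \<Rightarrow> (complex, 'a, 'm) module_scheme \<Rightarrow> (complex, 'b, 'n) module_scheme \<Rightarrow> bool"
  where "inverse_closed \<phi> A B \<longleftrightarrow>
    algebra_embedding \<phi> A B \<and>
    (\<forall>a\<in>carrier A. \<phi> a \<in> Units B \<longrightarrow> inv\<^bsub>B\<^esub> (\<phi> a) \<in> \<phi> ` carrier A)"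

record 'a star_algebra = "(complex, 'a) module" +
  anorm :: "'a \<Rightarrow> real"
  star :: "'a \<Rightarrow> 'a"

text \<open>The normalisation of the identity is required only if \<open>\<one> \<noteq> \<zero>\<close>, so that the zero algebra is
  admitted.\<close>

locale unital_banach_star_algebra =
  Module.module complex_ring A + Ring.ring A for A :: "('a, 'm) star_algebra_scheme" (structure) +
  assumes smult_mult_left: "\<lbrakk>x \<in> carrier A; y \<in> carrier A\<rbrakk> \<Longrightarrow> (c \<odot>\<^bsub>A\<^esub> x) \<otimes> y = c \<odot>\<^bsub>A\<^esub> (x \<otimes> y)"
    and smult_mult_right: "\<lbrakk>x \<in> carrier A; y \<in> carrier A\<rbrakk> \<Longrightarrow> x \<otimes> (c \<odot>\<^bsub>A\<^esub> y) = c \<odot>\<^bsub>A\<^esub> (x \<otimes> y)"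
    and anorm_ge_zero: "x \<in> carrier A \<Longrightarrow> 0 \<le> anorm A x"
    and anorm_eq_zero: "x \<in> carrier A \<Longrightarrow> anorm A x = 0 \<longleftrightarrow> x = \<zero>"
    and anorm_add: "\<lbrakk>x \<in> carrier A; y \<in> carrier A\<rbrakk> \<Longrightarrow> anorm A (x \<oplus> y) \<le> anorm A x + anorm A y"
    and anorm_smult: "x \<in> carrier A \<Longrightarrow> anorm A (c \<odot>\<^bsub>A\<^esub> x) = cmod c * anorm A x"
    and anorm_mult: "\<lbrakk>x \<in> carrier A; y \<in> carrier A\<rbrakk> \<Longrightarrow> anorm A (x \<otimes> y) \<le> anorm A x * anorm A y"
    and anorm_one: "\<one> \<noteq> \<zero> \<Longrightarrow> anorm A \<one> = 1"
    and complete: "\<lbrakk>\<And>n. s n \<in> carrier A;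
        \<forall>e>0. \<exists>N. \<forall>m\<ge>N. \<forall>n\<ge>N. anorm A (s m \<ominus> s n) < e\<rbrakk>
      \<Longrightarrow> \<exists>a\<in>carrier A. (\<lambda>n::nat. anorm A (s n \<ominus> a)) \<longlonglongrightarrow> 0"
    and star_closed: "x \<in> carrier A \<Longrightarrow> star A x \<in> carrier A"
    and star_star: "x \<in> carrier A \<Longrightarrow> star A (star A x) = x"
    and star_add: "\<lbrakk>x \<in> carrier A; y \<in> carrier A\<rbrakk> \<Longrightarrow> star A (x \<oplus> y) = star A x \<oplus> star A y"
    and star_smult: "x \<in> carrier A \<Longrightarrow> star A (c \<odot>\<^bsub>A\<^esub> x) = cnj c \<odot>\<^bsub>A\<^esub> star A x"
    and star_mult: "\<lbrakk>x \<in> carrier A; y \<in> carrier A\<rbrakk> \<Longrightarrow> star A (x \<otimes> y) = star A y \<otimes> star A x"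
    and anorm_star: "x \<in> carrier A \<Longrightarrow> anorm A (star A x) = anorm A x"

definition symmetric_banach_algebra :: "('a, 'm) star_algebra_scheme \<Rightarrow> bool"
  where "symmetric_banach_algebra A \<longleftrightarrow>
    unital_banach_star_algebra A \<and>
    (\<forall>a\<in>carrier A. spectrum A (star A a \<otimes>\<^bsub>A\<^esub> a) \<subseteq> complex_of_real ` {0..})"


section \<open>The bounded operators on the space of square-summable families\<close>

text \<open>Families indexed by \<open>X\<close> are functions vanishing outside \<open>X\<close>; operators on \<open>ell2 X\<close> are
  functions sending everything outside \<open>ell2 X\<close> to \<open>0\<close>.\<close>

definition ell2 :: "'i set \<Rightarrow> ('i \<Rightarrow> 'h::complex_hilbert_space) set"
  where "ell2 X = {f. (\<forall>k. k \<notin> X \<longrightarrow> f k = 0) \<and> (\<lambda>k. (norm (f k))\<^sup>2) summable_on X}"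

definition ell2_norm :: "'i set \<Rightarrow> ('i \<Rightarrow> 'h::complex_hilbert_space) \<Rightarrow> real"
  where "ell2_norm X f = sqrt (\<Sum>\<^sub>\<infinity>k\<in>X. (norm (f k))\<^sup>2)"

definition bounded_ell2_op ::
    "'i set \<Rightarrow> (('i \<Rightarrow> 'h::complex_hilbert_space) \<Rightarrow> ('i \<Rightarrow> 'h)) \<Rightarrow> bool"
  where "bounded_ell2_op X T \<longleftrightarrow>
    (\<forall>f. f \<notin> ell2 X \<longrightarrow> T f = (\<lambda>k. 0)) \<and>
    (\<forall>f\<in>ell2 X. T f \<in> ell2 X) \<and>
    (\<forall>f\<in>ell2 X. \<forall>g\<in>ell2 X. T (\<lambda>k. f k + g k) = (\<lambda>k. T f k + T g k)) \<and>
    (\<forall>c. \<forall>f\<in>ell2 X. T (\<lambda>k. c *\<^sub>C f k) = (\<lambda>k. c *\<^sub>C T f k)) \<and>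
    (\<exists>M. \<forall>f\<in>ell2 X. ell2_norm X (T f) \<le> M * ell2_norm X f)"

definition ell2_operators ::
    "'i set \<Rightarrow> (complex, ('i \<Rightarrow> 'h::complex_hilbert_space) \<Rightarrow> ('i \<Rightarrow> 'h)) module"
  where "ell2_operators X =
    \<lparr>carrier = Collect (bounded_ell2_op X),
     mult = (\<lambda>S T f. S (T f)),
     one = (\<lambda>f. if f \<in> ell2 X then f else (\<lambda>k. 0)),
     zero = (\<lambda>f k. 0),
     add = (\<lambda>S T f k. S f k + T f k),
     smult = (\<lambda>c T f k. c *\<^sub>C T f k)\<rparr>"


section \<open>Index sets and weights\<close>

definition relatively_separated :: "(real ^ 'n) set \<Rightarrow> bool"
  where "relatively_separated X \<longleftrightarrow>
    countable X \<and>
    (\<exists>N::nat. \<forall>x. finite (X \<inter> (+) x ` cbox 0 1) \<and> card (X \<inter> (+) x ` cbox 0 1) \<le> N)"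

definition is_norm :: "('v::real_vector \<Rightarrow> real) \<Rightarrow> bool"
  where "is_norm p \<longleftrightarrow>
    (\<forall>x. 0 \<le> p x) \<and> (\<forall>x. p x = 0 \<longleftrightarrow> x = 0) \<and>
    (\<forall>c x. p (c *\<^sub>R x) = \<bar>c\<bar> * p x) \<and> (\<forall>x y. p (x + y) \<le> p x + p y)"

definition weight :: "(real ^ 'n \<Rightarrow> real) \<Rightarrow> bool"
  where "weight \<nu> \<longleftrightarrow> continuous_on UNIV \<nu> \<and> (\<forall>x. 0 < \<nu> x)"

definition admissible_weight :: "(real ^ 'n \<Rightarrow> real) \<Rightarrow> bool"
  where "admissible_weight \<nu> \<longleftrightarrow>
    weight \<nu> \<and>
    (\<exists>p \<rho>. is_norm p \<and> continuous_on {0..} \<rho> \<and> concave_on {0..} \<rho> \<and>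
      (\<forall>t\<ge>0. 0 \<le> \<rho> t) \<and> \<rho> 0 = 0 \<and> (\<forall>x. \<nu> x = exp (\<rho> (p x)))) \<and>
    (\<forall>z. (\<lambda>n. root n (\<nu> (real n *\<^sub>R z))) \<longlonglongrightarrow> 1)"


section \<open>The weighted Schur algebra\<close>

type_synonym ('n, 'h) op_matrix = "real ^ 'n \<Rightarrow> real ^ 'n \<Rightarrow> 'h \<Rightarrow>\<^sub>L 'h"

definition schur_norm ::
    "(real ^ 'n \<Rightarrow> real) \<Rightarrow> (real ^ 'n) set \<Rightarrow> ('n::finite, 'h::complex_hilbert_space) op_matrix \<Rightarrow> ennreal"
  where "schur_norm \<nu> X A =
    max (SUP k\<in>X. \<Sum>\<^sub>\<infinity>l\<in>X. ennreal (norm (A k l) * \<nu> (k - l)))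
        (SUP l\<in>X. \<Sum>\<^sub>\<infinity>k\<in>X. ennreal (norm (A k l) * \<nu> (k - l)))"

text \<open>Matrices indexed by \<open>X\<close> are functions vanishing outside \<open>X \<times> X\<close>.\<close>

definition schur_algebra ::
    "(real ^ 'n \<Rightarrow> real) \<Rightarrow> (real ^ 'n) set \<Rightarrow> ('n::finite, 'h::complex_hilbert_space) op_matrix star_algebra"
  where "schur_algebra \<nu> X =
    \<lparr>carrier = {A. (\<forall>k l. k \<notin> X \<or> l \<notin> X \<longrightarrow> A k l = 0) \<and>
                   (\<forall>k l. A k l \<in> bounded_clinear_ops) \<and> schur_norm \<nu> X A < \<infinity>},
     mult = (\<lambda>A B k l. \<Sum>\<^sub>\<infinity>n\<in>X. A k n o\<^sub>L B n l),
     one = (\<lambda>k l. if k \<in> X \<and> k = l then id_blinfun else 0),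
     zero = (\<lambda>k l. 0),
     add = (\<lambda>A B k l. A k l + B k l),
     smult = (\<lambda>c A k l. Blinfun (\<lambda>x. c *\<^sub>C blinfun_apply (A k l) x)),
     anorm = (\<lambda>A. enn2real (schur_norm \<nu> X A)),
     star = (\<lambda>A k l. adj (A l k))\<rparr>"

definition matrix_op ::
    "(real ^ 'n) set \<Rightarrow> ('n::finite, 'h::complex_hilbert_space) op_matrix
      \<Rightarrow> (real ^ 'n \<Rightarrow> 'h) \<Rightarrow> (real ^ 'n \<Rightarrow> 'h)"
  where "matrix_op X A f =
    (if f \<in> ell2 X then (\<lambda>k. \<Sum>\<^sub>\<infinity>l\<in>X. blinfun_apply (A k l) (f l)) else (\<lambda>k. 0))"

end

theory Submission
  imports Defs
begin

text \<open>Write \<open>\<parallel>A\<parallel>\<^sub>1\<close> for the unweighted Schur norm. If \<open>\<parallel>A\<parallel> \<le> q < 1\<close> on \<open>\<ell>\<^sup>2\<close>, then \<open>1 - A\<close> is invertible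
  in the Schur algebra: bounding the near-diagonal entries of \<open>A\<^sup>m\<close> by \<open>q\<^sup>m\<close> and the others by the weak
  growth of \<open>\<nu>\<close> gives
  \<open>\<parallel>A\<^sup>m\<parallel>\<^sub>1 \<le> K R\<^sup>d q\<^sup>m + C\<inverse> R\<^sup>-\<^sup>\<delta> \<parallel>A\<^sup>m\<parallel>\<^sub>\<nu>\<close>, while the rate of growth of \<open>\<parallel>A\<^sup>n\<parallel>\<^sub>\<nu>\<close> does not change when
  \<open>\<nu> = exp (\<rho> \<circ> p)\<close> is replaced by the equivalent weight \<open>exp (\<rho> (p + L) - \<rho> L)\<close>; for large \<open>L\<close> the norm
  for this weight is close to \<open>\<parallel>\<cdot>\<parallel>\<^sub>1\<close>, because \<open>\<rho>\<close> is concave and unbounded with sublinear growth. So the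
  rate of growth of \<open>\<parallel>A\<^sup>n\<parallel>\<^sub>\<nu>\<close> is governed by \<open>\<parallel>A\<^sup>m\<parallel>\<^sub>1\<close>; taking \<open>R\<close> exponential in \<open>m\<close> pushes it below \<open>1\<close>.

  If \<open>N\<close> is merely bounded below on \<open>\<ell>\<^sup>2\<close>, this applies to \<open>1 - c N\<^sup>* N\<close> for small \<open>c\<close>, so \<open>N\<^sup>* N\<close> is
  invertible in the Schur algebra. Hence the algebra is inverse-closed, the spectra agree, and symmetry
  follows since \<open>z - A\<^sup>* A\<close> is coercive for \<open>z \<notin> [0, \<infinity>)\<close>.\<close>

section \<open>Weights and index sets\<close>

text \<open>The obstacle: an operator bound controls the single entries of a matrix but not its row
  sums. Passing to row sums costs a count of points, polynomial in \<open>R\<close>, and leaves a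
  remainder in the weighted norm, the very quantity to be bounded. Hence a bootstrap: with
  \<open>R = \<beta> ^ m\<close> the count costs a factor \<open>\<beta> ^ CARD('n)\<close> per
  power of the matrix, so \<open>\<beta>\<close> must stay close enough to 1 that
  \<open>\<beta> ^ CARD('n) * q < 1\<close>, and one pass improves the rate only by about
  \<open>\<beta> powr (- \<delta>)\<close>. Finitely many passes bring it below 1.

  The weak growth makes the remainder small and \<open>\<rho>\<close> unbounded; the GRS-condition
  makes \<open>\<rho> L / L\<close> small for suitable \<open>L\<close>. Together they allow the
  flattening, through which a single power with small unweighted norm controls all powers in the
  weighted norm.

  The conclusions come in the reverse of the stated order: the spectral radii agree because the
  spectra do. No spectral radius formula and no functional calculus enters; all estimates are
  geometric bounds \<open>D * s ^ n\<close> that feed a Neumann series.\<close>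

lemma concave_slopes:
  fixes \<rho> :: "real \<Rightarrow> real"
  assumes conc: "concave_on {0..} \<rho>" and "0 \<le> a" "a < b" "b < c"
  shows "(\<rho> c - \<rho> b) * (b - a) \<le> (\<rho> b - \<rho> a) * (c - b)"
proof -
  \<comment> \<open>\<open>b\<close> is the convex combination of \<open>a\<close> and
    \<open>c\<close> with weight \<open>t\<close>; multiplying concavity at \<open>b\<close> by
    \<open>c - a\<close> clears the denominator.\<close>
  define t where "t = (b - a) / (c - a)"
  have t: "0 \<le> t" "t \<le> 1" using assms by (auto simp: t_def)
  have "(1 - t) *\<^sub>R a + t *\<^sub>R c = a + t * (c - a)" by (simp add: algebra_simps)
  also have "\<dots> = b" using assms by (simp add: t_def)
  finally have eq: "(1 - t) *\<^sub>R a + t *\<^sub>R c = b" .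
  have "\<rho> ((1 - t) *\<^sub>R a + t *\<^sub>R c) \<ge> (1 - t) * \<rho> a + t * \<rho> c"
    using concave_onD[OF conc t, of a c] assms by auto
  then have "\<rho> b * (c - a) \<ge> ((1 - t) * \<rho> a + t * \<rho> c) * (c - a)"
    using assms unfolding eq by (intro mult_right_mono) auto
  also have "((1 - t) * \<rho> a + t * \<rho> c) * (c - a) = (c - b) * \<rho> a + (b - a) * \<rho> c"
  proof -
    have t_eq: "t * (c - a) = b - a" using assms by (simp add: t_def)
    have "((1 - t) * \<rho> a + t * \<rho> c) * (c - a)
        = (c - a) * \<rho> a - t * (c - a) * \<rho> a + t * (c - a) * \<rho> c" by (simp add: algebra_simps)
    then show ?thesis unfolding t_eq by (simp add: algebra_simps)
  qed
  finally show ?thesis by (simp add: algebra_simps)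
qed

text \<open>Both inner points \<open>s + h\<close> and \<open>t\<close> are convex combinations of
  the outer points \<open>s\<close> and \<open>t + h\<close>, with the weights \<open>1 - u\<close>
  and \<open>u\<close> interchanged. In the sum of the two concavity inequalities \<open>u\<close>
  cancels.\<close>

lemma concave_increment_antimono:
  fixes \<rho> :: "real \<Rightarrow> real"
  assumes conc: "concave_on {0..} \<rho>" and "0 \<le> s" "s \<le> t" "0 \<le> h"
  shows "\<rho> (t + h) - \<rho> t \<le> \<rho> (s + h) - \<rho> s"
proof (cases "s = t \<or> h = 0")
  case False
  then have lt: "s < t" "0 < h" using assms by auto
  define u where "u = h / (t + h - s)"
  have u: "0 \<le> u" "u \<le> 1" using lt by (auto simp: u_def)
  have e: "u * (t + h - s) = h" using lt by (simp add: u_def)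
  have e1: "(1 - u) *\<^sub>R s + u *\<^sub>R (t + h) = s + h"
    using e by (simp add: algebra_simps)
  have e2: "(1 - u) *\<^sub>R (t + h) + u *\<^sub>R s = t"
    using e by (simp add: algebra_simps)
  have "\<rho> (s + h) \<ge> (1 - u) * \<rho> s + u * \<rho> (t + h)"
    using concave_onD[OF conc u, of s "t + h"] assms e1 by auto
  moreover have "\<rho> t \<ge> (1 - u) * \<rho> (t + h) + u * \<rho> s"
    using concave_onD[OF conc u, of "t + h" s] assms e2 by auto
  ultimately show ?thesis by (simp add: algebra_simps)
qed auto

text \<open>A concave function that decreases once keeps decreasing at least as fast, so it would
  fall below zero.\<close>

lemma concave_nonneg_mono:
  fixes \<rho> :: "real \<Rightarrow> real"
  assumes conc: "concave_on {0..} \<rho>" and nonneg: "\<And>t. 0 \<le> t \<Longrightarrow> 0 \<le> \<rho> t" and "0 \<le> s" "s \<le> t"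
  shows "\<rho> s \<le> \<rho> t"
proof (rule ccontr)
  assume less: "\<not> \<rho> s \<le> \<rho> t"
  then have st: "s < t" using assms by (cases "s = t") auto
  \<comment> \<open>At \<open>c\<close> the line through the points of the graph over
    \<open>s\<close> and \<open>t\<close> has reached the value -1.\<close>
  define c where "c = t + (\<rho> t + 1) * (t - s) / (\<rho> s - \<rho> t)"
  have pos: "0 < (\<rho> t + 1) * (t - s) / (\<rho> s - \<rho> t)"
    using st less nonneg[of t] \<open>0 \<le> s\<close> by (intro divide_pos_pos mult_pos_pos) auto
  then have tc: "t < c" by (simp add: c_def)
  have "(\<rho> c - \<rho> t) * (t - s) \<le> (\<rho> t - \<rho> s) * (c - t)"
    by (rule concave_slopes[OF conc \<open>0 \<le> s\<close> st tc])
  also have "\<dots> = - (\<rho> t + 1) * (t - s)" using less by (simp add: c_def field_simps)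
  finally have "\<rho> c - \<rho> t \<le> - (\<rho> t + 1)"
    using st mult_le_cancel_right_pos[of "t - s"] by simp
  moreover have "0 \<le> \<rho> c" using nonneg[of c] tc st \<open>0 \<le> s\<close> by simp
  ultimately show False by simp
qed

text \<open>The slope inequality with left end point 0. Its bound contains
  \<open>\<rho> L / L\<close>, the quantity that the GRS-condition makes small.\<close>

lemma concave_increment_le_slope:
  fixes \<rho> :: "real \<Rightarrow> real"
  assumes conc: "concave_on {0..} \<rho>" and "\<rho> 0 = 0" "0 < L" "0 \<le> h"
  shows "\<rho> (L + h) - \<rho> L \<le> h * (\<rho> L / L)"
proof (cases "h = 0")
  case False
  then have "(\<rho> (L + h) - \<rho> L) * (L - 0) \<le> (\<rho> L - \<rho> 0) * (L + h - L)"
    using assms by (intro concave_slopes[OF conc]) auto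
  then show ?thesis using assms by (simp add: field_simps)
qed simp

text \<open>Translating \<open>\<rho>\<close> by a large \<open>L\<close> gives an equivalent weight that is almost constant on bounded
  sets, and that is smaller than \<open>\<nu>\<close> by a large factor outside of them.\<close>

lemma admissible_weight_flattening:
  fixes \<nu> :: "real ^ 'n \<Rightarrow> real"
  assumes adm: "admissible_weight \<nu>" and unbdd: "\<And>K. \<exists>x. K \<le> \<nu> x" and "0 < \<epsilon>"
  shows "\<exists>w c. 0 < c \<and> w 0 = 1 \<and> (\<forall>x. 0 < w x) \<and> (\<forall>x y. w (x + y) \<le> w x * w y) \<and>
    (\<forall>x. \<nu> x \<le> c * w x) \<and> (\<forall>x. w x \<le> (1 + \<epsilon>) + \<epsilon> * \<nu> x)"
proof -
  obtain p \<rho> where p: "is_norm p" and conc: "concave_on {0..} \<rho>" and nonneg: "\<And>t. 0 \<le> t \<Longrightarrow> 0 \<le> \<rho> t"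
    and "\<rho> 0 = 0" and \<nu>: "\<And>x. \<nu> x = exp (\<rho> (p x))"
    and GRS: "\<And>z. (\<lambda>n. root n (\<nu> (real n *\<^sub>R z))) \<longlonglongrightarrow> 1"
    using adm unfolding admissible_weight_def by blast
  have p_nonneg: "0 \<le> p x" for x using p by (simp add: is_norm_def)
  have p_tri: "p (x + y) \<le> p x + p y" for x y using p by (simp add: is_norm_def)
  have mono: "\<rho> s \<le> \<rho> t" if "0 \<le> s" "s \<le> t" for s t
    using concave_nonneg_mono[OF conc nonneg] that by blast
  define \<epsilon>0 where "\<epsilon>0 = ln (1 + \<epsilon>)"
  have \<epsilon>0: "0 < \<epsilon>0" "exp \<epsilon>0 = 1 + \<epsilon>" using \<open>0 < \<epsilon>\<close> by (auto simp: \<epsilon>0_def)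
  \<comment> \<open>\<open>L0\<close> is the radius beyond which the flattened weight gains the
    factor \<open>\<epsilon>\<close>, as
    \<open>exp (\<epsilon>0 - \<rho> L0) \<le> \<epsilon>\<close>. Taking \<open>p x + 1\<close> as
    the witness makes it positive.\<close>
  obtain L0 where L0: "0 < L0" "\<epsilon>0 - ln \<epsilon> \<le> \<rho> L0"
  proof -
    obtain x where "exp (\<epsilon>0 - ln \<epsilon>) \<le> \<nu> x" using unbdd by blast
    then have "\<epsilon>0 - ln \<epsilon> \<le> \<rho> (p x)" by (simp add: \<nu>)
    also have "\<dots> \<le> \<rho> (p x + 1)" using p_nonneg by (intro mono) auto
    finally show ?thesis using that[of "p x + 1"] p_nonneg[of x] by auto
  qed
  \<comment> \<open>One ray suffices: \<open>p\<close> is homogeneous, so \<open>\<nu>\<close> at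
    the multiples of \<open>z\<close> samples \<open>\<rho>\<close> at the multiples of
    \<open>p z\<close>, and \<open>L\<close> is one of these where \<open>\<rho> L / L\<close> is at
    most \<open>\<epsilon>0 / L0\<close>.\<close>
  obtain L where L: "0 < L" "L0 * (\<rho> L / L) \<le> \<epsilon>0"
  proof -
    define z :: "real ^ 'n" where "z = 1"
    have "z \<noteq> 0" by (simp add: z_def vec_eq_iff)
    then have pz: "0 < p z" using p p_nonneg[of z] unfolding is_norm_def by (metis less_eq_real_def)
    define \<eta> where "\<eta> = \<epsilon>0 * p z / L0"
    have "0 < \<eta>" using \<epsilon>0 pz L0 by (simp add: \<eta>_def)
    then have "eventually (\<lambda>n. root n (\<nu> (real n *\<^sub>R z)) < exp \<eta>) sequentially"
      by (intro order_tendstoD[OF GRS]) simp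
    then obtain n where n: "n \<ge> 1" "root n (\<nu> (real n *\<^sub>R z)) < exp \<eta>"
      using eventually_happens[OF eventually_conj[OF eventually_ge_at_top[of "1::nat"]]] by force
    have pn: "p (real n *\<^sub>R z) = real n * p z" using p by (simp add: is_norm_def)
    have "\<nu> (real n *\<^sub>R z) = root n (\<nu> (real n *\<^sub>R z)) ^ n"
      using n(1) by (simp add: \<nu>)
    also have "\<dots> \<le> exp \<eta> ^ n" using n by (intro power_mono) (auto simp: \<nu>)
    also have "\<dots> = exp (real n * \<eta>)" by (simp add: exp_of_nat_mult)
    finally have "\<rho> (real n * p z) \<le> real n * \<eta>" by (simp add: \<nu> pn)
    then have "\<rho> (real n * p z) \<le> real n * (\<epsilon>0 * p z / L0)" by (simp add: \<eta>_def)
    then have "L0 * (\<rho> (real n * p z) / (real n * p z)) \<le> \<epsilon>0"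
      using n pz L0 by (simp add: field_simps)
    then show ?thesis using that[of "real n * p z"] n pz by simp
  qed
  define w where "w x = exp (\<rho> (p x + L) - \<rho> L)" for x
  \<comment> \<open>The map from \<open>t\<close> to \<open>\<rho> (L + t) - \<rho> L\<close> is
    subadditive: a step of length \<open>p x\<close> from \<open>p y + L\<close> gains no more than
    one from \<open>L\<close>.\<close>
  have sub: "\<rho> (p (x + y) + L) - \<rho> L \<le> (\<rho> (p x + L) - \<rho> L) + (\<rho> (p y + L) - \<rho> L)" for x y
  proof -
    have "\<rho> (p (x + y) + L) \<le> \<rho> (p y + L + p x)"
      using p_nonneg[of "x + y"] p_tri[of x y] L by (intro mono) auto
    moreover have "\<rho> (p y + L + p x) - \<rho> (p y + L) \<le> \<rho> (L + p x) - \<rho> L"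
      using p_nonneg L by (intro concave_increment_antimono[OF conc]) auto
    ultimately show ?thesis by (simp add: add.commute)
  qed
  have upper: "w x \<le> (1 + \<epsilon>) + \<epsilon> * \<nu> x" for x
  proof (cases "p x \<le> L0")
    case True
    have "\<rho> (p x + L) \<le> \<rho> (L + L0)" using p_nonneg[of x] True L by (intro mono) auto
    moreover have "\<rho> (L + L0) - \<rho> L \<le> \<epsilon>0"
      using concave_increment_le_slope[OF conc \<open>\<rho> 0 = 0\<close> L(1), of L0] L0 L(2) by simp
    ultimately have "w x \<le> exp \<epsilon>0" by (simp add: w_def)
    moreover have "0 \<le> \<epsilon> * \<nu> x" using \<open>0 < \<epsilon>\<close> by (simp add: \<nu>)
    ultimately show ?thesis using \<epsilon>0 by simp
  next
    case False
    \<comment> \<open>Now the step has length \<open>L\<close> and its starting point varies: from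
      \<open>p x\<close>, beyond \<open>L0\<close>, it gains no more than from \<open>L0\<close>,
      that is at most \<open>\<rho> L + \<epsilon>0 - \<rho> L0 \<le> \<rho> L + ln
      \<epsilon>\<close>.\<close>
    have "\<rho> (p x + L) - \<rho> (p x) \<le> \<rho> (L0 + L) - \<rho> L0"
      using False L0 L by (intro concave_increment_antimono[OF conc]) auto
    moreover have "\<rho> (L + L0) - \<rho> L \<le> \<epsilon>0"
      using concave_increment_le_slope[OF conc \<open>\<rho> 0 = 0\<close> L(1), of L0] L0 L(2) by simp
    ultimately have "\<rho> (p x + L) - \<rho> L \<le> ln \<epsilon> + \<rho> (p x)"
      using L0 by (simp add: add.commute)
    then have "w x \<le> exp (ln \<epsilon> + \<rho> (p x))" unfolding w_def by (subst exp_le_cancel_iff)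
    then have "w x \<le> \<epsilon> * \<nu> x" using \<open>0 < \<epsilon>\<close> by (simp add: \<nu> exp_add)
    then show ?thesis using \<open>0 < \<epsilon>\<close> by simp
  qed
  have "\<nu> x \<le> exp (\<rho> L) * w x" for x
  proof -
    have "\<rho> (p x) \<le> \<rho> (p x + L)" using p_nonneg L by (intro mono) auto
    then show ?thesis by (simp add: \<nu> w_def flip: exp_add)
  qed
  moreover have "w (x + y) \<le> w x * w y" for x y
    using sub[of x y] by (simp add: w_def flip: exp_add)
  moreover have "p 0 = 0" using p unfolding is_norm_def by blast
  then have "w 0 = 1" by (simp add: w_def)
  moreover have "0 < w x" for x by (simp add: w_def)
  ultimately show ?thesis using upper by (intro exI[of _ w] exI[of _ "exp (\<rho> L)"]) auto
qed

text \<open>Submultiplicativity is subadditivity of \<open>\<rho>\<close>, which is the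
  antimonotonicity of increments compared with those from 0.\<close>

lemma admissible_weight_properties:
  assumes "admissible_weight \<nu>"
  shows "\<nu> 0 = 1" "1 \<le> \<nu> x" "\<nu> (- x) = \<nu> x" "\<nu> (x + y) \<le> \<nu> x * \<nu> y"
proof -
  obtain p \<rho> where p: "is_norm p" and conc: "concave_on {0..} \<rho>" and nonneg: "\<And>t. 0 \<le> t \<Longrightarrow> 0 \<le> \<rho> t"
    and "\<rho> 0 = 0" and \<nu>: "\<And>x. \<nu> x = exp (\<rho> (p x))"
    using assms unfolding admissible_weight_def by blast
  have p_nonneg: "0 \<le> p x" for x using p by (simp add: is_norm_def)
  have "p 0 = 0" using p unfolding is_norm_def by blast
  then show "\<nu> 0 = 1" using \<open>\<rho> 0 = 0\<close> by (simp add: \<nu>)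
  show "1 \<le> \<nu> x" using nonneg p_nonneg by (simp add: \<nu>)
  have "p ((-1) *\<^sub>R x) = \<bar>-1\<bar> * p x" using p unfolding is_norm_def by blast
  then show "\<nu> (- x) = \<nu> x" by (simp add: \<nu>)
  have "\<rho> (p (x + y)) \<le> \<rho> (p y + p x)"
    using p p_nonneg by (intro concave_nonneg_mono[OF conc nonneg]) (auto simp: is_norm_def add.commute)
  moreover have "\<rho> (p y + p x) - \<rho> (p y) \<le> \<rho> (0 + p x) - \<rho> 0"
    using p_nonneg by (intro concave_increment_antimono[OF conc]) auto
  ultimately show "\<nu> (x + y) \<le> \<nu> x * \<nu> y" using \<open>\<rho> 0 = 0\<close> by (simp add: \<nu> flip: exp_add)
qed

text \<open>The ball is covered by the translates of the unit cube by integer vectors with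
  coordinates in \<open>{-m..m}\<close>, \<open>m\<close> the ceiling of \<open>R\<close>; relative
  separation bounds the number of points in each of them.\<close>

lemma relatively_separated_growth:
  fixes X :: "(real ^ 'n) set"
  assumes "relatively_separated X"
  shows "\<exists>K>0. \<forall>R\<ge>1. \<forall>x. finite (X \<inter> cball x R) \<and> real (card (X \<inter> cball x R)) \<le> K * R ^ CARD('n)"
proof -
  obtain N :: nat where N: "\<And>x. finite (X \<inter> (+) x ` cbox 0 1) \<and> card (X \<inter> (+) x ` cbox 0 1) \<le> N"
    using assms unfolding relatively_separated_def by blast
  \<comment> \<open>The 5 comes from \<open>2 * m + 1 \<le> 2 * R + 3 \<le> 5 * R\<close> for
    \<open>R \<ge> 1\<close>; \<open>N + 1\<close> in place of \<open>N\<close> keeps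
    \<open>K\<close> positive.\<close>
  define K where "K = real (N + 1) * 5 ^ CARD('n)"
  have "finite (X \<inter> cball x R) \<and> real (card (X \<inter> cball x R)) \<le> K * R ^ CARD('n)" if "1 \<le> R" for R x
  proof -
    define m :: int where "m = \<lceil>R\<rceil>"
    define V where "V = (PiE UNIV (\<lambda>_. {-m..m}) :: ('n \<Rightarrow> int) set)"
    define T where "T v = X \<inter> (+) (x + (\<chi> i. real_of_int (v i))) ` cbox 0 1" for v :: "'n \<Rightarrow> int"
    have finV: "finite V" unfolding V_def by (intro finite_PiE) auto
    have m: "1 \<le> m" "real_of_int m \<le> R + 1" "R \<le> real_of_int m" using that by (auto simp: m_def)
    have "card V = nat (2 * m + 1) ^ CARD('n)"
      unfolding V_def by (subst card_PiE) (auto simp: algebra_simps)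
    then have "real (card V) = (2 * real_of_int m + 1) ^ CARD('n)" using m by simp
    also have "\<dots> \<le> (5 * R) ^ CARD('n)" using m that by (intro power_mono) auto
    finally have cardV: "real (card V) \<le> (5 * R) ^ CARD('n)" .
    have sub: "X \<inter> cball x R \<subseteq> (\<Union>v\<in>V. T v)"
    proof
      fix y assume y: "y \<in> X \<inter> cball x R"
      define v where "v i = \<lfloor>(y - x) $ i\<rfloor>" for i
      have bd: "\<bar>(y - x) $ i\<bar> \<le> R" for i
        using y component_le_norm_cart[of "y - x" i] by (simp add: dist_norm norm_minus_commute)
      have "v i \<in> {-m..m}" for i
        using bd[of i] m unfolding v_def atLeastAtMost_iff le_floor_iff floor_le_iff by auto
      then have "v \<in> V" by (auto simp: V_def)
      moreover have "y - (x + (\<chi> i. real_of_int (v i))) \<in> cbox 0 1"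
        by (auto simp: mem_box_cart v_def) linarith+
      then have "y \<in> T v" using y unfolding T_def
        by (auto intro!: image_eqI[of _ _ "y - (x + (\<chi> i. real_of_int (v i)))"])
      ultimately show "y \<in> (\<Union>v\<in>V. T v)" by blast
    qed
    have fin: "finite (\<Union>v\<in>V. T v)" using finV N unfolding T_def by (intro finite_UN_I) auto
    have "card (X \<inter> cball x R) \<le> card (\<Union>v\<in>V. T v)" by (rule card_mono[OF fin sub])
    also have "\<dots> \<le> (\<Sum>v\<in>V. card (T v))" by (rule card_UN_le[OF finV])
    also have "\<dots> \<le> (\<Sum>v\<in>V. N)" using N by (intro sum_mono) (auto simp: T_def)
    finally have "card (X \<inter> cball x R) \<le> N * card V" by (simp add: mult.commute)
    then have "real (card (X \<inter> cball x R)) \<le> real N * real (card V)"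
      by (metis of_nat_le_iff of_nat_mult)
    also have "\<dots> \<le> real (N + 1) * (5 * R) ^ CARD('n)" using cardV by (intro mult_mono) auto
    finally show ?thesis using finite_subset[OF sub fin] by (simp add: K_def power_mult_distrib)
  qed
  moreover have "0 < K" by (simp add: K_def)
  ultimately show ?thesis by blast
qed

section \<open>Complex Hilbert spaces and adjoints\<close>

lemma scaleC_zero_right [simp]: "c *\<^sub>C (0::'a::complex_hilbert_space) = 0"
  using scaleC_add_right[of c "0::'a" 0] by simp

lemma scaleC_zero_left [simp]: "0 *\<^sub>C (x::'a::complex_hilbert_space) = 0"
  using scaleC_add_left[of 0 0 x] by simp

lemma scaleC_one [simp]: "1 *\<^sub>C (x::'a::complex_hilbert_space) = x"
  using scaleR_scaleC[of 1 x] by simp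

lemma scaleC_minus_one: "(-1) *\<^sub>C (x::'a::complex_hilbert_space) = - x"
  using scaleR_scaleC[of "-1" x] by simp

lemma scaleC_minus_right: "c *\<^sub>C (- x) = - (c *\<^sub>C (x::'a::complex_hilbert_space))"
  by (metis scaleC_minus_one scaleC_scaleC mult.commute)

lemma cinner_add_right: "cinner x (y + z) = cinner x y + cinner x (z::'a::complex_hilbert_space)"
  by (metis cinner_add_left cinner_commute complex_cnj_add)

lemma cinner_scaleC_right: "cinner x (c *\<^sub>C y) = cnj c * cinner x (y::'a::complex_hilbert_space)"
  by (metis cinner_scaleC_left cinner_commute complex_cnj_mult)

lemma cinner_zero_left [simp]: "cinner 0 (y::'a::complex_hilbert_space) = 0"
  using cinner_add_left[of 0 0 y] by simp

lemma cinner_zero_right [simp]: "cinner (y::'a::complex_hilbert_space) 0 = 0"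
  using cinner_add_right[of y 0 0] by simp

lemma cinner_minus_left: "cinner (- x) y = - cinner x (y::'a::complex_hilbert_space)"
  using cinner_add_left[of x "- x" y] by (simp add: add_eq_0_iff)

lemma cinner_minus_right: "cinner x (- y) = - cinner x (y::'a::complex_hilbert_space)"
  using cinner_add_right[of x y "- y"] by (simp add: add_eq_0_iff)

lemma cinner_diff_left: "cinner (x - y) z = cinner x z - cinner y (z::'a::complex_hilbert_space)"
  using cinner_add_left[of x "- y" z] by (simp add: cinner_minus_left)

lemma cinner_diff_right: "cinner x (y - z) = cinner x y - cinner x (z::'a::complex_hilbert_space)"
  using cinner_add_right[of x y "- z"] by (simp add: cinner_minus_right)

lemma cinner_scaleR_left: "cinner (r *\<^sub>R x) y = complex_of_real r * cinner x (y::'a::complex_hilbert_space)"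
  by (simp add: scaleR_scaleC cinner_scaleC_left)

lemma cinner_scaleR_right: "cinner x (r *\<^sub>R y) = complex_of_real r * cinner x (y::'a::complex_hilbert_space)"
  by (simp add: scaleR_scaleC cinner_scaleC_right)

text \<open>The class postulates homogeneity of the norm for real scalars; the complex case has to
  come from the inner product.\<close>

lemma norm_scaleC: "norm (c *\<^sub>C x) = cmod c * norm (x::'a::complex_hilbert_space)"
proof -
  have "complex_of_real ((norm (c *\<^sub>C x))\<^sup>2) = c * (cnj c * complex_of_real ((norm x)\<^sup>2))"
    unfolding cinner_self[symmetric] by (simp add: cinner_scaleC_left cinner_scaleC_right)
  also have "\<dots> = complex_of_real ((cmod c * norm x)\<^sup>2)"
    by (simp only: power_mult_distrib of_real_mult complex_norm_square mult.assoc)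
  finally have "(norm (c *\<^sub>C x))\<^sup>2 = (cmod c * norm x)\<^sup>2" using of_real_eq_iff by blast
  then show ?thesis by (simp add: power2_eq_iff_nonneg)
qed

lemma norm_add_sq: "(norm (x + y))\<^sup>2 = (norm x)\<^sup>2 + (norm y)\<^sup>2 + 2 * Re (cinner x (y::'a::complex_hilbert_space))"
proof -
  have "complex_of_real ((norm (x + y))\<^sup>2)
      = complex_of_real ((norm x)\<^sup>2) + complex_of_real ((norm y)\<^sup>2) + (cinner x y + cnj (cinner x y))"
    unfolding cinner_self[symmetric] using cinner_commute[of y x]
    by (simp add: cinner_add_left cinner_add_right)
  then have "Re (complex_of_real ((norm (x + y))\<^sup>2))
      = Re (complex_of_real ((norm x)\<^sup>2) + complex_of_real ((norm y)\<^sup>2) + (cinner x y + cnj (cinner x y)))"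
    by simp
  then show ?thesis by (simp del: of_real_power)
qed

text \<open>Cauchy-Schwarz read off from the triangle inequality, which the underlying normed space
  already provides.\<close>

lemma Re_cinner_le: "Re (cinner x y) \<le> norm x * norm (y::'a::complex_hilbert_space)"
proof -
  have "(norm (x + y))\<^sup>2 \<le> (norm x + norm y)\<^sup>2"
    by (simp add: norm_triangle_ineq power_mono)
  then show ?thesis by (simp add: norm_add_sq power2_sum)
qed

lemma cmod_cinner_le: "cmod (cinner x y) \<le> norm x * norm (y::'a::complex_hilbert_space)"
proof (cases "cinner x y = 0")
  case False
  \<comment> \<open>A unimodular factor rotates the inner product onto the positive real axis, which
    reduces the claim to the real part.\<close>
  define c where "c = cnj (sgn (cinner x y))"
  have c: "cmod c = 1" using False by (simp add: c_def norm_sgn)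
  have "c * cinner x y = complex_of_real (cmod (cinner x y))"
    using False by (simp add: c_def sgn_eq mult.commute complex_norm_square[symmetric] power2_eq_square)
  then have "cmod (cinner x y) = Re (cinner (c *\<^sub>C x) y)" by (simp add: cinner_scaleC_left)
  also have "\<dots> \<le> norm (c *\<^sub>C x) * norm y" by (rule Re_cinner_le)
  finally show ?thesis by (simp add: norm_scaleC c)
qed simp

lemma bounded_linear_cinner_left: "bounded_linear (\<lambda>x. cinner x (y::'a::complex_hilbert_space))"
  by (rule bounded_linear_intro[of _ "norm y"])
     (simp_all add: cinner_add_left cinner_scaleR_left scaleR_conv_of_real cmod_cinner_le)

lemma bounded_linear_cinner_right: "bounded_linear (\<lambda>y. cinner (x::'a::complex_hilbert_space) y)"
  by (rule bounded_linear_intro[of _ "norm x"])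
     (simp_all add: cinner_add_right cinner_scaleR_right scaleR_conv_of_real cmod_cinner_le mult.commute[of "norm _" "norm x"])

lemma bounded_linear_scaleC: "bounded_linear (\<lambda>x::'a::complex_hilbert_space. c *\<^sub>C x)"
  by (rule bounded_linear_intro[of _ "cmod c"])
     (auto simp: scaleC_add_right norm_scaleC mult.commute scaleR_scaleC scaleC_scaleC)

text \<open>The representing vector minimises \<open>\<parallel>x\<parallel>\<^sup>2 - 2 \<phi> x\<close>; minimising sequences are Cauchy by the
  parallelogram law.\<close>

lemma riesz_representation:
  fixes \<phi> :: "'a::complex_hilbert_space \<Rightarrow> real"
  assumes lin: "bounded_linear \<phi>"
  shows "\<exists>z. \<forall>x. \<phi> x = Re (cinner x z)"
proof -
  interpret \<phi>: bounded_linear \<phi> by fact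
  obtain K where K: "\<And>x. norm (\<phi> x) \<le> norm x * K" using \<phi>.bounded by blast
  define F where "F x = (norm x)\<^sup>2 - 2 * \<phi> x" for x
  have lower: "- K\<^sup>2 \<le> F x" for x
  proof -
    have "0 \<le> (norm x - K)\<^sup>2" by simp
    moreover have "\<phi> x \<le> norm x * K" using K[of x] by simp
    ultimately show ?thesis by (simp add: F_def power2_diff)
  qed
  define I where "I = Inf (range F)"
  have bdd: "bdd_below (range F)" using lower by (auto intro: bdd_belowI[of _ "- K\<^sup>2"])
  have I_le: "I \<le> F x" for x unfolding I_def by (rule cInf_lower[OF _ bdd]) simp
  \<comment> \<open>The value of \<open>F\<close> at the midpoint is at least \<open>I\<close>, so
    the parallelogram law forces two near-minimisers to be close to each other.\<close>
  have par: "(norm (x - y))\<^sup>2 \<le> 2 * (F x - I) + 2 * (F y - I)" for x y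
  proof -
    let ?m = "(1/2) *\<^sub>R (x + y)"
    have "(norm (x - y))\<^sup>2 = (norm x)\<^sup>2 + (norm y)\<^sup>2 - 2 * Re (cinner x y)"
      using norm_add_sq[of x "- y"] by (simp add: cinner_minus_right)
    moreover have "(norm ?m)\<^sup>2 = ((norm x)\<^sup>2 + (norm y)\<^sup>2 + 2 * Re (cinner x y)) / 4"
      by (simp add: power_divide norm_add_sq)
    moreover have "\<phi> ?m = (\<phi> x + \<phi> y) / 2" by (simp only: \<phi>.scaleR \<phi>.add) simp
    moreover have "I \<le> F ?m" by (rule I_le)
    ultimately show ?thesis by (simp add: F_def field_simps)
  qed
  have "\<exists>x. F x < I + inverse (real (Suc n))" for n
    using cInf_lessD[of "range F" "I + inverse (real (Suc n))"] by (auto simp: I_def)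
  then obtain x where x: "\<And>n. F (x n) < I + inverse (real (Suc n))" by metis
  have "Cauchy x"
  proof (rule metric_CauchyI)
    fix e :: real assume "0 < e"
    then obtain M where M: "inverse (real (Suc M)) < e\<^sup>2 / 4"
      using reals_Archimedean[of "e\<^sup>2 / 4"] by auto
    have "dist (x m) (x n) < e" if "m \<ge> M" "n \<ge> M" for m n
    proof -
      have "F (x k) < I + e\<^sup>2 / 4" if "k \<ge> M" for k
      proof -
        have "inverse (real (Suc k)) \<le> inverse (real (Suc M))" using that by (simp add: field_simps)
        then have "inverse (real (Suc k)) < e\<^sup>2 / 4" using M by (rule le_less_trans)
        then have "I + inverse (real (Suc k)) < I + e\<^sup>2 / 4" by (rule add_strict_left_mono)
        then show ?thesis using x[of k] by (rule less_trans[rotated])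
      qed
      from this[OF that(1)] this[OF that(2)] have "(norm (x m - x n))\<^sup>2 < e\<^sup>2"
        using par[of "x m" "x n"] by simp
      then show ?thesis using \<open>0 < e\<close> by (simp add: dist_norm power_less_imp_less_base)
    qed
    then show "\<exists>M. \<forall>m\<ge>M. \<forall>n\<ge>M. dist (x m) (x n) < e" by blast
  qed
  then obtain z where z: "x \<longlonglongrightarrow> z" using Cauchy_convergent convergent_def by blast
  have "(\<lambda>n. F (x n)) \<longlonglongrightarrow> F z"
    unfolding F_def by (intro tendsto_intros z \<phi>.tendsto)
  moreover have "(\<lambda>n. I + inverse (real (Suc n))) \<longlonglongrightarrow> I + 0"
    by (intro tendsto_intros LIMSEQ_inverse_real_of_nat)
  ultimately have Fz: "F z \<le> I"
    using x by (intro LIMSEQ_le[of "\<lambda>n. F (x n)" _ "\<lambda>n. I + inverse (real (Suc n))"]) (auto intro: less_imp_le)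
  have "\<phi> h = Re (cinner h z)" for h
  proof -
    define b where "b = Re (cinner h z) - \<phi> h"
    \<comment> \<open>Varying the minimiser in direction \<open>h\<close> gives a polynomial in
      \<open>t\<close> without constant term that is nowhere negative, so its linear coefficient
      \<open>2 * b\<close> must vanish.\<close>
    have quad: "0 \<le> t\<^sup>2 * (norm h)\<^sup>2 + 2 * t * b" for t
    proof -
      have "F z \<le> F (t *\<^sub>R h + z)" using Fz I_le by (rule order_trans)
      moreover have "F (t *\<^sub>R h + z) = t\<^sup>2 * (norm h)\<^sup>2 + (norm z)\<^sup>2 + 2 * (t * Re (cinner h z)) - 2 * (t * \<phi> h + \<phi> z)"
        by (simp add: F_def norm_add_sq \<phi>.add \<phi>.scaleR power_mult_distrib cinner_scaleR_left)
      ultimately show ?thesis by (simp add: F_def b_def algebra_simps)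
    qed
    have "b = 0"
    proof (cases "norm h = 0")
      case True
      then show ?thesis using quad[of 1] quad[of "-1"] by simp
    next
      case False
      \<comment> \<open>The value inserted for \<open>t\<close> is the vertex of the
        parabola.\<close>
      have "0 \<le> (- b / (norm h)\<^sup>2)\<^sup>2 * (norm h)\<^sup>2 + 2 * (- b / (norm h)\<^sup>2) * b" by (rule quad)
      also have "\<dots> = - (b\<^sup>2 / (norm h)\<^sup>2)" using False by (simp add: field_simps power2_eq_square)
      finally have "b\<^sup>2 / (norm h)\<^sup>2 \<le> 0" by simp
      then show ?thesis using False by (simp add: divide_le_0_iff)
    qed
    then show ?thesis by (simp add: b_def)
  qed
  then show ?thesis by blast
qed

section \<open>Adjoints of bounded operators\<close>

lemma cinner_eqI:
  assumes "\<And>x. cinner x y = cinner x (z::'a::complex_hilbert_space)"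
  shows "y = z"
proof -
  have "cinner (y - z) (y - z) = 0" using assms[of "y - z"] by (simp only: cinner_diff_right) simp
  then show ?thesis by (simp add: cinner_self)
qed

lemma adj_exists:
  assumes T: "T \<in> bounded_clinear_ops"
  shows "\<exists>S. \<forall>x y. cinner (blinfun_apply T x) y = cinner x (blinfun_apply S y)"
proof -
  have T_scale: "T (c *\<^sub>C x) = c *\<^sub>C T x" for c x using T by (simp add: bounded_clinear_ops_def)
  have "\<exists>z. \<forall>x. Re (cinner (T x) y) = Re (cinner x z)" for y
    by (intro riesz_representation bounded_linear_compose[OF bounded_linear_Re]
        bounded_linear_compose[OF bounded_linear_cinner_left] blinfun.bounded_linear_right)
  then obtain g where g: "\<And>x y. Re (cinner (T x) y) = Re (cinner x (g y))" by metis
  \<comment> \<open>So far only real parts are represented; by complex linearity of \<open>T\<close>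
    the real part at \<open>(- \<i>) *\<^sub>C x\<close> is the imaginary part at
    \<open>x\<close>.\<close>
  have g': "cinner (T x) y = cinner x (g y)" for x y
  proof (rule complex_eqI)
    show "Im (cinner (T x) y) = Im (cinner x (g y))"
      using g[of "(- \<i>) *\<^sub>C x" y] by (simp add: T_scale cinner_scaleC_left)
  qed (rule g)
  have "bounded_linear g"
  proof (rule bounded_linear_intro[of _ "norm T"])
    show "g (x + y) = g x + g y" for x y
      by (rule cinner_eqI) (metis g' cinner_add_right)
    show "g (r *\<^sub>R x) = r *\<^sub>R g x" for r x
      by (rule cinner_eqI) (metis g' cinner_scaleR_right)
    show "norm (g y) \<le> norm y * norm T" for y
    proof -
      have "(norm (g y))\<^sup>2 = Re (cinner (g y) (g y))" by (simp add: cinner_self del: of_real_power)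
      also have "\<dots> = Re (cinner (T (g y)) y)" by (simp add: g)
      also have "\<dots> \<le> norm (T (g y)) * norm y" by (rule Re_cinner_le)
      also have "\<dots> \<le> norm T * norm (g y) * norm y" by (intro mult_right_mono norm_blinfun) simp
      finally have "norm (g y) * norm (g y) \<le> norm (g y) * (norm y * norm T)"
        by (simp add: power2_eq_square mult_ac)
      then show ?thesis by (cases "norm (g y) = 0") (auto simp: mult_le_cancel_left)
    qed
  qed
  then show ?thesis using g' by (intro exI[of _ "Blinfun g"]) (simp add: bounded_linear_Blinfun_apply)
qed

text \<open>\<open>adj\<close> is a definite description, so identities about it are proved by
  exhibiting an operator with the defining property.\<close>

lemma adj_unique:
  assumes "\<And>x y. cinner (blinfun_apply T x) y = cinner x (blinfun_apply S y)"
  shows "adj T = S"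
  unfolding adj_def
proof (rule the_equality)
  show "\<forall>x y. cinner (T x) y = cinner x (S y)" using assms by blast
  show "S' = S" if "\<forall>x y. cinner (T x) y = cinner x (blinfun_apply S' y)" for S'
  proof (rule blinfun_eqI, rule cinner_eqI)
    show "cinner x (blinfun_apply S' y) = cinner x (blinfun_apply S y)" for x y
      using that assms by simp
  qed
qed

lemma cinner_adj:
  assumes "T \<in> bounded_clinear_ops"
  shows "cinner (blinfun_apply T x) y = cinner x (blinfun_apply (adj T) y)"
  using adj_exists[OF assms] adj_unique by metis

lemma cinner_adj':
  assumes "T \<in> bounded_clinear_ops"
  shows "cinner (blinfun_apply (adj T) x) y = cinner x (blinfun_apply T y)"
  using cinner_adj[OF assms, of y x] cinner_commute[of "adj T x" y] cinner_commute[of x "T y"] by simp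

lemma adj_clinear:
  assumes "T \<in> bounded_clinear_ops"
  shows "adj T \<in> bounded_clinear_ops"
  unfolding bounded_clinear_ops_def mem_Collect_eq
  by (intro allI, rule cinner_eqI) (simp only: cinner_scaleC_right cinner_adj[OF assms, symmetric])

lemma adj_adj:
  assumes "T \<in> bounded_clinear_ops"
  shows "adj (adj T) = T"
  by (rule adj_unique) (rule cinner_adj'[OF assms])

lemma norm_adj_le:
  assumes "T \<in> bounded_clinear_ops"
  shows "norm (adj T) \<le> norm T"
proof (rule norm_blinfun_bound)
  fix y
  let ?g = "blinfun_apply (adj T) y"
  have "(norm ?g)\<^sup>2 = Re (cinner ?g ?g)" by (simp add: cinner_self del: of_real_power)
  also have "\<dots> = Re (cinner (T ?g) y)" by (simp add: cinner_adj[OF assms])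
  also have "\<dots> \<le> norm (T ?g) * norm y" by (rule Re_cinner_le)
  also have "\<dots> \<le> norm T * norm ?g * norm y" by (intro mult_right_mono norm_blinfun) simp
  finally have "norm ?g * norm ?g \<le> norm ?g * (norm T * norm y)"
    by (simp add: power2_eq_square mult_ac)
  then show "norm ?g \<le> norm T * norm y" by (cases "norm ?g = 0") (auto simp: mult_le_cancel_left)
qed simp

lemma norm_adj:
  assumes "T \<in> bounded_clinear_ops"
  shows "norm (adj T) = norm T"
  using norm_adj_le[OF assms] norm_adj_le[OF adj_clinear[OF assms]] by (simp add: adj_adj[OF assms])

lemma adj_zero [simp]: "adj 0 = 0"
  by (rule adj_unique) simp

lemma adj_add:
  assumes "S \<in> bounded_clinear_ops" "T \<in> bounded_clinear_ops"
  shows "adj (S + T) = adj S + adj T"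
  by (rule adj_unique)
     (simp add: blinfun.add_left cinner_add_left cinner_add_right cinner_adj assms)

lemma blinfun_apply_scaleC:
  "blinfun_apply (Blinfun (\<lambda>x. c *\<^sub>C blinfun_apply T x)) x = c *\<^sub>C blinfun_apply (T::'h::complex_hilbert_space \<Rightarrow>\<^sub>L 'h) x"
  by (subst bounded_linear_Blinfun_apply)
     (auto intro: bounded_linear_compose[OF bounded_linear_scaleC blinfun.bounded_linear_right])

lemma norm_blinfun_scaleC:
  "norm (Blinfun (\<lambda>x. c *\<^sub>C blinfun_apply T x)) = cmod c * norm (T::'h::complex_hilbert_space \<Rightarrow>\<^sub>L 'h)"
proof -
  have le: "norm (Blinfun (\<lambda>x. c *\<^sub>C blinfun_apply T x)) \<le> cmod c * norm T" for c and T :: "'h \<Rightarrow>\<^sub>L 'h"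
    by (rule norm_blinfun_bound)
       (auto simp: blinfun_apply_scaleC norm_scaleC mult.assoc intro!: mult_left_mono norm_blinfun)
  show ?thesis
  proof (cases "c = 0")
    case False
    have "Blinfun (\<lambda>x. inverse c *\<^sub>C blinfun_apply (Blinfun (\<lambda>x. c *\<^sub>C blinfun_apply T x)) x) = T"
      by (rule blinfun_eqI) (simp only: blinfun_apply_scaleC scaleC_scaleC False left_inverse scaleC_one not_False_eq_True blinfun_apply_inverse)
    then have "norm T \<le> cmod (inverse c) * norm (Blinfun (\<lambda>x. c *\<^sub>C blinfun_apply T x))"
      using le[of "inverse c" "Blinfun (\<lambda>x. c *\<^sub>C blinfun_apply T x)"] by simp
    then have "cmod c * norm T \<le> norm (Blinfun (\<lambda>x. c *\<^sub>C blinfun_apply T x))"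
      using False by (simp add: norm_inverse norm_divide field_simps)
    with le[of c T] show ?thesis by simp
  qed (use le[of 0 T] in auto)
qed

lemma adj_scaleC:
  assumes "T \<in> bounded_clinear_ops"
  shows "adj (Blinfun (\<lambda>x. c *\<^sub>C blinfun_apply T x)) = Blinfun (\<lambda>x. cnj c *\<^sub>C blinfun_apply (adj T) x)"
  by (rule adj_unique)
     (simp add: blinfun_apply_scaleC cinner_scaleC_left cinner_scaleC_right cinner_adj assms)

lemma bounded_clinear_ops_closed:
  assumes "S \<in> bounded_clinear_ops" "T \<in> bounded_clinear_ops"
  shows "S + T \<in> bounded_clinear_ops" "S o\<^sub>L T \<in> bounded_clinear_ops"
    "Blinfun (\<lambda>x. c *\<^sub>C blinfun_apply T x) \<in> bounded_clinear_ops"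
  using assms by (auto simp: bounded_clinear_ops_def blinfun.add_left scaleC_add_right
      blinfun_apply_scaleC scaleC_scaleC mult.commute)

lemma zero_clinear [simp]: "0 \<in> bounded_clinear_ops"
  and id_clinear [simp]: "id_blinfun \<in> bounded_clinear_ops"
  by (auto simp: bounded_clinear_ops_def)

section \<open>Schur bounds\<close>

lemma summable_on_of_finite_sums_le:
  fixes f :: "'i \<Rightarrow> real"
  assumes "\<And>x. x \<in> X \<Longrightarrow> 0 \<le> f x" and "\<And>F. finite F \<Longrightarrow> F \<subseteq> X \<Longrightarrow> sum f F \<le> M"
  shows "f summable_on X" "infsum f X \<le> M"
proof -
  show "f summable_on X"
    using assms by (intro nonneg_bdd_above_summable_on) (auto intro!: bdd_aboveI2)
  then show "infsum f X \<le> M" using assms by (intro infsum_le_finite_sums) auto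
qed

lemma sum_infsum_commute:
  fixes g :: "'i \<Rightarrow> 'j \<Rightarrow> real"
  assumes "finite F" and "\<And>l. l \<in> F \<Longrightarrow> (\<lambda>n. g n l) summable_on X"
  shows "(\<lambda>n. \<Sum>l\<in>F. g n l) summable_on X"
    and "(\<Sum>l\<in>F. \<Sum>\<^sub>\<infinity>n\<in>X. g n l) = (\<Sum>\<^sub>\<infinity>n\<in>X. \<Sum>l\<in>F. g n l)"
proof -
  have "(\<lambda>n. \<Sum>l\<in>F. g n l) summable_on X \<and>
      (\<Sum>l\<in>F. \<Sum>\<^sub>\<infinity>n\<in>X. g n l) = (\<Sum>\<^sub>\<infinity>n\<in>X. \<Sum>l\<in>F. g n l)"
    using assms by (induction F rule: finite_induct) (auto simp: infsum_add intro!: summable_on_add)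
  then show "(\<lambda>n. \<Sum>l\<in>F. g n l) summable_on X"
    "(\<Sum>l\<in>F. \<Sum>\<^sub>\<infinity>n\<in>X. g n l) = (\<Sum>\<^sub>\<infinity>n\<in>X. \<Sum>l\<in>F. g n l)" by blast+
qed

text \<open>Absolute summability over \<open>X \<times> X\<close> from iterated bounds. It justifies
  exchanging two infinite sums of vectors, for products of matrices and for adjoints.\<close>

lemma summable_on_product_bound:
  fixes h :: "'i \<Rightarrow> 'i \<Rightarrow> 'b::banach"
  assumes h: "\<And>n l. n \<in> X \<Longrightarrow> l \<in> X \<Longrightarrow> norm (h n l) \<le> u n l"
    and u: "\<And>n. n \<in> X \<Longrightarrow> u n summable_on X" "\<And>n. n \<in> X \<Longrightarrow> infsum (u n) X \<le> v n"
    and v: "v summable_on X"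
  shows "(\<lambda>(n, l). h n l) summable_on (X \<times> X)"
proof -
  have hs: "(\<lambda>l. norm (h n l)) summable_on X" if "n \<in> X" for n
    by (rule summable_on_comparison_test[OF u(1)[OF that] h[OF that]]) auto
  have "(\<lambda>n. norm (\<Sum>\<^sub>\<infinity>l\<in>X. norm (h n l))) summable_on X"
  proof (rule summable_on_comparison_test[OF v])
    fix n assume "n \<in> X"
    then have "(\<Sum>\<^sub>\<infinity>l\<in>X. norm (h n l)) \<le> infsum (u n) X"
      using h u hs by (intro infsum_mono) auto
    then show "norm (\<Sum>\<^sub>\<infinity>l\<in>X. norm (h n l)) \<le> v n"
      using u(2)[OF \<open>n \<in> X\<close>] infsum_nonneg[of X "\<lambda>l. norm (h n l)"] by simp
  qed simp
  then have "(\<lambda>x. norm ((\<lambda>(n, l). h n l) x)) summable_on (X \<times> X)"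
    unfolding Infinite_Sum.abs_summable_on_Sigma_iff using hs by simp
  then show ?thesis by (rule abs_summable_summable)
qed

text \<open>Finite partial sums keep the bound real-valued and free of summability conditions, and
  let it pass to entrywise limits. \<open>W\<close> is an arbitrary function of two indices so that
  the same lemmas serve for \<open>\<nu> (k - l)\<close>, the constant 1, the flattened weight and
  the indicator of a band.\<close>

definition row_le :: "('i \<Rightarrow> 'i \<Rightarrow> real) \<Rightarrow> 'i set \<Rightarrow> real \<Rightarrow> ('i \<Rightarrow> 'i \<Rightarrow> 'b::real_normed_vector) \<Rightarrow> bool"
  where "row_le W X M A \<longleftrightarrow> (\<forall>k\<in>X. \<forall>F. finite F \<and> F \<subseteq> X \<longrightarrow> (\<Sum>l\<in>F. norm (A k l) * W k l) \<le> M)"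

text \<open>Columns are the rows of the transpose, with the weight transposed as well; facts are
  thus proved for rows and applied twice.\<close>

definition schur_le :: "('i \<Rightarrow> 'i \<Rightarrow> real) \<Rightarrow> 'i set \<Rightarrow> real \<Rightarrow> ('i \<Rightarrow> 'i \<Rightarrow> 'b::real_normed_vector) \<Rightarrow> bool"
  where "schur_le W X M A \<longleftrightarrow> row_le W X M A \<and> row_le (\<lambda>k l. W l k) X M (\<lambda>k l. A l k)"

lemma row_leD: "row_le W X M A \<Longrightarrow> k \<in> X \<Longrightarrow> finite F \<Longrightarrow> F \<subseteq> X \<Longrightarrow> (\<Sum>l\<in>F. norm (A k l) * W k l) \<le> M"
  by (simp add: row_le_def)

lemma row_le_summable:
  assumes "row_le W X M A" and "\<And>k l. 0 \<le> W k l" and "k \<in> X"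
  shows "(\<lambda>l. norm (A k l) * W k l) summable_on X" "(\<Sum>\<^sub>\<infinity>l\<in>X. norm (A k l) * W k l) \<le> M"
  using assms by (auto intro!: summable_on_of_finite_sums_le row_leD)

lemma row_le_weight_mono:
  assumes "row_le V X M A" and "\<And>k l. W k l \<le> c * V k l" and "0 \<le> c"
  shows "row_le W X (c * M) A"
  unfolding row_le_def
proof (intro ballI allI impI)
  fix k F assume k: "k \<in> X" and F: "finite F \<and> F \<subseteq> X"
  have "(\<Sum>l\<in>F. norm (A k l) * W k l) \<le> (\<Sum>l\<in>F. norm (A k l) * (c * V k l))"
    using assms by (intro sum_mono mult_left_mono) auto
  also have "\<dots> = c * (\<Sum>l\<in>F. norm (A k l) * V k l)" by (simp add: sum_distrib_left mult_ac)
  also have "\<dots> \<le> c * M" using assms k F row_leD[OF assms(1)] by (intro mult_left_mono) auto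
  finally show "(\<Sum>l\<in>F. norm (A k l) * W k l) \<le> c * M" .
qed

lemma schur_le_weight_mono:
  assumes "schur_le V X M A" and "\<And>k l. W k l \<le> c * V k l" and "0 \<le> c"
  shows "schur_le W X (c * M) A"
  using assms row_le_weight_mono[of V X M A W c]
    row_le_weight_mono[of "\<lambda>k l. V l k" X M "\<lambda>k l. A l k" "\<lambda>k l. W l k" c]
  by (simp add: schur_le_def)

lemma row_le_weight_add:
  assumes "row_le V X M A" "row_le V' X M' A"
    and "\<And>k l. W k l \<le> c * V k l + c' * V' k l" and "0 \<le> c" "0 \<le> c'"
  shows "row_le W X (c * M + c' * M') A"
  unfolding row_le_def
proof (intro ballI allI impI)
  fix k F assume k: "k \<in> X" and F: "finite F \<and> F \<subseteq> X"
  have "(\<Sum>l\<in>F. norm (A k l) * W k l) \<le> (\<Sum>l\<in>F. norm (A k l) * (c * V k l + c' * V' k l))"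
    using assms by (intro sum_mono mult_left_mono) auto
  also have "\<dots> = c * (\<Sum>l\<in>F. norm (A k l) * V k l) + c' * (\<Sum>l\<in>F. norm (A k l) * V' k l)"
    by (simp add: sum_distrib_left sum.distrib algebra_simps)
  also have "\<dots> \<le> c * M + c' * M'"
    using assms k F row_leD[OF assms(1)] row_leD[OF assms(2)] by (intro add_mono mult_left_mono) auto
  finally show "(\<Sum>l\<in>F. norm (A k l) * W k l) \<le> c * M + c' * M'" .
qed

text \<open>This trades a weight for a combination of two: the indicator of a band plus a multiple
  of \<open>\<nu>\<close>, or a constant plus a multiple of \<open>\<nu>\<close>.\<close>

lemma schur_le_weight_add:
  assumes "schur_le V X M A" "schur_le V' X M' A"
    and "\<And>k l. W k l \<le> c * V k l + c' * V' k l" and "0 \<le> c" "0 \<le> c'"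
  shows "schur_le W X (c * M + c' * M') A"
  using assms row_le_weight_add[of V X M A V' M' W c c']
    row_le_weight_add[of "\<lambda>k l. V l k" X M "\<lambda>k l. A l k" "\<lambda>k l. V' l k" M' "\<lambda>k l. W l k" c c']
  by (simp add: schur_le_def)

lemma row_le_mono: "row_le W X M A \<Longrightarrow> M \<le> N \<Longrightarrow> row_le W X N A"
  by (force simp: row_le_def)

lemma schur_le_mono: "schur_le W X M A \<Longrightarrow> M \<le> N \<Longrightarrow> schur_le W X N A"
  by (auto simp: schur_le_def intro: row_le_mono)

lemma schur_le_add:
  assumes "schur_le W X M A" "schur_le W X N B" and "\<And>k l. 0 \<le> W k l"
    and C: "\<And>k l. k \<in> X \<Longrightarrow> l \<in> X \<Longrightarrow> norm (C k l) \<le> norm (A k l) + norm (B k l)"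
  shows "schur_le W X (M + N) C"
proof -
  have row: "row_le W X (M + N) C"
    if A: "row_le W X M A" and B: "row_le W X N B" and W: "\<And>k l. 0 \<le> W k l"
      and C: "\<And>k l. k \<in> X \<Longrightarrow> l \<in> X \<Longrightarrow> norm (C k l) \<le> norm (A k l) + norm (B k l)"
    for W and A :: "'a \<Rightarrow> 'a \<Rightarrow> 'b" and B :: "'a \<Rightarrow> 'a \<Rightarrow> 'c" and C :: "'a \<Rightarrow> 'a \<Rightarrow> 'd"
    unfolding row_le_def
  proof (intro ballI allI impI)
    fix k F assume k: "k \<in> X" and F: "finite F \<and> F \<subseteq> X"
    have "(\<Sum>l\<in>F. norm (C k l) * W k l) \<le> (\<Sum>l\<in>F. (norm (A k l) + norm (B k l)) * W k l)"
      using C k F W by (intro sum_mono mult_right_mono) auto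
    also have "\<dots> \<le> M + N"
      using row_leD[OF A k, of F] row_leD[OF B k, of F] F by (simp add: ring_distribs sum.distrib)
    finally show "(\<Sum>l\<in>F. norm (C k l) * W k l) \<le> M + N" .
  qed
  show ?thesis using assms unfolding schur_le_def by (auto intro!: row)
qed

lemma schur_le_norm_le:
  assumes A: "schur_le W X M A" and "\<And>k l. 0 \<le> W k l" "0 \<le> c"
    and C: "\<And>k l. k \<in> X \<Longrightarrow> l \<in> X \<Longrightarrow> norm (C k l) \<le> c * norm (A k l)"
  shows "schur_le W X (c * M) C"
proof -
  have row: "row_le W X (c * M) C"
    if A: "row_le W X M A" and W: "\<And>k l. 0 \<le> W k l"
      and C: "\<And>k l. k \<in> X \<Longrightarrow> l \<in> X \<Longrightarrow> norm (C k l) \<le> c * norm (A k l)"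
    for W and A :: "'a \<Rightarrow> 'a \<Rightarrow> 'b" and C :: "'a \<Rightarrow> 'a \<Rightarrow> 'c"
    unfolding row_le_def
  proof (intro ballI allI impI)
    fix k F assume k: "k \<in> X" and F: "finite F \<and> F \<subseteq> X"
    have "(\<Sum>l\<in>F. norm (C k l) * W k l) \<le> (\<Sum>l\<in>F. c * norm (A k l) * W k l)"
      using C k F W by (intro sum_mono mult_right_mono) auto
    also have "\<dots> = c * (\<Sum>l\<in>F. norm (A k l) * W k l)" by (simp add: sum_distrib_left mult_ac)
    also have "\<dots> \<le> c * M" using row_leD[OF A k, of F] F \<open>0 \<le> c\<close> by (intro mult_left_mono) auto
    finally show "(\<Sum>l\<in>F. norm (C k l) * W k l) \<le> c * M" .
  qed
  show ?thesis using assms unfolding schur_le_def by (auto intro!: row)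
qed

lemma schur_le_entry:
  assumes "schur_le (\<lambda>_ _. 1) X M A" "k \<in> X" "l \<in> X"
  shows "norm (A k l) \<le> M"
  using assms row_leD[of "\<lambda>_ _. 1" X M A k "{l}"] by (simp add: schur_le_def)

lemma schur_le_summable:
  assumes "schur_le (\<lambda>_ _. 1) X M A"
  shows "k \<in> X \<Longrightarrow> (\<lambda>l. norm (A k l)) summable_on X" "k \<in> X \<Longrightarrow> (\<Sum>\<^sub>\<infinity>l\<in>X. norm (A k l)) \<le> M"
    "l \<in> X \<Longrightarrow> (\<lambda>k. norm (A k l)) summable_on X" "l \<in> X \<Longrightarrow> (\<Sum>\<^sub>\<infinity>k\<in>X. norm (A k l)) \<le> M"
  using assms row_le_summable[of "\<lambda>_ _. 1" X M A k] row_le_summable[of "\<lambda>_ _. 1" X M "\<lambda>k l. A l k" l]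
  by (auto simp: schur_le_def)

text \<open>The entries of \<open>B\<close> are at most \<open>N\<close>, so \<open>N\<close> times
  a row of \<open>A\<close> dominates.\<close>

lemma schur_le_product_summable:
  assumes A: "schur_le (\<lambda>_ _. 1) X M A" and B: "schur_le (\<lambda>_ _. 1) X N B" and kl: "k \<in> X" "l \<in> X"
  shows "(\<lambda>n. norm (A k n) * norm (B n l)) summable_on X"
  using kl schur_le_entry[OF B]
  by (intro summable_on_comparison_test[OF summable_on_cmult_left[OF schur_le_summable(1)[OF A], of _ N]])
     (auto intro: mult_left_mono)

text \<open>Submultiplicativity distributes the weight over the two factors. Since \<open>F\<close>
  is finite, moving the sum over \<open>F\<close> inside the sum over \<open>n\<close> is plain
  additivity and no Fubini argument.\<close>

lemma row_le_product:
  assumes W: "\<And>k l. 0 \<le> W k l" "\<And>k n l. W k l \<le> W k n * W n l"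
    and A: "row_le W X M A" and B: "row_le W X N B" and "0 \<le> N"
    and summ: "\<And>k l. k \<in> X \<Longrightarrow> l \<in> X \<Longrightarrow> (\<lambda>n. norm (A k n) * norm (B n l)) summable_on X"
    and C: "\<And>k l. k \<in> X \<Longrightarrow> l \<in> X \<Longrightarrow> norm (C k l) \<le> (\<Sum>\<^sub>\<infinity>n\<in>X. norm (A k n) * norm (B n l))"
  shows "row_le W X (M * N) C"
  unfolding row_le_def
proof (intro ballI allI impI)
  fix k F assume k: "k \<in> X" and F: "finite F \<and> F \<subseteq> X"
  let ?g = "\<lambda>n l. norm (A k n) * norm (B n l) * W k l"
  have summ': "(\<lambda>n. ?g n l) summable_on X" if "l \<in> F" for l
    using summ[of k l] k F that by (intro summable_on_cmult_left) auto
  have "(\<Sum>l\<in>F. norm (C k l) * W k l) \<le> (\<Sum>l\<in>F. (\<Sum>\<^sub>\<infinity>n\<in>X. norm (A k n) * norm (B n l)) * W k l)"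
    using C k F W by (intro sum_mono mult_right_mono) auto
  also have "\<dots> = (\<Sum>l\<in>F. \<Sum>\<^sub>\<infinity>n\<in>X. ?g n l)"
    using summ k F by (intro sum.cong infsum_cmult_left[symmetric]) auto
  also have "\<dots> = (\<Sum>\<^sub>\<infinity>n\<in>X. \<Sum>l\<in>F. ?g n l)" using F summ' by (intro sum_infsum_commute) auto
  also have "\<dots> \<le> (\<Sum>\<^sub>\<infinity>n\<in>X. norm (A k n) * W k n * N)"
  proof (rule infsum_mono)
    show "(\<lambda>n. \<Sum>l\<in>F. ?g n l) summable_on X" using F summ' by (intro sum_infsum_commute) auto
    show "(\<lambda>n. norm (A k n) * W k n * N) summable_on X"
      using row_le_summable[OF A W(1) k] by (intro summable_on_cmult_left) auto
    show "(\<Sum>l\<in>F. ?g n l) \<le> norm (A k n) * W k n * N" if n: "n \<in> X" for n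
    proof -
      have "(\<Sum>l\<in>F. ?g n l) \<le> (\<Sum>l\<in>F. norm (A k n) * norm (B n l) * (W k n * W n l))"
        using W by (intro sum_mono mult_left_mono) auto
      also have "\<dots> = norm (A k n) * W k n * (\<Sum>l\<in>F. norm (B n l) * W n l)"
        by (simp add: sum_distrib_left mult_ac)
      also have "\<dots> \<le> norm (A k n) * W k n * N"
        using row_leD[OF B n, of F] F W by (intro mult_left_mono) auto
      finally show ?thesis .
    qed
  qed
  also have "\<dots> = (\<Sum>\<^sub>\<infinity>n\<in>X. norm (A k n) * W k n) * N"
    using row_le_summable[OF A W(1) k] by (intro infsum_cmult_left) auto
  also have "\<dots> \<le> M * N" using row_le_summable[OF A W(1) k] \<open>0 \<le> N\<close> by (intro mult_right_mono) auto
  finally show "(\<Sum>l\<in>F. norm (C k l) * W k l) \<le> M * N" .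
qed

lemma schur_le_product:
  assumes W: "\<And>k l. 0 \<le> W k l" "\<And>k n l. W k l \<le> W k n * W n l"
    and A: "schur_le W X M A" and B: "schur_le W X N B" and "0 \<le> M" "0 \<le> N"
    and summ: "\<And>k l. k \<in> X \<Longrightarrow> l \<in> X \<Longrightarrow> (\<lambda>n. norm (A k n) * norm (B n l)) summable_on X"
    and C: "\<And>k l. k \<in> X \<Longrightarrow> l \<in> X \<Longrightarrow> norm (C k l) \<le> (\<Sum>\<^sub>\<infinity>n\<in>X. norm (A k n) * norm (B n l))"
  shows "schur_le W X (M * N) C"
proof -
  have "row_le W X (M * N) C"
    using A B C W \<open>0 \<le> N\<close> summ by (intro row_le_product[of W X M A N B]) (auto simp: schur_le_def)
  moreover have W': "W l k \<le> W n k * W l n" for k l n using W(2)[of l k n] by (simp add: mult.commute)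
  have "row_le (\<lambda>k l. W l k) X (N * M) (\<lambda>k l. C l k)"
  proof (rule row_le_product[of _ X N "\<lambda>k l. B l k" M "\<lambda>k l. A l k"])
    show "(\<lambda>n. norm (B n k) * norm (A l n)) summable_on X" if "k \<in> X" "l \<in> X" for k l
      using summ[OF that(2,1)] by (simp only: mult.commute)
    show "norm (C l k) \<le> (\<Sum>\<^sub>\<infinity>n\<in>X. norm (B n k) * norm (A l n))" if "k \<in> X" "l \<in> X" for k l
      using C[OF that(2,1)] by (simp only: mult.commute)
  qed (use A B W(1) W' \<open>0 \<le> M\<close> in \<open>simp_all add: schur_le_def\<close>)
  ultimately show ?thesis by (simp add: schur_le_def mult.commute)
qed

text \<open>The bridge between the norm of the definition, a supremum in \<open>ennreal\<close>, and
  the real bounds used in all estimates.\<close>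

lemma schur_norm_le_iff:
  fixes X :: "(real ^ 'n) set"
  assumes \<nu>: "\<And>x. 0 \<le> \<nu> x" and M: "0 \<le> M"
  shows "schur_norm \<nu> X A \<le> ennreal M \<longleftrightarrow> schur_le (\<lambda>k l. \<nu> (k - l)) X M A"
proof -
  have *: "(\<Sum>\<^sub>\<infinity>l\<in>X. ennreal (g l)) \<le> ennreal M \<longleftrightarrow> (\<forall>F. finite F \<and> F \<subseteq> X \<longrightarrow> sum g F \<le> M)"
    if "\<And>l. 0 \<le> g l" for g :: "real ^ 'n \<Rightarrow> real"
    using that M by (subst nonneg_infsum_complete) (auto simp: SUP_le_iff sum_ennreal sum_nonneg)
  have "schur_norm \<nu> X A \<le> ennreal M \<longleftrightarrow>
      (\<forall>k\<in>X. (\<Sum>\<^sub>\<infinity>l\<in>X. ennreal (norm (A k l) * \<nu> (k - l))) \<le> ennreal M) \<and>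
      (\<forall>l\<in>X. (\<Sum>\<^sub>\<infinity>k\<in>X. ennreal (norm (A k l) * \<nu> (k - l))) \<le> ennreal M)"
    unfolding schur_norm_def by (simp add: SUP_le_iff)
  also have "\<dots> \<longleftrightarrow> schur_le (\<lambda>k l. \<nu> (k - l)) X M A"
    using \<nu> by (subst (1 2) *) (auto simp: schur_le_def row_le_def)
  finally show ?thesis .
qed

text \<open>Cauchy-Schwarz for the splitting of \<open>a k l * x l\<close> into
  \<open>sqrt (a k l)\<close> and \<open>sqrt (a k l) * x l\<close>: the row bound gives one factor
  \<open>M\<close>, and summing over \<open>k\<close> with the column bound gives the other.\<close>

lemma schur_test:
  fixes a :: "'i \<Rightarrow> 'i \<Rightarrow> real" and x :: "'i \<Rightarrow> real"
  assumes a: "\<And>k l. 0 \<le> a k l" and x: "\<And>l. 0 \<le> x l" and "0 \<le> M"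
    and A: "schur_le (\<lambda>_ _. 1) X M a"
    and sq: "(\<lambda>l. (x l)\<^sup>2) summable_on X"
  shows "k \<in> X \<Longrightarrow> (\<lambda>l. a k l * x l) summable_on X"
    and "(\<lambda>k. (\<Sum>\<^sub>\<infinity>l\<in>X. a k l * x l)\<^sup>2) summable_on X"
    and "(\<Sum>\<^sub>\<infinity>k\<in>X. (\<Sum>\<^sub>\<infinity>l\<in>X. a k l * x l)\<^sup>2) \<le> M\<^sup>2 * (\<Sum>\<^sub>\<infinity>l\<in>X. (x l)\<^sup>2)"
proof -
  have ax_sq: "(\<lambda>l. a k l * (x l)\<^sup>2) summable_on X" if "k \<in> X" for k
    using that a schur_le_entry[OF A]
    by (intro summable_on_comparison_test[OF summable_on_cmult_right[OF sq, of M]])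
       (auto simp: intro: mult_right_mono)
  have ax: "(\<lambda>l. a k l * x l) summable_on X \<and> (\<Sum>\<^sub>\<infinity>l\<in>X. a k l * x l)\<^sup>2 \<le> M * (\<Sum>\<^sub>\<infinity>l\<in>X. a k l * (x l)\<^sup>2)"
    if k: "k \<in> X" for k
  proof -
    let ?S = "\<Sum>\<^sub>\<infinity>l\<in>X. a k l * (x l)\<^sup>2"
    have S: "0 \<le> ?S" using a by (intro infsum_nonneg) auto
    have fin: "(\<Sum>l\<in>F. a k l * x l) \<le> sqrt (M * ?S)" if F: "finite F" "F \<subseteq> X" for F
    proof -
      have "(\<Sum>l\<in>F. a k l * x l) = (\<Sum>l\<in>F. \<bar>sqrt (a k l)\<bar> * \<bar>sqrt (a k l) * x l\<bar>)"
        using a x by (intro sum.cong) (auto simp flip: mult.assoc)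
      also have "\<dots> \<le> L2_set (\<lambda>l. sqrt (a k l)) F * L2_set (\<lambda>l. sqrt (a k l) * x l) F"
        by (rule L2_set_mult_ineq)
      also have "\<dots> = sqrt ((\<Sum>l\<in>F. a k l) * (\<Sum>l\<in>F. a k l * (x l)\<^sup>2))"
        using a by (simp add: L2_set_def power_mult_distrib real_sqrt_mult)
      also have "\<dots> \<le> sqrt (M * ?S)"
      proof (intro real_sqrt_le_mono mult_mono)
        show "(\<Sum>l\<in>F. a k l) \<le> M"
          using A row_leD[of "\<lambda>_ _. 1" X M a k F] F k a by (simp add: schur_le_def)
        show "(\<Sum>l\<in>F. a k l * (x l)\<^sup>2) \<le> ?S"
          using F a ax_sq[OF k] by (intro finite_sum_le_infsum) auto
      qed (use a \<open>0 \<le> M\<close> in \<open>auto intro: sum_nonneg\<close>)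
      finally show ?thesis .
    qed
    have nn: "0 \<le> a k l * x l" for l using a x by simp
    have "(\<Sum>\<^sub>\<infinity>l\<in>X. a k l * x l)\<^sup>2 \<le> (sqrt (M * ?S))\<^sup>2"
      by (intro power_mono summable_on_of_finite_sums_le(2)[OF nn fin] infsum_nonneg nn)
    then show ?thesis using summable_on_of_finite_sums_le(1)[OF nn fin] S \<open>0 \<le> M\<close> by simp
  qed
  then show "k \<in> X \<Longrightarrow> (\<lambda>l. a k l * x l) summable_on X" by blast
  have fin: "(\<Sum>k\<in>F. (\<Sum>\<^sub>\<infinity>l\<in>X. a k l * x l)\<^sup>2) \<le> M\<^sup>2 * (\<Sum>\<^sub>\<infinity>l\<in>X. (x l)\<^sup>2)" if F: "finite F" "F \<subseteq> X" for F
  proof -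
    have "(\<Sum>k\<in>F. (\<Sum>\<^sub>\<infinity>l\<in>X. a k l * x l)\<^sup>2) \<le> (\<Sum>k\<in>F. M * (\<Sum>\<^sub>\<infinity>l\<in>X. a k l * (x l)\<^sup>2))"
      using ax F by (intro sum_mono) auto
    also have "\<dots> = M * (\<Sum>k\<in>F. \<Sum>\<^sub>\<infinity>l\<in>X. a k l * (x l)\<^sup>2)" by (simp add: sum_distrib_left)
    also have "(\<Sum>k\<in>F. \<Sum>\<^sub>\<infinity>l\<in>X. a k l * (x l)\<^sup>2) = (\<Sum>\<^sub>\<infinity>l\<in>X. \<Sum>k\<in>F. a k l * (x l)\<^sup>2)"
      using F ax_sq by (intro sum_infsum_commute) auto
    also have "\<dots> \<le> (\<Sum>\<^sub>\<infinity>l\<in>X. M * (x l)\<^sup>2)"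
    proof (rule infsum_mono)
      show "(\<lambda>l. \<Sum>k\<in>F. a k l * (x l)\<^sup>2) summable_on X"
        using F ax_sq by (intro sum_infsum_commute) auto
      show "(\<lambda>l. M * (x l)\<^sup>2) summable_on X" by (intro summable_on_cmult_right sq)
      show "(\<Sum>k\<in>F. a k l * (x l)\<^sup>2) \<le> M * (x l)\<^sup>2" if "l \<in> X" for l
        using A row_leD[of "\<lambda>_ _. 1" X M "\<lambda>k l. a l k" l F] F that a
        by (auto simp: schur_le_def simp flip: sum_distrib_right intro!: mult_right_mono)
    qed
    also have "\<dots> = M * (\<Sum>\<^sub>\<infinity>l\<in>X. (x l)\<^sup>2)" by (intro infsum_cmult_right sq)
    finally show ?thesis using \<open>0 \<le> M\<close> by (simp add: power2_eq_square mult_left_mono mult.assoc)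
  qed
  show "(\<lambda>k. (\<Sum>\<^sub>\<infinity>l\<in>X. a k l * x l)\<^sup>2) summable_on X"
    and "(\<Sum>\<^sub>\<infinity>k\<in>X. (\<Sum>\<^sub>\<infinity>l\<in>X. a k l * x l)\<^sup>2) \<le> M\<^sup>2 * (\<Sum>\<^sub>\<infinity>l\<in>X. (x l)\<^sup>2)"
    by (rule summable_on_of_finite_sums_le[OF _ fin]; simp)+
qed

section \<open>Square-summable families and matrix operators\<close>

lemma norm_sq_add_scaleR:
  "(norm (x + r *\<^sub>R y))\<^sup>2 = (norm x)\<^sup>2 + 2 * r * Re (cinner x y) + r\<^sup>2 * (norm (y::'a::complex_hilbert_space))\<^sup>2"
  by (simp add: norm_add_sq cinner_scaleR_right power_mult_distrib)

lemma summable_on_norm_le: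
  fixes h :: "'i \<Rightarrow> 'b::banach"
  assumes "u summable_on X" and "\<And>n. n \<in> X \<Longrightarrow> norm (h n) \<le> u n"
  shows "h summable_on X" "norm (infsum h X) \<le> infsum u X"
proof -
  have *: "(\<lambda>n. norm (h n)) summable_on X"
    by (rule summable_on_comparison_test[OF assms]) auto
  then show "h summable_on X" by (rule abs_summable_summable)
  have "norm (infsum h X) \<le> (\<Sum>\<^sub>\<infinity>n\<in>X. norm (h n))" by (rule norm_infsum_bound[OF *])
  also have "\<dots> \<le> infsum u X" using assms * by (intro infsum_mono) auto
  finally show "norm (infsum h X) \<le> infsum u X" .
qed

lemma cauchy_schwarz_infsum:
  fixes x y :: "'i \<Rightarrow> real"
  assumes x: "\<And>l. 0 \<le> x l" "(\<lambda>l. (x l)\<^sup>2) summable_on X" and y: "\<And>l. 0 \<le> y l" "(\<lambda>l. (y l)\<^sup>2) summable_on X"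
  shows "(\<lambda>l. x l * y l) summable_on X"
    and "(\<Sum>\<^sub>\<infinity>l\<in>X. x l * y l) \<le> sqrt (\<Sum>\<^sub>\<infinity>l\<in>X. (x l)\<^sup>2) * sqrt (\<Sum>\<^sub>\<infinity>l\<in>X. (y l)\<^sup>2)"
proof -
  have fin: "(\<Sum>l\<in>F. x l * y l) \<le> sqrt (\<Sum>\<^sub>\<infinity>l\<in>X. (x l)\<^sup>2) * sqrt (\<Sum>\<^sub>\<infinity>l\<in>X. (y l)\<^sup>2)"
    if F: "finite F" "F \<subseteq> X" for F
  proof -
    have "(\<Sum>l\<in>F. x l * y l) \<le> L2_set x F * L2_set y F"
      using L2_set_mult_ineq[of x y F] x y by simp
    also have "\<dots> \<le> sqrt (\<Sum>\<^sub>\<infinity>l\<in>X. (x l)\<^sup>2) * sqrt (\<Sum>\<^sub>\<infinity>l\<in>X. (y l)\<^sup>2)"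
      unfolding L2_set_def using F x y
      by (intro mult_mono real_sqrt_le_mono finite_sum_le_infsum) (auto intro: infsum_nonneg sum_nonneg)
    finally show ?thesis .
  qed
  show "(\<lambda>l. x l * y l) summable_on X"
    and "(\<Sum>\<^sub>\<infinity>l\<in>X. x l * y l) \<le> sqrt (\<Sum>\<^sub>\<infinity>l\<in>X. (x l)\<^sup>2) * sqrt (\<Sum>\<^sub>\<infinity>l\<in>X. (y l)\<^sup>2)"
    by (rule summable_on_of_finite_sums_le[OF _ fin]; use x y in simp)+
qed

lemma ell2_summable: "f \<in> ell2 X \<Longrightarrow> (\<lambda>k. (norm (f k))\<^sup>2) summable_on X"
  by (simp add: ell2_def)

lemma ell2_outside: "f \<in> ell2 X \<Longrightarrow> k \<notin> X \<Longrightarrow> f k = 0"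
  by (simp add: ell2_def)

lemma ell2_norm_nonneg: "0 \<le> ell2_norm X f"
  by (simp add: ell2_norm_def infsum_nonneg)

lemma ell2_norm_sq: "(ell2_norm X f)\<^sup>2 = (\<Sum>\<^sub>\<infinity>k\<in>X. (norm (f k))\<^sup>2)"
  by (simp add: ell2_norm_def infsum_nonneg)

lemma norm_le_ell2_norm:
  assumes "f \<in> ell2 X" "k \<in> X"
  shows "norm (f k) \<le> ell2_norm X f"
proof -
  have "(\<Sum>j\<in>{k}. (norm (f j))\<^sup>2) \<le> (\<Sum>\<^sub>\<infinity>k\<in>X. (norm (f k))\<^sup>2)"
    using assms by (intro finite_sum_le_infsum ell2_summable) auto
  then show ?thesis by (simp add: ell2_norm_def real_le_rsqrt)
qed

lemma ell2_zero [simp]: "(\<lambda>k. 0) \<in> ell2 X"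
  by (simp add: ell2_def)

lemma ell2_add:
  assumes "f \<in> ell2 X" "g \<in> ell2 X"
  shows "(\<lambda>k. f k + g k) \<in> ell2 X"
proof -
  have "(\<lambda>k. (norm (f k + g k))\<^sup>2) summable_on X"
  proof (rule summable_on_comparison_test)
    show "(\<lambda>k. 2 * (norm (f k))\<^sup>2 + 2 * (norm (g k))\<^sup>2) summable_on X"
      using assms by (intro summable_on_add summable_on_cmult_right ell2_summable)
    show "(norm (f k + g k))\<^sup>2 \<le> 2 * (norm (f k))\<^sup>2 + 2 * (norm (g k))\<^sup>2" for k
    proof -
      have "(norm (f k + g k))\<^sup>2 \<le> (norm (f k) + norm (g k))\<^sup>2"
        by (intro power_mono norm_triangle_ineq) auto
      also have "\<dots> \<le> 2 * (norm (f k))\<^sup>2 + 2 * (norm (g k))\<^sup>2"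
        using zero_le_power2[of "norm (f k) - norm (g k)"] by (simp add: power2_sum power2_diff)
      finally show ?thesis .
    qed
  qed simp
  then show ?thesis using assms by (simp add: ell2_def)
qed

lemma ell2_scaleC:
  assumes "f \<in> ell2 X"
  shows "(\<lambda>k. c *\<^sub>C f k) \<in> ell2 X"
  using assms by (auto simp: ell2_def norm_scaleC power_mult_distrib intro: summable_on_cmult_right)

lemma ell2_single:
  assumes "k \<in> X"
  shows "(\<lambda>j. if j = k then h else 0) \<in> ell2 X" "ell2_norm X (\<lambda>j. if j = k then h else 0) = norm h"
proof -
  have *: "((\<lambda>j. (norm (if j = k then h else 0))\<^sup>2) has_sum (norm h)\<^sup>2) X"
    using assms by (intro has_sum_finite_neutralI[of "{k}"]) auto
  then show "(\<lambda>j. if j = k then h else 0) \<in> ell2 X"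
    using assms by (auto simp: ell2_def summable_on_def)
  show "ell2_norm X (\<lambda>j. if j = k then h else 0) = norm h"
    using infsumI[OF *] by (simp add: ell2_norm_def)
qed

section \<open>The inner product of square-summable families\<close>

definition ell2_inner :: "'i set \<Rightarrow> ('i \<Rightarrow> 'h::complex_hilbert_space) \<Rightarrow> ('i \<Rightarrow> 'h) \<Rightarrow> complex"
  where "ell2_inner X f g = (\<Sum>\<^sub>\<infinity>k\<in>X. cinner (f k) (g k))"

lemma ell2_inner_summable:
  assumes "f \<in> ell2 X" "g \<in> ell2 X"
  shows "(\<lambda>k. cinner (f k) (g k)) summable_on X"
    and "cmod (ell2_inner X f g) \<le> ell2_norm X f * ell2_norm X g"
proof -
  have s: "(\<lambda>k. norm (f k) * norm (g k)) summable_on X"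
    and le: "(\<Sum>\<^sub>\<infinity>k\<in>X. norm (f k) * norm (g k)) \<le> ell2_norm X f * ell2_norm X g"
    unfolding ell2_norm_def using assms by (auto intro!: cauchy_schwarz_infsum ell2_summable)
  show "(\<lambda>k. cinner (f k) (g k)) summable_on X"
    by (rule summable_on_norm_le(1)[OF s cmod_cinner_le])
  show "cmod (ell2_inner X f g) \<le> ell2_norm X f * ell2_norm X g"
    unfolding ell2_inner_def using summable_on_norm_le(2)[OF s cmod_cinner_le] le by (rule order_trans)
qed

lemma ell2_inner_diff_left:
  assumes "f \<in> ell2 X" "g \<in> ell2 X" "h \<in> ell2 X"
  shows "ell2_inner X (\<lambda>k. f k - g k) h = ell2_inner X f h - ell2_inner X g h"
  unfolding ell2_inner_def cinner_diff_left
  using assms infsum_add[OF ell2_inner_summable(1)[OF assms(1,3)]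
      summable_on_uminus[THEN iffD2, OF ell2_inner_summable(1)[OF assms(2,3)]]]
  by (simp add: infsum_uminus)

lemma ell2_inner_scaleC_left:
  "ell2_inner X (\<lambda>k. c *\<^sub>C f k) g = c * ell2_inner X f g"
  unfolding ell2_inner_def cinner_scaleC_left by (simp add: infsum_cmult_right')

lemma ell2_inner_self:
  assumes "f \<in> ell2 X"
  shows "ell2_inner X f f = complex_of_real ((ell2_norm X f)\<^sup>2)"
  unfolding ell2_inner_def cinner_self ell2_norm_sq
  by (rule infsumI, rule has_sum_of_real, rule has_sum_infsum, rule ell2_summable[OF assms])

lemma ell2_norm_sq_add_scaleR:
  assumes f: "f \<in> ell2 X" and g: "g \<in> ell2 X"
  shows "(ell2_norm X (\<lambda>k. f k + r *\<^sub>R g k))\<^sup>2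
      = (ell2_norm X f)\<^sup>2 + 2 * r * Re (ell2_inner X f g) + r\<^sup>2 * (ell2_norm X g)\<^sup>2"
proof -
  note s = ell2_summable[OF f] ell2_summable[OF g] summable_on_Re[OF ell2_inner_summable(1)[OF f g]]
  have "(\<Sum>\<^sub>\<infinity>k\<in>X. (norm (f k + r *\<^sub>R g k))\<^sup>2)
      = (\<Sum>\<^sub>\<infinity>k\<in>X. ((norm (f k))\<^sup>2 + 2 * r * Re (cinner (f k) (g k))) + r\<^sup>2 * (norm (g k))\<^sup>2)"
    by (simp add: norm_sq_add_scaleR)
  also have "\<dots> = (\<Sum>\<^sub>\<infinity>k\<in>X. (norm (f k))\<^sup>2) + (\<Sum>\<^sub>\<infinity>k\<in>X. 2 * r * Re (cinner (f k) (g k)))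
      + (\<Sum>\<^sub>\<infinity>k\<in>X. r\<^sup>2 * (norm (g k))\<^sup>2)"
    using s by (simp add: infsum_add summable_on_add summable_on_cmult_right)
  also have "\<dots> = (ell2_norm X f)\<^sup>2 + 2 * r * Re (ell2_inner X f g) + r\<^sup>2 * (ell2_norm X g)\<^sup>2"
    using infsum_Re[OF ell2_inner_summable(1)[OF f g]]
    by (simp add: infsum_cmult_right' ell2_norm_sq ell2_inner_def)
  finally show ?thesis by (simp add: ell2_norm_sq)
qed

section \<open>Operators given by Schur-bounded matrices\<close>

lemma matrix_op_apply: "f \<in> ell2 X \<Longrightarrow> matrix_op X A f k = (\<Sum>\<^sub>\<infinity>l\<in>X. blinfun_apply (A k l) (f l))"
  by (simp add: matrix_op_def)

text \<open>Families supported at one point read off the entries. Injectivity of the representation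
  and the bound of entries by the operator norm rest on this.\<close>

lemma matrix_op_single:
  assumes "l \<in> X"
  shows "matrix_op X A (\<lambda>j. if j = l then h else 0) k = blinfun_apply (A k l) h"
proof -
  have "((\<lambda>j. blinfun_apply (A k j) (if j = l then h else 0)) has_sum blinfun_apply (A k l) h) X"
    using assms by (intro has_sum_finite_neutralI[of "{l}"]) (auto simp: if_distrib)
  then show ?thesis unfolding matrix_op_apply[OF ell2_single(1)[OF assms]] by (rule infsumI)
qed

context
  fixes X :: "(real ^ 'n) set" and A :: "('n::finite, 'h::complex_hilbert_space) op_matrix" and M :: real
  assumes A: "schur_le (\<lambda>_ _. 1) X M A" and M: "0 \<le> M"
begin

lemma schur_le_norms: "schur_le (\<lambda>_ _. 1) X M (\<lambda>k l. norm (A k l))"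
  using A by (simp add: schur_le_def row_le_def)

lemma matrix_op_schur_test:
  assumes f: "f \<in> ell2 X"
  shows "k \<in> X \<Longrightarrow> (\<lambda>l. norm (A k l) * norm (f l)) summable_on X"
    and "(\<lambda>k. (\<Sum>\<^sub>\<infinity>l\<in>X. norm (A k l) * norm (f l))\<^sup>2) summable_on X"
    and "(\<Sum>\<^sub>\<infinity>k\<in>X. (\<Sum>\<^sub>\<infinity>l\<in>X. norm (A k l) * norm (f l))\<^sup>2) \<le> M\<^sup>2 * (ell2_norm X f)\<^sup>2"
  using schur_test[OF norm_ge_zero norm_ge_zero M schur_le_norms ell2_summable[OF f]]
  by (simp_all add: ell2_norm_sq)

lemma matrix_op_summable:
  assumes f: "f \<in> ell2 X" and k: "k \<in> X"
  shows "(\<lambda>l. blinfun_apply (A k l) (f l)) summable_on X"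
    and "norm (matrix_op X A f k) \<le> (\<Sum>\<^sub>\<infinity>l\<in>X. norm (A k l) * norm (f l))"
  using summable_on_norm_le[OF matrix_op_schur_test(1)[OF f k] norm_blinfun]
  by (simp_all add: matrix_op_apply f)

lemma matrix_op_ell2:
  assumes f: "f \<in> ell2 X" and van: "\<And>k l. k \<notin> X \<Longrightarrow> A k l = 0"
  shows "matrix_op X A f \<in> ell2 X" "ell2_norm X (matrix_op X A f) \<le> M * ell2_norm X f"
proof -
  have le: "(norm (matrix_op X A f k))\<^sup>2 \<le> (\<Sum>\<^sub>\<infinity>l\<in>X. norm (A k l) * norm (f l))\<^sup>2" if "k \<in> X" for k
    using matrix_op_summable(2)[OF f that] by (intro power_mono) auto
  have s: "(\<lambda>k. (norm (matrix_op X A f k))\<^sup>2) summable_on X"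
    by (rule summable_on_comparison_test[OF matrix_op_schur_test(2)[OF f] le]) auto
  then show "matrix_op X A f \<in> ell2 X" using van by (simp add: ell2_def matrix_op_apply[OF f])
  have "(ell2_norm X (matrix_op X A f))\<^sup>2 \<le> (\<Sum>\<^sub>\<infinity>k\<in>X. (\<Sum>\<^sub>\<infinity>l\<in>X. norm (A k l) * norm (f l))\<^sup>2)"
    unfolding ell2_norm_sq by (rule infsum_mono[OF s matrix_op_schur_test(2)[OF f] le])
  also have "\<dots> \<le> (M * ell2_norm X f)\<^sup>2" using matrix_op_schur_test(3)[OF f] by (simp add: power_mult_distrib)
  finally show "ell2_norm X (matrix_op X A f) \<le> M * ell2_norm X f"
    using M ell2_norm_nonneg[of X f] by (simp add: power2_le_iff_abs_le)
qed

lemma bounded_ell2_op_matrix_op: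
  assumes van: "\<And>k l. k \<notin> X \<Longrightarrow> A k l = 0" and clin: "\<And>k l. A k l \<in> bounded_clinear_ops"
  shows "bounded_ell2_op X (matrix_op X A)"
  unfolding bounded_ell2_op_def
proof (intro conjI ballI allI impI)
  fix f g :: "real ^ 'n \<Rightarrow> 'h" and c assume f: "f \<in> ell2 X" and g: "g \<in> ell2 X"
  show "matrix_op X A (\<lambda>k. f k + g k) = (\<lambda>k. matrix_op X A f k + matrix_op X A g k)"
  proof
    fix k
    show "matrix_op X A (\<lambda>k. f k + g k) k = matrix_op X A f k + matrix_op X A g k"
    proof (cases "k \<in> X")
      case True
      then show ?thesis using f g
        by (simp add: matrix_op_apply ell2_add blinfun.add_right infsum_add matrix_op_summable)
    qed (use f g in \<open>simp add: matrix_op_apply ell2_add van\<close>)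
  qed
next
  fix f :: "real ^ 'n \<Rightarrow> 'h" and c assume f: "f \<in> ell2 X"
  show "matrix_op X A (\<lambda>k. c *\<^sub>C f k) = (\<lambda>k. c *\<^sub>C matrix_op X A f k)"
  proof
    fix k
    show "matrix_op X A (\<lambda>k. c *\<^sub>C f k) k = c *\<^sub>C matrix_op X A f k"
    proof (cases "k \<in> X")
      case True
      have "A k l (c *\<^sub>C x) = c *\<^sub>C A k l x" for l x using clin by (simp add: bounded_clinear_ops_def)
      then show ?thesis
        using infsumI[OF has_sum_bounded_linear[OF bounded_linear_scaleC
              has_sum_infsum[OF matrix_op_summable(1)[OF f True]]], of c]
        by (simp add: matrix_op_apply ell2_scaleC f)
    qed (use f in \<open>simp add: matrix_op_apply ell2_scaleC van\<close>)
  qed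
qed (use matrix_op_ell2[OF _ van] in \<open>auto simp: matrix_op_def\<close>)

end

lemma matrix_product_summable:
  fixes A B :: "('n::finite, 'h::complex_hilbert_space) op_matrix"
  assumes A: "schur_le (\<lambda>_ _. 1) X M A" and B: "schur_le (\<lambda>_ _. 1) X N B" and kl: "k \<in> X" "l \<in> X"
  shows "(\<lambda>n. A k n o\<^sub>L B n l) summable_on X"
    and "norm (\<Sum>\<^sub>\<infinity>n\<in>X. A k n o\<^sub>L B n l) \<le> (\<Sum>\<^sub>\<infinity>n\<in>X. norm (A k n) * norm (B n l))"
  using summable_on_norm_le[OF schur_le_product_summable[OF A B kl] norm_blinfun_compose] by blast+

text \<open>An exchange of the sums over \<open>n\<close> and \<open>l\<close>. The double sum
  converges absolutely because the norms of the entries of \<open>B\<close> map the norms of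
  \<open>f\<close> to a square-summable family, against which a row of \<open>A\<close> is
  summable.\<close>

lemma matrix_op_mult:
  fixes A B :: "('n::finite, 'h::complex_hilbert_space) op_matrix"
  assumes A: "schur_le (\<lambda>_ _. 1) X M A" "0 \<le> M" and B: "schur_le (\<lambda>_ _. 1) X N B" "0 \<le> N"
    and van: "\<And>k l. k \<notin> X \<Longrightarrow> A k l = 0" "\<And>k l. k \<notin> X \<Longrightarrow> B k l = 0"
  shows "matrix_op X (\<lambda>k l. \<Sum>\<^sub>\<infinity>n\<in>X. A k n o\<^sub>L B n l) f = matrix_op X A (matrix_op X B f)"
proof (cases "f \<in> ell2 X")
  case f: True
  have Bf: "matrix_op X B f \<in> ell2 X" using matrix_op_ell2[OF B f] van by blast
  show ?thesis
  proof
    fix k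
    show "matrix_op X (\<lambda>k l. \<Sum>\<^sub>\<infinity>n\<in>X. A k n o\<^sub>L B n l) f k = matrix_op X A (matrix_op X B f) k"
    proof (cases "k \<in> X")
      case k: True
      let ?h = "\<lambda>n l. blinfun_apply (A k n) (blinfun_apply (B n l) (f l))"
      have sBf: "(\<lambda>n. (\<Sum>\<^sub>\<infinity>l\<in>X. norm (B n l) * norm (f l))\<^sup>2) summable_on X"
        by (rule matrix_op_schur_test(2)[OF B f])
      have v: "(\<lambda>n. norm (A k n) * (\<Sum>\<^sub>\<infinity>l\<in>X. norm (B n l) * norm (f l))) summable_on X"
        using schur_test(1)[OF norm_ge_zero _ A(2) schur_le_norms[OF A] sBf k]
        by (simp add: infsum_nonneg)
      have "(\<lambda>(n, l). ?h n l) summable_on (X \<times> X)"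
      proof (rule summable_on_product_bound[OF _ _ _ v])
        show "norm (?h n l) \<le> norm (A k n) * (norm (B n l) * norm (f l))" for n l
          by (meson norm_blinfun order_trans mult_left_mono norm_ge_zero)
        show "(\<lambda>l. norm (A k n) * (norm (B n l) * norm (f l))) summable_on X" if "n \<in> X" for n
          by (intro summable_on_cmult_right matrix_op_schur_test(1)[OF B f that])
        show "(\<Sum>\<^sub>\<infinity>l\<in>X. norm (A k n) * (norm (B n l) * norm (f l)))
            \<le> norm (A k n) * (\<Sum>\<^sub>\<infinity>l\<in>X. norm (B n l) * norm (f l))" for n
          by (simp add: infsum_cmult_right')
      qed
      then have swap: "(\<Sum>\<^sub>\<infinity>n\<in>X. \<Sum>\<^sub>\<infinity>l\<in>X. ?h n l) = (\<Sum>\<^sub>\<infinity>l\<in>X. \<Sum>\<^sub>\<infinity>n\<in>X. ?h n l)"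
        by (rule infsum_swap_banach)
      have "matrix_op X A (matrix_op X B f) k = (\<Sum>\<^sub>\<infinity>n\<in>X. \<Sum>\<^sub>\<infinity>l\<in>X. ?h n l)"
        unfolding matrix_op_apply[OF Bf]
      proof (rule infsum_cong)
        fix n assume n: "n \<in> X"
        show "blinfun_apply (A k n) (matrix_op X B f n) = (\<Sum>\<^sub>\<infinity>l\<in>X. ?h n l)"
          unfolding matrix_op_apply[OF f]
          by (rule infsumI[symmetric], rule has_sum_bounded_linear[OF blinfun.bounded_linear_right])
             (rule has_sum_infsum[OF matrix_op_summable(1)[OF B f n]])
      qed
      moreover have "matrix_op X (\<lambda>k l. \<Sum>\<^sub>\<infinity>n\<in>X. A k n o\<^sub>L B n l) f k = (\<Sum>\<^sub>\<infinity>l\<in>X. \<Sum>\<^sub>\<infinity>n\<in>X. ?h n l)"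
        unfolding matrix_op_apply[OF f]
      proof (rule infsum_cong)
        fix l assume l: "l \<in> X"
        have "((\<lambda>n. blinfun_apply (A k n o\<^sub>L B n l) (f l)) has_sum
            blinfun_apply (\<Sum>\<^sub>\<infinity>n\<in>X. A k n o\<^sub>L B n l) (f l)) X"
          by (rule has_sum_bounded_linear[OF blinfun.bounded_linear_left])
             (rule has_sum_infsum[OF matrix_product_summable(1)[OF A(1) B(1) k l]])
        then show "blinfun_apply (\<Sum>\<^sub>\<infinity>n\<in>X. A k n o\<^sub>L B n l) (f l) = (\<Sum>\<^sub>\<infinity>n\<in>X. ?h n l)"
          by (simp add: infsumI)
      qed
      ultimately show ?thesis using swap by simp
    qed (use f Bf in \<open>simp add: matrix_op_apply van\<close>)
  qed
next
  case False
  then show ?thesis by (simp add: matrix_op_def)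
qed

text \<open>Again two sums are exchanged; the dominating double sum converges because it pairs two
  square-summable families.\<close>

lemma matrix_op_adjoint:
  fixes A :: "('n::finite, 'h::complex_hilbert_space) op_matrix"
  assumes A: "schur_le (\<lambda>_ _. 1) X M A" "0 \<le> M" and clin: "\<And>k l. A k l \<in> bounded_clinear_ops"
    and f: "f \<in> ell2 X" and g: "g \<in> ell2 X"
  shows "ell2_inner X (matrix_op X A f) g = ell2_inner X f (matrix_op X (\<lambda>k l. adj (A l k)) g)"
proof -
  let ?h = "\<lambda>k l. cinner (blinfun_apply (A k l) (f l)) (g k)"
  have A': "schur_le (\<lambda>_ _. 1) X M (\<lambda>k l. adj (A l k))"
    using A(1) by (simp add: schur_le_def row_le_def norm_adj clin)
  have v: "(\<lambda>k. (\<Sum>\<^sub>\<infinity>l\<in>X. norm (A k l) * norm (f l)) * norm (g k)) summable_on X"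
    using matrix_op_schur_test(2)[OF A f] ell2_summable[OF g]
    by (intro cauchy_schwarz_infsum(1)) (auto intro: infsum_nonneg)
  have "(\<lambda>(k, l). ?h k l) summable_on (X \<times> X)"
  proof (rule summable_on_product_bound[OF _ _ _ v])
    show "norm (?h k l) \<le> norm (A k l) * norm (f l) * norm (g k)" for k l
      by (meson norm_blinfun order_trans mult_right_mono norm_ge_zero cmod_cinner_le)
    show "(\<lambda>l. norm (A k l) * norm (f l) * norm (g k)) summable_on X" if "k \<in> X" for k
      by (intro summable_on_cmult_left matrix_op_schur_test(1)[OF A f that])
    show "(\<Sum>\<^sub>\<infinity>l\<in>X. norm (A k l) * norm (f l) * norm (g k))
        \<le> (\<Sum>\<^sub>\<infinity>l\<in>X. norm (A k l) * norm (f l)) * norm (g k)" for k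
      by (simp add: infsum_cmult_left')
  qed
  then have swap: "(\<Sum>\<^sub>\<infinity>k\<in>X. \<Sum>\<^sub>\<infinity>l\<in>X. ?h k l) = (\<Sum>\<^sub>\<infinity>l\<in>X. \<Sum>\<^sub>\<infinity>k\<in>X. ?h k l)"
    by (rule infsum_swap_banach)
  have "ell2_inner X (matrix_op X A f) g = (\<Sum>\<^sub>\<infinity>k\<in>X. \<Sum>\<^sub>\<infinity>l\<in>X. ?h k l)"
    unfolding ell2_inner_def matrix_op_apply[OF f]
  proof (rule infsum_cong)
    fix k assume k: "k \<in> X"
    show "cinner (\<Sum>\<^sub>\<infinity>l\<in>X. blinfun_apply (A k l) (f l)) (g k) = (\<Sum>\<^sub>\<infinity>l\<in>X. ?h k l)"
      by (rule infsumI[symmetric], rule has_sum_bounded_linear[OF bounded_linear_cinner_left])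
         (rule has_sum_infsum[OF matrix_op_summable(1)[OF A f k]])
  qed
  moreover have "ell2_inner X f (matrix_op X (\<lambda>k l. adj (A l k)) g) = (\<Sum>\<^sub>\<infinity>l\<in>X. \<Sum>\<^sub>\<infinity>k\<in>X. ?h k l)"
    unfolding ell2_inner_def matrix_op_apply[OF g]
  proof (rule infsum_cong)
    fix l assume l: "l \<in> X"
    have "((\<lambda>k. cinner (f l) (blinfun_apply (adj (A k l)) (g k))) has_sum
        cinner (f l) (\<Sum>\<^sub>\<infinity>k\<in>X. blinfun_apply (adj (A k l)) (g k))) X"
      by (rule has_sum_bounded_linear[OF bounded_linear_cinner_right])
         (rule has_sum_infsum[OF matrix_op_summable(1)[OF A' A(2) g l]])
    then show "cinner (f l) (\<Sum>\<^sub>\<infinity>k\<in>X. blinfun_apply (adj (A k l)) (g k)) = (\<Sum>\<^sub>\<infinity>k\<in>X. ?h k l)"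
      by (simp add: infsumI cinner_adj clin)
  qed
  ultimately show ?thesis using swap by simp
qed

lemma matrix_op_eqI:
  fixes A B :: "('n::finite, 'h::complex_hilbert_space) op_matrix"
  assumes van: "\<And>k l. k \<notin> X \<or> l \<notin> X \<Longrightarrow> A k l = 0" "\<And>k l. k \<notin> X \<or> l \<notin> X \<Longrightarrow> B k l = 0"
    and eq: "\<And>f. f \<in> ell2 X \<Longrightarrow> matrix_op X A f = matrix_op X B f"
  shows "A = B"
proof (intro ext)
  fix k l
  show "A k l = B k l"
  proof (cases "l \<in> X")
    case True
    show ?thesis
      by (rule blinfun_eqI)
         (metis eq[OF ell2_single(1)[OF True]] matrix_op_single[OF True])
  qed (use van in auto)
qed

section \<open>Neumann series\<close>

lemma complex_ring_simps [simp]: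
  "carrier complex_ring = UNIV" "mult complex_ring = (*)" "one complex_ring = 1"
  "zero complex_ring = 0" "add complex_ring = (+)"
  by (simp_all add: complex_ring_def)

lemma cring_complex_ring: "cring complex_ring"
proof (intro cringI abelian_groupI comm_monoidI)
  fix x :: complex
  show "\<exists>y\<in>carrier complex_ring. y \<oplus>\<^bsub>complex_ring\<^esub> x = \<zero>\<^bsub>complex_ring\<^esub>"
    by (rule bexI[of _ "- x"]) auto
qed (auto simp: algebra_simps)

context unital_banach_star_algebra
begin

lemma smult_minus_one: "x \<in> carrier A \<Longrightarrow> (- 1) \<odot>\<^bsub>A\<^esub> x = \<ominus> x"
  using smult_l_distr[of "-1" 1 x] smult_one[of x] smult_l_null[of x]
  by (simp add: minus_equality)

lemma anorm_zero: "anorm A \<zero> = 0"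
  using anorm_eq_zero[of \<zero>] by simp

lemma anorm_minus: "x \<in> carrier A \<Longrightarrow> anorm A (\<ominus> x) = anorm A x"
  using anorm_smult[of x "-1"] by (simp add: smult_minus_one)

lemma anorm_minus_commute:
  assumes "x \<in> carrier A" "y \<in> carrier A"
  shows "anorm A (x \<ominus> y) = anorm A (y \<ominus> x)"
proof -
  have "\<ominus> (x \<ominus> y) = y \<ominus> x" using assms by (simp add: minus_eq minus_add a_comm)
  then show ?thesis using anorm_minus[of "x \<ominus> y"] assms by simp
qed

lemma telescoping_power_sum:
  assumes b: "b \<in> carrier A"
  shows "(\<one> \<ominus> b) \<otimes> (\<Oplus>i\<in>{..<n::nat}. b [^] i) = \<one> \<ominus> b [^] n"
    and "(\<Oplus>i\<in>{..<n::nat}. b [^] i) \<otimes> (\<one> \<ominus> b) = \<one> \<ominus> b [^] n"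
proof -
  let ?t = "\<lambda>n::nat. \<Oplus>i\<in>{..<n}. b [^] i"
  have t: "?t n \<in> carrier A" for n using b by (intro finsum_closed) auto
  have t_Suc: "?t (Suc n) = b [^] n \<oplus> ?t n" for n
    unfolding lessThan_Suc using b by (subst finsum_insert) auto
  have [simp]: "b \<otimes> b [^] n = b [^] Suc n" for n :: nat
    using b nat_pow_comm[OF b, of n 1] by simp
  show "(\<one> \<ominus> b) \<otimes> ?t n = \<one> \<ominus> b [^] n"
  proof (induction n)
    case 0
    then show ?case using b by (simp add: minus_eq r_neg)
  next
    case (Suc n)
    have "(\<one> \<ominus> b) \<otimes> ?t (Suc n) = (b [^] n \<ominus> b [^] Suc n) \<oplus> (\<one> \<ominus> b [^] n)"
      using b t[of n] Suc by (simp add: t_Suc r_distr minus_eq l_distr l_minus)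
    also have "\<dots> = \<one> \<ominus> b [^] Suc n"
      using b by (simp only: minus_eq) (simp add: a_ac r_neg1 r_neg2 del: nat_pow_Suc)
    finally show ?case .
  qed
  show "?t n \<otimes> (\<one> \<ominus> b) = \<one> \<ominus> b [^] n"
  proof (induction n)
    case 0
    then show ?case using b by (simp add: minus_eq r_neg)
  next
    case (Suc n)
    have "?t (Suc n) \<otimes> (\<one> \<ominus> b) = b [^] n \<otimes> (\<one> \<ominus> b) \<oplus> ?t n \<otimes> (\<one> \<ominus> b)"
      using b t[of n] by (simp add: t_Suc l_distr)
    also have "\<dots> = (b [^] n \<ominus> b [^] Suc n) \<oplus> (\<one> \<ominus> b [^] n)"
      unfolding Suc using b by (simp add: minus_eq r_distr r_minus)
    also have "\<dots> = \<one> \<ominus> b [^] Suc n"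
      using b by (simp only: minus_eq) (simp add: a_ac r_neg1 r_neg2 del: nat_pow_Suc)
    finally show ?case .
  qed
qed

lemma anorm_tendsto_zero_eq:
  assumes "x \<in> carrier A" "y \<in> carrier A" and "\<And>n::nat. anorm A (x \<ominus> y) \<le> e n" "e \<longlonglongrightarrow> 0"
  shows "x = y"
proof -
  have "anorm A (x \<ominus> y) \<le> 0" using assms(3,4) by (intro LIMSEQ_le_const[OF assms(4)]) auto
  then have "x \<ominus> y = \<zero>" using anorm_ge_zero[of "x \<ominus> y"] anorm_eq_zero[of "x \<ominus> y"] assms by simp
  then have "x \<ominus> y \<oplus> y = y" using assms(2) by simp
  then show ?thesis using assms(1,2) by (simp add: minus_eq a_assoc l_neg)
qed

text \<open>The powers decay geometrically up to the constant \<open>C\<close>, while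
  \<open>b\<close> itself may have norm above 1; this is the form in which the growth estimates
  arrive. The partial sums converge, and both telescoping identities pass to the limit.\<close>

lemma neumann_series_unit:
  assumes b: "b \<in> carrier A" and bound: "\<And>n::nat. anorm A (b [^] n) \<le> C * s ^ n" and s: "0 < s" "s < 1"
  shows "\<one> \<ominus> b \<in> Units A"
proof -
  define t where "t n = (\<Oplus>i\<in>{..<n::nat}. b [^] i)" for n
  have t: "t n \<in> carrier A" for n using b unfolding t_def by (intro finsum_closed) auto
  have t_Suc: "t (Suc n) = b [^] n \<oplus> t n" for n
    unfolding t_def lessThan_Suc using b by (subst finsum_insert) auto
  have C: "0 \<le> C" using bound[of 0] anorm_ge_zero[of \<one>] by simp
  have diff: "anorm A (t m \<ominus> t n) \<le> C * (s ^ n - s ^ m) / (1 - s)" if "n \<le> m" for m n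
    using that
  proof (induction m rule: dec_induct)
    case base
    then show ?case using t[of n] by (simp add: minus_eq r_neg anorm_zero)
  next
    case (step m)
    have "t (Suc m) \<ominus> t n = b [^] m \<oplus> (t m \<ominus> t n)"
      using t b by (simp add: t_Suc minus_eq a_assoc)
    then have "anorm A (t (Suc m) \<ominus> t n) \<le> anorm A (b [^] m) + anorm A (t m \<ominus> t n)"
      using t b by (simp add: anorm_add)
    also have "\<dots> \<le> C * s ^ m + C * (s ^ n - s ^ m) / (1 - s)" using bound step by (intro add_mono) auto
    also have "\<dots> = C * (s ^ n - s ^ Suc m) / (1 - s)" using s by (simp add: field_simps)
    finally show ?case .
  qed
  have tail: "anorm A (t m \<ominus> t n) \<le> C * s ^ N / (1 - s)" if "N \<le> n" "n \<le> m" for m n N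
  proof -
    have "s ^ n \<le> s ^ N" using that s by (intro power_decreasing) auto
    then have "s ^ n - s ^ m \<le> s ^ N" using s zero_le_power[of s m] by linarith
    then have "C * (s ^ n - s ^ m) / (1 - s) \<le> C * s ^ N / (1 - s)"
      using C s by (intro divide_right_mono mult_left_mono) auto
    then show ?thesis using diff[OF that(2)] by simp
  qed
  have pow0: "(\<lambda>n. C * s ^ n / (1 - s)) \<longlonglongrightarrow> 0"
    using s by (auto intro!: tendsto_eq_intros LIMSEQ_realpow_zero)
  have "\<exists>a\<in>carrier A. (\<lambda>n. anorm A (t n \<ominus> a)) \<longlonglongrightarrow> 0"
  proof (rule complete[OF t], intro allI impI)
    fix e :: real assume "0 < e"
    then obtain N where N: "C * s ^ N / (1 - s) < e"
      using order_tendstoD(2)[OF pow0] eventually_happens'[OF sequentially_bot] by blast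
    have "anorm A (t m \<ominus> t n) < e" if "N \<le> m" "N \<le> n" for m n
    proof (cases "n \<le> m")
      case True
      then show ?thesis using tail[of N n m] that N by simp
    next
      case False
      then show ?thesis using tail[of N m n] that N t anorm_minus_commute[of "t m" "t n"] by simp
    qed
    then show "\<exists>N. \<forall>m\<ge>N. \<forall>n\<ge>N. anorm A (t m \<ominus> t n) < e" by blast
  qed
  then obtain a where a: "a \<in> carrier A" and lim: "(\<lambda>n. anorm A (t n \<ominus> a)) \<longlonglongrightarrow> 0" by blast
  define u where "u = \<one> \<ominus> b"
  have u: "u \<in> carrier A" using b by (simp add: u_def)
  define e where "e n = anorm A u * anorm A (t n \<ominus> a) + C * s ^ n" for n
  have e0: "e \<longlonglongrightarrow> 0" unfolding e_def using s lim
    by (auto intro!: tendsto_eq_intros LIMSEQ_realpow_zero)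
  have bn: "b [^] n \<in> carrier A" for n :: nat using b by simp
  \<comment> \<open>Common to both sides of the inverse: up to sign,
    \<open>x \<ominus> \<one>\<close> is the truncation error \<open>d\<close> plus the power left
    over by telescoping.\<close>
  have key: "anorm A (x \<ominus> \<one>) \<le> e n"
    if x: "x \<in> carrier A" and d: "d \<in> carrier A" "anorm A d \<le> anorm A u * anorm A (t n \<ominus> a)"
      and eq: "\<one> \<ominus> b [^] n \<ominus> x = d" for x d n
  proof -
    have "d \<oplus> b [^] n = (\<one> \<ominus> x) \<oplus> (\<ominus> (b [^] n) \<oplus> b [^] n)"
      unfolding eq[symmetric] using x bn[of n] by (simp only: minus_eq a_ac a_inv_closed a_closed one_closed)
    then have "d \<oplus> b [^] n = \<one> \<ominus> x" using x bn[of n] by (simp add: l_neg)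
    then have "x \<ominus> \<one> = \<ominus> (d \<oplus> b [^] n)" using x by (simp add: minus_eq minus_add a_comm)
    then have "anorm A (x \<ominus> \<one>) = anorm A (d \<oplus> b [^] n)" using d bn[of n] by (simp add: anorm_minus)
    also have "\<dots> \<le> anorm A d + anorm A (b [^] n)" using d bn by (intro anorm_add) auto
    also have "\<dots> \<le> e n" unfolding e_def using d bound by (intro add_mono) auto
    finally show ?thesis .
  qed
  have "u \<otimes> a = \<one>"
  proof (rule anorm_tendsto_zero_eq[OF _ _ _ e0])
    fix n
    have "\<one> \<ominus> b [^] n \<ominus> u \<otimes> a = u \<otimes> (t n \<ominus> a)"
      unfolding telescoping_power_sum(1)[OF b, of n, folded u_def t_def, symmetric]
      using u a t[of n] by (simp add: minus_eq r_distr r_minus)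
    then show "anorm A (u \<otimes> a \<ominus> \<one>) \<le> e n"
      using u a t[of n] by (intro key[of _ "u \<otimes> (t n \<ominus> a)"] anorm_mult) auto
  qed (use u a in auto)
  moreover have "a \<otimes> u = \<one>"
  proof (rule anorm_tendsto_zero_eq[OF _ _ _ e0])
    fix n
    have "\<one> \<ominus> b [^] n \<ominus> a \<otimes> u = (t n \<ominus> a) \<otimes> u"
      unfolding telescoping_power_sum(2)[OF b, of n, folded u_def t_def, symmetric]
      using u a t[of n] by (simp add: minus_eq l_distr l_minus)
    then show "anorm A (a \<otimes> u \<ominus> \<one>) \<le> e n"
      using u a t[of n] anorm_mult[of "t n \<ominus> a" u]
      by (intro key[of _ "(t n \<ominus> a) \<otimes> u"]) (auto simp: mult.commute)
  qed (use u a in auto)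
  ultimately show ?thesis using u a unfolding Units_def u_def by blast
qed

end

section \<open>The weighted Schur algebra is a Banach star-algebra\<close>

text \<open>The ambient operator type is only real-linear, so complex linearity of an infinite sum
  needs a proof: evaluation and multiplication by a scalar are bounded linear and commute with the
  sum.\<close>

lemma bounded_clinear_ops_infsum:
  fixes T :: "'i \<Rightarrow> 'h::complex_hilbert_space \<Rightarrow>\<^sub>L 'h"
  assumes "T summable_on X" and clin: "\<And>n. T n \<in> bounded_clinear_ops"
  shows "infsum T X \<in> bounded_clinear_ops"
proof -
  have hs: "((\<lambda>n. blinfun_apply (T n) x) has_sum blinfun_apply (infsum T X) x) X" for x
    by (rule has_sum_bounded_linear[OF blinfun.bounded_linear_left has_sum_infsum[OF assms(1)]])
  have "blinfun_apply (infsum T X) (c *\<^sub>C x) = c *\<^sub>C blinfun_apply (infsum T X) x" for c x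
  proof (rule has_sum_unique[OF hs])
    show "((\<lambda>n. blinfun_apply (T n) (c *\<^sub>C x)) has_sum c *\<^sub>C blinfun_apply (infsum T X) x) X"
      using has_sum_bounded_linear[OF bounded_linear_scaleC hs, of c x] clin
      by (simp add: bounded_clinear_ops_def)
  qed
  then show ?thesis by (simp add: bounded_clinear_ops_def)
qed

lemma adj_infsum_compose:
  fixes S T :: "'i \<Rightarrow> 'h::complex_hilbert_space \<Rightarrow>\<^sub>L 'h"
  assumes "(\<lambda>n. S n o\<^sub>L T n) summable_on X" "(\<lambda>n. adj (T n) o\<^sub>L adj (S n)) summable_on X"
    and clin: "\<And>n. S n \<in> bounded_clinear_ops" "\<And>n. T n \<in> bounded_clinear_ops"
  shows "adj (\<Sum>\<^sub>\<infinity>n\<in>X. S n o\<^sub>L T n) = (\<Sum>\<^sub>\<infinity>n\<in>X. adj (T n) o\<^sub>L adj (S n))"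
proof (rule adj_unique)
  fix x y
  have "((\<lambda>n. cinner (blinfun_apply (S n o\<^sub>L T n) x) y) has_sum
      cinner (blinfun_apply (\<Sum>\<^sub>\<infinity>n\<in>X. S n o\<^sub>L T n) x) y) X"
    by (rule has_sum_bounded_linear[OF bounded_linear_cinner_left], rule has_sum_bounded_linear[OF blinfun.bounded_linear_left])
       (rule has_sum_infsum[OF assms(1)])
  moreover have "((\<lambda>n. cinner x (blinfun_apply (adj (T n) o\<^sub>L adj (S n)) y)) has_sum
      cinner x (blinfun_apply (\<Sum>\<^sub>\<infinity>n\<in>X. adj (T n) o\<^sub>L adj (S n)) y)) X"
    by (rule has_sum_bounded_linear[OF bounded_linear_cinner_right], rule has_sum_bounded_linear[OF blinfun.bounded_linear_left])
       (rule has_sum_infsum[OF assms(2)])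
  moreover have "cinner (blinfun_apply (S n o\<^sub>L T n) x) y
      = cinner x (blinfun_apply (adj (T n) o\<^sub>L adj (S n)) y)" for n
    by (simp add: cinner_adj clin)
  ultimately show "cinner (blinfun_apply (\<Sum>\<^sub>\<infinity>n\<in>X. S n o\<^sub>L T n) x) y
      = cinner x (blinfun_apply (\<Sum>\<^sub>\<infinity>n\<in>X. adj (T n) o\<^sub>L adj (S n)) y)"
    by (simp only:) (rule has_sum_unique)
qed

text \<open>A Fatou property: each test in \<open>row_le\<close> is a finite sum, so it survives
  entrywise limits, uniform or not.\<close>

lemma schur_le_limit:
  assumes "\<And>n::nat. n \<ge> N \<Longrightarrow> schur_le W X M (B n)" and lim: "\<And>k l. (\<lambda>n. B n k l) \<longlonglongrightarrow> C k l"
  shows "schur_le W X M C"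
proof -
  have row: "row_le W X M C"
    if B: "\<And>n::nat. n \<ge> N \<Longrightarrow> row_le W X M (B n)" and lim: "\<And>k l. (\<lambda>n. B n k l) \<longlonglongrightarrow> C k l"
    for W and B :: "nat \<Rightarrow> 'a \<Rightarrow> 'a \<Rightarrow> 'b" and C
    unfolding row_le_def
  proof (intro ballI allI impI)
    fix k F assume k: "k \<in> X" and F: "finite F \<and> F \<subseteq> X"
    have "(\<lambda>n. \<Sum>l\<in>F. norm (B n k l) * W k l) \<longlonglongrightarrow> (\<Sum>l\<in>F. norm (C k l) * W k l)"
      by (intro tendsto_intros lim)
    then show "(\<Sum>l\<in>F. norm (C k l) * W k l) \<le> M"
      using B k F by (intro LIMSEQ_le_const2) (auto intro!: exI[of _ N] row_leD)
  qed
  have "row_le W X M C" by (rule row[OF _ lim]) (use assms(1) in \<open>simp add: schur_le_def\<close>)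
  moreover have "row_le (\<lambda>k l. W l k) X M (\<lambda>k l. C l k)"
    by (rule row[of _ "\<lambda>n k l. B n l k", OF _ lim]) (use assms(1) in \<open>simp add: schur_le_def\<close>)
  ultimately show ?thesis by (simp add: schur_le_def)
qed

text \<open>The four properties of an admissible weight on which the Banach star-algebra structure
  rests. \<open>S\<close> is a parameter with a defining equation, which gives the algebra a short
  name in the ring locales.\<close>

locale schur_weight =
  fixes \<nu> :: "real ^ 'n \<Rightarrow> real" and X :: "(real ^ 'n) set"
    and S :: "('n, 'h::complex_hilbert_space) op_matrix star_algebra"
  assumes weight_zero: "\<nu> 0 = 1" and weight_ge_1: "1 \<le> \<nu> x" and weight_minus: "\<nu> (- x) = \<nu> x"
    and weight_submult: "\<nu> (x + y) \<le> \<nu> x * \<nu> y"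
    and S_def: "S = schur_algebra \<nu> X"
begin

abbreviation W :: "real ^ 'n \<Rightarrow> real ^ 'n \<Rightarrow> real"
  where "W k l \<equiv> \<nu> (k - l)"

lemma weight_nonneg: "0 \<le> \<nu> x"
  using weight_ge_1[of x] by simp

lemma W_submult: "W k l \<le> W k n * W n l"
  using weight_submult[of "k - n" "n - l"] by simp

lemma S_simps:
  "mult S A B = (\<lambda>k l. \<Sum>\<^sub>\<infinity>n\<in>X. A k n o\<^sub>L B n l)"
  "one S = (\<lambda>k l. if k \<in> X \<and> k = l then id_blinfun else 0)"
  "zero S = (\<lambda>k l. 0)" "add S A B = (\<lambda>k l. A k l + B k l)"
  "smult S c A = (\<lambda>k l. Blinfun (\<lambda>x. c *\<^sub>C blinfun_apply (A k l) x))"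
  "anorm S A = enn2real (schur_norm \<nu> X A)" "star S A = (\<lambda>k l. adj (A l k))"
  by (simp_all add: S_def schur_algebra_def)

lemma carrier_iff:
  "A \<in> carrier S \<longleftrightarrow> (\<forall>k l. k \<notin> X \<or> l \<notin> X \<longrightarrow> A k l = 0) \<and> (\<forall>k l. A k l \<in> bounded_clinear_ops) \<and>
    (\<exists>M\<ge>0. schur_le W X M A)"
proof -
  have "schur_norm \<nu> X A < \<infinity> \<longleftrightarrow> (\<exists>M\<ge>0. schur_norm \<nu> X A \<le> ennreal M)"
    by (metis ennreal_cases ennreal_less_top infinity_ennreal_def le_less_trans order_refl top.not_eq_extremum)
  then show ?thesis
    unfolding S_def schur_algebra_def by (auto simp: schur_norm_le_iff[OF weight_nonneg])
qed

lemma carrierI: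
  assumes "\<And>k l. k \<notin> X \<or> l \<notin> X \<Longrightarrow> A k l = 0" "\<And>k l. A k l \<in> bounded_clinear_ops"
    and "schur_le W X M A" "0 \<le> M"
  shows "A \<in> carrier S"
  using assms by (auto simp: carrier_iff)

lemma carrier_outside: "A \<in> carrier S \<Longrightarrow> k \<notin> X \<or> l \<notin> X \<Longrightarrow> A k l = 0"
  and carrier_clinear: "A \<in> carrier S \<Longrightarrow> A k l \<in> bounded_clinear_ops"
  by (auto simp: carrier_iff)

lemma anorm_nonneg: "0 \<le> anorm S A"
  by (simp add: S_simps)

lemma anorm_le_iff:
  assumes "A \<in> carrier S" "0 \<le> M"
  shows "anorm S A \<le> M \<longleftrightarrow> schur_le W X M A"
proof -
  have fin: "schur_norm \<nu> X A < \<infinity>" using assms by (simp add: S_def schur_algebra_def)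
  then have eq: "ennreal (enn2real (schur_norm \<nu> X A)) = schur_norm \<nu> X A" by simp
  have "anorm S A \<le> M \<longleftrightarrow> ennreal (enn2real (schur_norm \<nu> X A)) \<le> ennreal M"
    unfolding S_simps using assms by (simp add: ennreal_le_iff del: ennreal_enn2real)
  then show ?thesis unfolding eq by (simp add: schur_norm_le_iff[OF weight_nonneg assms(2)])
qed

lemma schur_le_anorm: "A \<in> carrier S \<Longrightarrow> schur_le W X (anorm S A) A"
  using anorm_le_iff[of A "anorm S A"] anorm_nonneg by simp

lemma schur_le_unweighted:
  assumes "schur_le W X M A"
  shows "schur_le (\<lambda>_ _. 1) X M A"
  using schur_le_weight_mono[OF assms, of "\<lambda>_ _. 1" 1] weight_ge_1 by simp

lemma schur_le_anorm_unweighted: "A \<in> carrier S \<Longrightarrow> schur_le (\<lambda>_ _. 1) X (anorm S A) A"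
  by (intro schur_le_unweighted schur_le_anorm)

lemma mult_norm_le:
  assumes "A \<in> carrier S" "B \<in> carrier S" "k \<in> X" "l \<in> X"
  shows "(\<lambda>n. A k n o\<^sub>L B n l) summable_on X"
    "norm (mult S A B k l) \<le> (\<Sum>\<^sub>\<infinity>n\<in>X. norm (A k n) * norm (B n l))"
  unfolding S_simps
  using matrix_product_summable[OF schur_le_anorm_unweighted[OF assms(1)] schur_le_anorm_unweighted[OF assms(2)] assms(3,4)]
  by blast+

lemma schur_le_mult:
  assumes AB: "A \<in> carrier S" "B \<in> carrier S"
    and V: "\<And>k l. 0 \<le> V k l" "\<And>k n l. V k l \<le> V k n * V n l"
    and "schur_le V X M A" "0 \<le> M" "schur_le V X N B" "0 \<le> N"
  shows "schur_le V X (M * N) (mult S A B)"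
  using assms mult_norm_le[OF AB]
    schur_le_product_summable[OF schur_le_anorm_unweighted[OF AB(1)] schur_le_anorm_unweighted[OF AB(2)]]
  by (intro schur_le_product[of V X M A N B "mult S A B"]) auto

lemma mult_outside:
  assumes "A \<in> carrier S" "B \<in> carrier S" "k \<notin> X \<or> l \<notin> X"
  shows "mult S A B k l = 0"
  using assms carrier_outside[OF assms(1)] carrier_outside[OF assms(2)] by (auto simp: S_simps)

lemma mult_closed:
  assumes AB: "A \<in> carrier S" "B \<in> carrier S"
  shows "mult S A B \<in> carrier S"
proof (rule carrierI)
  show "schur_le W X (anorm S A * anorm S B) (mult S A B)"
    by (intro schur_le_mult AB weight_nonneg W_submult schur_le_anorm anorm_nonneg)
  show "mult S A B k l \<in> bounded_clinear_ops" for k l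
  proof (cases "k \<in> X \<and> l \<in> X")
    case True
    then show ?thesis unfolding S_simps
      using mult_norm_le(1)[OF AB] AB
      by (intro bounded_clinear_ops_infsum bounded_clinear_ops_closed carrier_clinear) auto
  qed (use mult_outside[OF AB] in auto)
qed (use mult_outside[OF AB] in \<open>auto simp: anorm_nonneg\<close>)

lemma schur_le_one:
  assumes "\<And>k. V k k \<le> 1" "\<And>k l. 0 \<le> V k l"
  shows "schur_le V X 1 (one S)"
proof -
  have row: "row_le V X 1 (one S)" if V: "\<And>k. V k k \<le> 1" "\<And>k l. 0 \<le> V k l" for V
    unfolding row_le_def
  proof (intro ballI allI impI)
    fix k F assume k: "k \<in> X" and F: "finite F \<and> F \<subseteq> X"
    have "(\<Sum>l\<in>F. norm (one S k l) * V k l) \<le> (\<Sum>l\<in>F. if l = k then 1 else 0)"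
      using V norm_blinfun_id_le by (intro sum_mono) (auto simp: S_simps intro: mult_le_one)
    also have "\<dots> \<le> 1" using F by simp
    finally show "(\<Sum>l\<in>F. norm (one S k l) * V k l) \<le> 1" .
  qed
  have "one S l k = one S k l" for k l by (auto simp: S_simps)
  then show ?thesis using row[of V] row[of "\<lambda>k l. V l k"] assms by (simp add: schur_le_def)
qed

lemma one_closed: "one S \<in> carrier S"
  using schur_le_one[of W] weight_zero weight_nonneg
  by (intro carrierI[of _ 1]) (auto simp: S_simps)

lemma zero_closed: "zero S \<in> carrier S"
  by (intro carrierI[of _ 0]) (auto simp: S_simps schur_le_def row_le_def)

lemma add_closed:
  assumes "A \<in> carrier S" "B \<in> carrier S"
  shows "add S A B \<in> carrier S"
proof (rule carrierI)
  show "schur_le W X (anorm S A + anorm S B) (add S A B)"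
    by (rule schur_le_add[OF schur_le_anorm[OF assms(1)] schur_le_anorm[OF assms(2)] weight_nonneg])
       (simp add: S_simps norm_triangle_ineq)
  show "add S A B k l = 0" if "k \<notin> X \<or> l \<notin> X" for k l
    using carrier_outside[OF assms(1) that] carrier_outside[OF assms(2) that] by (simp add: S_simps)
  show "add S A B k l \<in> bounded_clinear_ops" for k l
    unfolding S_simps by (intro bounded_clinear_ops_closed(1) carrier_clinear assms)
qed (simp add: anorm_nonneg)

lemma smult_apply: "blinfun_apply (smult S c A k l) x = c *\<^sub>C blinfun_apply (A k l) x"
  by (simp add: S_simps blinfun_apply_scaleC)

lemma smult_outside: "A \<in> carrier S \<Longrightarrow> k \<notin> X \<or> l \<notin> X \<Longrightarrow> smult S c A k l = 0"
  by (rule blinfun_eqI) (simp only: smult_apply carrier_outside blinfun.zero_left scaleC_zero_right)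

lemma smult_closed:
  assumes "A \<in> carrier S"
  shows "smult S c A \<in> carrier S"
proof (rule carrierI)
  show "schur_le W X (cmod c * anorm S A) (smult S c A)"
    by (rule schur_le_norm_le[OF schur_le_anorm[OF assms] weight_nonneg])
       (simp_all add: S_simps norm_blinfun_scaleC)
  show "smult S c A k l = 0" if "k \<notin> X \<or> l \<notin> X" for k l
    using that by (rule smult_outside[OF assms])
  show "smult S c A k l \<in> bounded_clinear_ops" for k l
    \<comment> \<open>The third closure rule has a premise about another operator that its
      conclusion does not contain; the zero operator fills it.\<close>
    unfolding S_simps using assms by (intro bounded_clinear_ops_closed(3)[of 0]) (auto simp: carrier_clinear)
qed (simp add: anorm_nonneg)

lemma star_closed:
  assumes "A \<in> carrier S"
  shows "star S A \<in> carrier S"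
proof (rule carrierI)
  have "norm (adj (A k l)) = norm (A k l)" for k l using assms by (intro norm_adj carrier_clinear)
  moreover have "\<nu> (l - k) = \<nu> (k - l)" for k l using weight_minus[of "k - l"] by simp
  ultimately show "schur_le W X (anorm S A) (star S A)"
    using schur_le_anorm[OF assms] by (auto simp: schur_le_def row_le_def S_simps simp del: enn2real_nonneg)
qed (use assms in \<open>auto simp: S_simps carrier_outside adj_clinear carrier_clinear simp del: enn2real_nonneg intro: enn2real_nonneg\<close>)

section \<open>Action of the algebra on square-summable families\<close>

lemma op_bounded:
  assumes "A \<in> carrier S"
  shows "bounded_ell2_op X (matrix_op X A)"
  by (rule bounded_ell2_op_matrix_op[OF schur_le_anorm_unweighted[OF assms] anorm_nonneg])
     (use assms in \<open>auto simp: carrier_outside carrier_clinear\<close>)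

lemma op_ell2:
  assumes "A \<in> carrier S" "f \<in> ell2 X"
  shows "matrix_op X A f \<in> ell2 X" "ell2_norm X (matrix_op X A f) \<le> anorm S A * ell2_norm X f"
  by (rule matrix_op_ell2[OF schur_le_anorm_unweighted[OF assms(1)] anorm_nonneg assms(2)];
      use assms in \<open>simp add: carrier_outside\<close>)+

lemma op_mult:
  assumes "A \<in> carrier S" "B \<in> carrier S"
  shows "matrix_op X (mult S A B) f = matrix_op X A (matrix_op X B f)"
  unfolding S_simps
  by (rule matrix_op_mult[OF schur_le_anorm_unweighted[OF assms(1)] anorm_nonneg
        schur_le_anorm_unweighted[OF assms(2)] anorm_nonneg])
     (use assms in \<open>auto simp: carrier_outside\<close>)

lemma op_add:
  assumes "A \<in> carrier S" "B \<in> carrier S" "f \<in> ell2 X"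
  shows "matrix_op X (add S A B) f = (\<lambda>k. matrix_op X A f k + matrix_op X B f k)"
proof
  fix k
  show "matrix_op X (add S A B) f k = matrix_op X A f k + matrix_op X B f k"
  proof (cases "k \<in> X")
    case True
    then show ?thesis
      using matrix_op_summable(1)[OF schur_le_anorm_unweighted[OF assms(1)] anorm_nonneg assms(3)]
        matrix_op_summable(1)[OF schur_le_anorm_unweighted[OF assms(2)] anorm_nonneg assms(3)]
      by (simp add: matrix_op_apply assms(3) S_simps blinfun.add_left infsum_add del: enn2real_nonneg)
  qed (use assms in \<open>simp add: matrix_op_apply S_simps carrier_outside\<close>)
qed

lemma op_smult:
  assumes "A \<in> carrier S" "f \<in> ell2 X"
  shows "matrix_op X (smult S c A) f = (\<lambda>k. c *\<^sub>C matrix_op X A f k)"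
proof
  fix k
  show "matrix_op X (smult S c A) f k = c *\<^sub>C matrix_op X A f k"
  proof (cases "k \<in> X")
    case True
    show ?thesis
      using infsumI[OF has_sum_bounded_linear[OF bounded_linear_scaleC has_sum_infsum[OF
          matrix_op_summable(1)[OF schur_le_anorm_unweighted[OF assms(1)] anorm_nonneg assms(2) True]]], of c]
      by (simp add: matrix_op_apply assms(2) S_simps blinfun_apply_scaleC)
  qed (use assms in \<open>simp add: matrix_op_apply smult_outside carrier_outside\<close>)
qed

lemma op_one:
  assumes "f \<in> ell2 X"
  shows "matrix_op X (one S) f = f"
proof
  fix k
  show "matrix_op X (one S) f k = f k"
  proof (cases "k \<in> X")
    case True
    then have "((\<lambda>l. blinfun_apply (one S k l) (f l)) has_sum f k) X"
      by (intro has_sum_finite_neutralI[of "{k}"]) (auto simp: S_simps)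
    then show ?thesis by (simp add: matrix_op_apply assms infsumI)
  qed (use assms in \<open>simp add: matrix_op_apply S_simps ell2_outside\<close>)
qed

lemma op_zero: "matrix_op X (zero S) f = (\<lambda>k. 0)"
  by (auto simp: matrix_op_def S_simps)

lemma op_star:
  assumes "A \<in> carrier S" "f \<in> ell2 X" "g \<in> ell2 X"
  shows "ell2_inner X (matrix_op X A f) g = ell2_inner X f (matrix_op X (star S A) g)"
  unfolding S_simps using assms
  by (intro matrix_op_adjoint[OF schur_le_anorm_unweighted anorm_nonneg] carrier_clinear)

text \<open>Comparing matrices as operators reduces associativity and distributivity to composition
  of functions, in place of manipulations of infinite sums.\<close>

lemma op_eqI:
  assumes "A \<in> carrier S" "B \<in> carrier S" and "\<And>f. f \<in> ell2 X \<Longrightarrow> matrix_op X A f = matrix_op X B f"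
  shows "A = B"
  using assms by (intro matrix_op_eqI[of X A B]) (auto simp: carrier_outside)

section \<open>Ring and module structure\<close>

lemma abelian_group_S: "abelian_group S"
proof (rule abelian_groupI)
  fix A assume A: "A \<in> carrier S"
  have "smult S (-1) A \<in> carrier S" by (rule smult_closed[OF A])
  moreover have "add S (smult S (-1) A) A = zero S"
    unfolding S_simps(3,4)
    by (intro ext blinfun_eqI) (simp only: blinfun.add_left smult_apply scaleC_minus_one blinfun.zero_left left_minus)
  ultimately show "\<exists>B\<in>carrier S. add S B A = zero S" by blast
  show "add S (zero S) A = A" by (simp add: S_simps(3,4))
next
  fix A B C
  show "add S (add S A B) C = add S A (add S B C)" "add S A B = add S B A"
    by (simp_all add: S_simps(4) add_ac)
qed (simp_all add: add_closed zero_closed)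

lemma op_op_add:
  assumes "A \<in> carrier S" "f \<in> ell2 X" "g \<in> ell2 X"
  shows "matrix_op X A (\<lambda>k. f k + g k) = (\<lambda>k. matrix_op X A f k + matrix_op X A g k)"
  using op_bounded[OF assms(1)] assms(2,3) unfolding bounded_ell2_op_def by blast

lemma op_op_scaleC:
  assumes "A \<in> carrier S" "f \<in> ell2 X"
  shows "matrix_op X A (\<lambda>k. c *\<^sub>C f k) = (\<lambda>k. c *\<^sub>C matrix_op X A f k)"
  using op_bounded[OF assms(1)] assms(2) unfolding bounded_ell2_op_def by blast

sublocale S: ring S
proof (rule ringI[OF abelian_group_S])
  show "monoid S"
    by (rule monoidI)
       (auto intro!: mult_closed one_closed op_eqI simp: op_mult mult_closed one_closed op_one op_ell2)
qed (auto intro!: op_eqI add_closed mult_closed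
      simp: mult_closed add_closed op_mult op_add op_ell2 op_op_add)

lemma module_S: "Module.module complex_ring S"
proof (rule moduleI[OF cring_complex_ring abelian_group_S])
  show "smult S (add complex_ring a b) A = add S (smult S a A) (smult S b A)" for a b A
    unfolding S_simps(4) by (intro ext blinfun_eqI) (simp add: smult_apply blinfun.add_left scaleC_add_left)
  show "smult S a (add S A B) = add S (smult S a A) (smult S a B)" for a A B
    unfolding S_simps(4) by (intro ext blinfun_eqI) (simp add: smult_apply blinfun.add_left scaleC_add_right)
  show "smult S (mult complex_ring a b) A = smult S a (smult S b A)" for a b A
    by (intro ext blinfun_eqI) (simp add: smult_apply scaleC_scaleC)
  show "smult S (one complex_ring) A = A" for A
    by (intro ext blinfun_eqI) (simp add: smult_apply)
qed (rule smult_closed)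

lemma minus_apply:
  assumes "A \<in> carrier S" "B \<in> carrier S"
  shows "(A \<ominus>\<^bsub>S\<^esub> B) k l = A k l - B k l"
proof -
  have "add S (smult S (-1) B) B = zero S"
    unfolding S_simps(3,4)
    by (intro ext blinfun_eqI) (simp only: blinfun.add_left smult_apply scaleC_minus_one blinfun.zero_left left_minus)
  then have "\<ominus>\<^bsub>S\<^esub> B = smult S (-1) B"
    using S.minus_equality smult_closed assms(2) by blast
  then have "(A \<ominus>\<^bsub>S\<^esub> B) k l = A k l + smult S (-1) B k l"
    by (simp add: S.minus_eq S_simps)
  also have "smult S (-1) B k l = - B k l"
    by (rule blinfun_eqI) (simp only: smult_apply scaleC_minus_one blinfun.minus_left)
  finally show ?thesis by simp
qed

section \<open>Norm, involution and completeness\<close>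

lemma anorm_leI:
  assumes "A \<in> carrier S" "0 \<le> M" "schur_le W X M A"
  shows "anorm S A \<le> M"
  using assms anorm_le_iff by blast

lemma entry_le_anorm:
  assumes "A \<in> carrier S"
  shows "norm (A k l) \<le> anorm S A"
proof (cases "k \<in> X \<and> l \<in> X")
  case True
  then show ?thesis using schur_le_entry[OF schur_le_anorm_unweighted[OF assms]] by blast
qed (use carrier_outside[OF assms] anorm_nonneg in auto)

lemma anorm_smult_le: "A \<in> carrier S \<Longrightarrow> anorm S (smult S c A) \<le> cmod c * anorm S A"
proof (rule anorm_leI)
  assume A: "A \<in> carrier S"
  show "schur_le W X (cmod c * anorm S A) (smult S c A)"
    by (rule schur_le_norm_le[OF schur_le_anorm[OF A] weight_nonneg])
       (simp_all add: S_simps norm_blinfun_scaleC)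
qed (simp_all add: smult_closed anorm_nonneg)

lemma anorm_star_le: "A \<in> carrier S \<Longrightarrow> anorm S (star S A) \<le> anorm S A"
proof (rule anorm_leI)
  assume A: "A \<in> carrier S"
  have "norm (adj (A k l)) = norm (A k l)" for k l using A by (intro norm_adj carrier_clinear)
  moreover have "\<nu> (l - k) = \<nu> (k - l)" for k l using weight_minus[of "k - l"] by simp
  ultimately show "schur_le W X (anorm S A) (star S A)"
    using schur_le_anorm[OF A] by (auto simp: schur_le_def row_le_def S_simps(7))
qed (simp_all add: star_closed anorm_nonneg)

lemma star_star: "A \<in> carrier S \<Longrightarrow> star S (star S A) = A"
  by (simp add: S_simps adj_adj carrier_clinear)

lemma star_mult:
  assumes AB: "A \<in> carrier S" "B \<in> carrier S"
  shows "star S (mult S A B) = mult S (star S B) (star S A)"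
proof (intro ext)
  fix k l
  show "star S (mult S A B) k l = mult S (star S B) (star S A) k l"
  proof (cases "k \<in> X \<and> l \<in> X")
    case True
    then have "(\<lambda>n. adj (B n k) o\<^sub>L adj (A l n)) summable_on X"
      using mult_norm_le(1)[OF star_closed[OF AB(2)] star_closed[OF AB(1)], of k l] by (simp add: S_simps)
    then have "adj (\<Sum>\<^sub>\<infinity>n\<in>X. A l n o\<^sub>L B n k) = (\<Sum>\<^sub>\<infinity>n\<in>X. adj (B n k) o\<^sub>L adj (A l n))"
      using True by (intro adj_infsum_compose[OF mult_norm_le(1)[OF AB]] carrier_clinear AB) auto
    then show ?thesis by (simp add: S_simps)
  next
    case False
    then have "mult S A B l k = 0" "mult S (star S B) (star S A) k l = 0"
      using AB by (auto intro!: mult_outside star_closed)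
    then show ?thesis by (simp add: S_simps(7))
  qed
qed

text \<open>The excluded case occurs when \<open>X\<close> is empty or the Hilbert space is zero.
  Otherwise a nonzero vector shows that the identity operator has norm at least 1, and it is a
  diagonal entry of the matrix.\<close>

lemma anorm_one:
  assumes "one S \<noteq> zero S"
  shows "anorm S (one S) = 1"
proof (rule antisym)
  show "anorm S (one S) \<le> 1"
    using schur_le_one[of W] weight_zero weight_nonneg by (intro anorm_leI one_closed) auto
  obtain k l where "one S k l \<noteq> zero S k l" using assms by blast
  then have k: "one S k k = id_blinfun" and id: "(id_blinfun :: 'h \<Rightarrow>\<^sub>L 'h) \<noteq> 0"
    by (auto simp: S_simps split: if_splits)
  obtain x :: 'h where x: "x \<noteq> 0" using id by (metis blinfun_eqI blinfun_apply_id_blinfun blinfun.zero_left id_apply)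
  have "norm x \<le> norm (id_blinfun :: 'h \<Rightarrow>\<^sub>L 'h) * norm x"
    using norm_blinfun[of "id_blinfun :: 'h \<Rightarrow>\<^sub>L 'h" x] by simp
  then have "1 \<le> norm (id_blinfun :: 'h \<Rightarrow>\<^sub>L 'h)" using x by simp
  then show "1 \<le> anorm S (one S)" using entry_le_anorm[OF one_closed, of k k] k by simp
qed

text \<open>Entries converge since the norm dominates them. The Cauchy estimate passes to the
  entrywise limit through \<open>schur_le_limit\<close>, which yields both its membership in the
  algebra and convergence in norm.\<close>

lemma complete_S:
  assumes s: "\<And>n. s n \<in> carrier S"
    and cauchy: "\<forall>e>0. \<exists>N. \<forall>m\<ge>N. \<forall>n\<ge>N. anorm S (s m \<ominus>\<^bsub>S\<^esub> s n) < e"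
  shows "\<exists>a\<in>carrier S. (\<lambda>n::nat. anorm S (s n \<ominus>\<^bsub>S\<^esub> a)) \<longlonglongrightarrow> 0"
proof -
  have "Cauchy (\<lambda>n. s n k l)" for k l
  proof (rule metric_CauchyI)
    fix e :: real assume "0 < e"
    then obtain N where N: "\<forall>m\<ge>N. \<forall>n\<ge>N. anorm S (s m \<ominus>\<^bsub>S\<^esub> s n) < e" using cauchy by blast
    have "dist (s m k l) (s n k l) < e" if "m \<ge> N" "n \<ge> N" for m n
    proof -
      have "dist (s m k l) (s n k l) \<le> anorm S (s m \<ominus>\<^bsub>S\<^esub> s n)"
        using entry_le_anorm[of "s m \<ominus>\<^bsub>S\<^esub> s n" k l] s by (simp add: minus_apply dist_norm)
      then show ?thesis using N that by fastforce
    qed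
    then show "\<exists>M. \<forall>m\<ge>M. \<forall>n\<ge>M. dist (s m k l) (s n k l) < e" by blast
  qed
  then have "\<exists>L. (\<lambda>n. s n k l) \<longlonglongrightarrow> L" for k l using Cauchy_convergent convergent_def by blast
  then obtain a where a: "\<And>k l. (\<lambda>n. s n k l) \<longlonglongrightarrow> a k l" by metis
  have tail: "schur_le W X e (\<lambda>k l. s n k l - a k l)"
    if N: "\<forall>m\<ge>N. \<forall>n\<ge>N. anorm S (s m \<ominus>\<^bsub>S\<^esub> s n) < e" and n: "n \<ge> N" for N n e
  proof (rule schur_le_limit[of N _ _ _ "\<lambda>m k l. s n k l - s m k l"])
    fix m assume "m \<ge> N"
    then have lt: "anorm S (s n \<ominus>\<^bsub>S\<^esub> s m) < e" using N n by blast
    have "schur_le W X e (s n \<ominus>\<^bsub>S\<^esub> s m)"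
      using schur_le_anorm[of "s n \<ominus>\<^bsub>S\<^esub> s m"] s lt by (intro schur_le_mono[OF _ less_imp_le[OF lt]]) auto
    moreover have "s n \<ominus>\<^bsub>S\<^esub> s m = (\<lambda>k l. s n k l - s m k l)" using s by (intro ext minus_apply)
    ultimately show "schur_le W X e (\<lambda>k l. s n k l - s m k l)" by simp
  qed (intro tendsto_intros a)
  obtain N1 where N1: "\<forall>m\<ge>N1. \<forall>n\<ge>N1. anorm S (s m \<ominus>\<^bsub>S\<^esub> s n) < 1"
    using cauchy zero_less_one by blast
  have a_carrier: "a \<in> carrier S"
  proof (rule carrierI)
    show "schur_le W X (anorm S (s N1) + 1) a"
    proof (rule schur_le_add[OF schur_le_anorm[OF s] tail[OF N1 order_refl] weight_nonneg])
      show "norm (a k l) \<le> norm (s N1 k l) + norm (s N1 k l - a k l)" for k l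
        using norm_triangle_sub[of "a k l" "s N1 k l"] by (simp add: norm_minus_commute)
    qed
    show "a k l = 0" if "k \<notin> X \<or> l \<notin> X" for k l
    proof (rule LIMSEQ_unique[OF a])
      show "(\<lambda>n. s n k l) \<longlonglongrightarrow> 0" using carrier_outside[OF s that] by simp
    qed
    show "a k l \<in> bounded_clinear_ops" for k l
    proof -
      have lim: "(\<lambda>n. blinfun_apply (s n k l) x) \<longlonglongrightarrow> blinfun_apply (a k l) x" for x
        by (intro bounded_linear.tendsto[OF blinfun.bounded_linear_left] a)
      have "blinfun_apply (a k l) (c *\<^sub>C x) = c *\<^sub>C blinfun_apply (a k l) x" for c x
      proof (rule LIMSEQ_unique[OF lim])
        show "(\<lambda>n. blinfun_apply (s n k l) (c *\<^sub>C x)) \<longlonglongrightarrow> c *\<^sub>C blinfun_apply (a k l) x"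
          using bounded_linear.tendsto[OF bounded_linear_scaleC lim, of c x] carrier_clinear[OF s]
          by (simp add: bounded_clinear_ops_def)
      qed
      then show ?thesis by (simp add: bounded_clinear_ops_def)
    qed
  qed (simp add: anorm_nonneg)
  have "(\<lambda>n. anorm S (s n \<ominus>\<^bsub>S\<^esub> a)) \<longlonglongrightarrow> 0"
  proof (rule metric_LIMSEQ_I)
    fix e :: real assume "0 < e"
    then obtain N where N: "\<forall>m\<ge>N. \<forall>n\<ge>N. anorm S (s m \<ominus>\<^bsub>S\<^esub> s n) < e / 2"
      using cauchy half_gt_zero by blast
    have "dist (anorm S (s n \<ominus>\<^bsub>S\<^esub> a)) 0 < e" if n: "n \<ge> N" for n
    proof -
      have "s n \<ominus>\<^bsub>S\<^esub> a = (\<lambda>k l. s n k l - a k l)" using s a_carrier by (intro ext minus_apply)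
      then have "schur_le W X (e / 2) (s n \<ominus>\<^bsub>S\<^esub> a)" using tail[OF N n] by simp
      then have "anorm S (s n \<ominus>\<^bsub>S\<^esub> a) \<le> e / 2"
        using s a_carrier \<open>0 < e\<close> by (intro anorm_leI S.minus_closed) auto
      then show ?thesis using \<open>0 < e\<close> anorm_nonneg[of "s n \<ominus>\<^bsub>S\<^esub> a"] by simp
    qed
    then show "\<exists>N. \<forall>n\<ge>N. dist (anorm S (s n \<ominus>\<^bsub>S\<^esub> a)) 0 < e" by blast
  qed
  then show ?thesis using a_carrier by blast
qed

lemma unital_banach_star_algebra_S: "unital_banach_star_algebra S"
proof (intro unital_banach_star_algebra.intro unital_banach_star_algebra_axioms.intro module_S S.ring_axioms)
  fix A B c assume A: "A \<in> carrier S" and B: "B \<in> carrier S"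
  show "mult S (smult S c A) B = smult S c (mult S A B)"
    using A B by (intro op_eqI) (auto simp: mult_closed smult_closed op_mult op_smult op_ell2)
  show "mult S A (smult S c B) = smult S c (mult S A B)"
    using A B by (intro op_eqI) (auto simp: mult_closed smult_closed op_mult op_smult op_ell2 op_op_scaleC)
  show "anorm S (add S A B) \<le> anorm S A + anorm S B"
  proof (rule anorm_leI)
    show "schur_le W X (anorm S A + anorm S B) (add S A B)"
      by (rule schur_le_add[OF schur_le_anorm[OF A] schur_le_anorm[OF B] weight_nonneg])
         (simp add: S_simps norm_triangle_ineq)
  qed (simp_all add: A B add_closed anorm_nonneg)
  show "anorm S (mult S A B) \<le> anorm S A * anorm S B"
    by (intro anorm_leI schur_le_mult A B mult_closed weight_nonneg W_submult schur_le_anorm anorm_nonneg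
        mult_nonneg_nonneg)
  show "star S (add S A B) = add S (star S A) (star S B)"
    using A B by (simp add: S_simps(4,7) adj_add carrier_clinear)
  show "star S (mult S A B) = mult S (star S B) (star S A)" by (rule star_mult[OF A B])
next
  fix A c assume A: "A \<in> carrier S"
  show "anorm S A = 0 \<longleftrightarrow> A = zero S"
  proof
    assume "anorm S A = 0"
    then show "A = zero S" using entry_le_anorm[OF A] by (auto simp: S_simps(3))
  next
    assume "A = zero S"
    moreover have "schur_le W X 0 (zero S)" by (simp add: S_simps(3) schur_le_def row_le_def)
    ultimately show "anorm S A = 0" using anorm_le_iff[OF A, of 0] anorm_nonneg[of A] by simp
  qed
  show "anorm S (smult S c A) = cmod c * anorm S A"
  proof (cases "c = 0")
    case True
    then show ?thesis using anorm_smult_le[OF A, of c] anorm_nonneg[of "smult S c A"] by simp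
  next
    case False
    have "smult S (inverse c) (smult S c A) = A"
      by (intro ext blinfun_eqI) (simp add: smult_apply scaleC_scaleC False)
    then have "anorm S A \<le> cmod (inverse c) * anorm S (smult S c A)"
      using anorm_smult_le[OF smult_closed[OF A], of "inverse c" c] by simp
    then have "cmod c * anorm S A \<le> anorm S (smult S c A)"
      using False by (simp add: norm_inverse norm_divide field_simps)
    then show ?thesis using anorm_smult_le[OF A, of c] by simp
  qed
  show "star S (smult S c A) = smult S (cnj c) (star S A)"
    using A by (simp add: S_simps(5,7) adj_scaleC carrier_clinear)
  show "anorm S (star S A) = anorm S A"
    using anorm_star_le[OF A] anorm_star_le[OF star_closed[OF A]] by (simp add: star_star[OF A])
qed (simp_all add: anorm_nonneg anorm_one star_closed star_star complete_S)

end

section \<open>The rate of growth of the powers\<close>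

context schur_weight
begin

lemma pow_closed: "A \<in> carrier S \<Longrightarrow> A [^]\<^bsub>S\<^esub> (n::nat) \<in> carrier S"
  by (rule S.nat_pow_closed)

text \<open>Stated for an arbitrary submultiplicative \<open>V\<close>, since powers are measured in
  the flattened weight as well as in \<open>\<nu>\<close>.\<close>

lemma schur_le_pow:
  assumes A: "A \<in> carrier S" and V: "\<And>k. V k k \<le> 1" "\<And>k l. 0 \<le> V k l" "\<And>k n l. V k l \<le> V k n * V n l"
    and M: "schur_le V X M A" "0 \<le> M"
  shows "schur_le V X (M ^ n) (A [^]\<^bsub>S\<^esub> (n::nat))"
proof (induction n)
  case 0
  then show ?case using schur_le_one[of V] V by simp
next
  case (Suc n)
  have "schur_le V X (M ^ n * M) (A [^]\<^bsub>S\<^esub> n \<otimes>\<^bsub>S\<^esub> A)"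
    using A M V Suc by (intro schur_le_mult pow_closed) auto
  then show ?case by (simp add: mult.commute)
qed

lemma anorm_pow_le:
  assumes "A \<in> carrier S"
  shows "anorm S (A [^]\<^bsub>S\<^esub> (n::nat)) \<le> anorm S A ^ n"
  using assms schur_le_pow[OF assms, of W "anorm S A" n]
  by (intro anorm_leI pow_closed) (auto simp: weight_zero weight_nonneg W_submult schur_le_anorm anorm_nonneg)

lemma op_pow:
  assumes A: "A \<in> carrier S" and q: "0 \<le> q" "\<And>f. f \<in> ell2 X \<Longrightarrow> ell2_norm X (matrix_op X A f) \<le> q * ell2_norm X f"
    and f: "f \<in> ell2 X"
  shows "ell2_norm X (matrix_op X (A [^]\<^bsub>S\<^esub> (n::nat)) f) \<le> q ^ n * ell2_norm X f"
  using f
proof (induction n arbitrary: f)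
  case 0
  then show ?case by (simp add: op_one)
next
  case (Suc n)
  have "ell2_norm X (matrix_op X (A [^]\<^bsub>S\<^esub> Suc n) f) \<le> q ^ n * ell2_norm X (matrix_op X A f)"
    using Suc A by (simp add: op_mult pow_closed op_ell2)
  also have "\<dots> \<le> q ^ n * (q * ell2_norm X f)" using q Suc.prems by (intro mult_left_mono) auto
  finally show ?case by (simp add: mult_ac)
qed

lemma entry_le_op_bound:
  assumes B: "B \<in> carrier S" and q: "0 \<le> q" "\<And>f. f \<in> ell2 X \<Longrightarrow> ell2_norm X (matrix_op X B f) \<le> q * ell2_norm X f"
  shows "norm (B k l) \<le> q"
proof (cases "k \<in> X \<and> l \<in> X")
  case True
  show ?thesis
  proof (rule norm_blinfun_bound[OF q(1)])
    fix h :: 'h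
    let ?e = "\<lambda>j. if j = l then h else 0"
    have e: "?e \<in> ell2 X" "ell2_norm X ?e = norm h" using ell2_single[of l X h] True by auto
    have "norm (blinfun_apply (B k l) h) = norm (matrix_op X B ?e k)" using True by (simp add: matrix_op_single)
    also have "\<dots> \<le> ell2_norm X (matrix_op X B ?e)" using True by (intro norm_le_ell2_norm op_ell2 B e) auto
    also have "\<dots> \<le> q * norm h" using q(2)[OF e(1)] e(2) by simp
    finally show "norm (blinfun_apply (B k l) h) \<le> q * norm h" .
  qed
qed (use carrier_outside[OF B] q in auto)

end

locale gelfand_weight = schur_weight \<nu> X S
  for \<nu> :: "real ^ 'n \<Rightarrow> real" and X :: "(real ^ 'n) set"
    and S :: "('n, 'h::complex_hilbert_space) op_matrix star_algebra" +
  fixes C \<delta> :: real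
  assumes admissible: "admissible_weight \<nu>" and separated: "relatively_separated X"
    and C_pos: "0 < C" and \<delta>_pos: "0 < \<delta>" and growth: "C * (1 + norm x) powr \<delta> \<le> \<nu> x"
begin

lemma weight_unbounded: "\<exists>x. K \<le> \<nu> x"
proof -
  \<comment> \<open>\<open>r\<close> solves
    \<open>C * r powr \<delta> = \<bar>K\<bar>\<close>.\<close>
  define r where "r = (\<bar>K\<bar> / C) powr (1 / \<delta>)"
  have r: "0 \<le> r" by (simp add: r_def)
  obtain x :: "real ^ 'n" where x: "norm x = r" using vector_choose_size[OF r] by blast
  have "\<bar>K\<bar> / C = r powr \<delta>" using \<delta>_pos C_pos by (simp add: r_def powr_powr)
  also have "\<dots> \<le> (1 + norm x) powr \<delta>" using r x \<delta>_pos by (intro powr_mono2) auto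
  finally have "\<bar>K\<bar> \<le> C * (1 + norm x) powr \<delta>" using C_pos by (simp add: field_simps)
  then show ?thesis using growth[of x] by (intro exI[of _ x]) linarith
qed

text \<open>Barnes' estimate: near the diagonal the row sums are controlled by the number of entries, far from
  it by the weight.\<close>

lemma schur_le_unweighted_interpolation:
  obtains K where "0 < K" "\<And>B b a R. \<lbrakk>\<And>k l. norm (B k l) \<le> b; 0 \<le> b; schur_le W X a B; 1 \<le> R\<rbrakk>
    \<Longrightarrow> schur_le (\<lambda>_ _. 1) X (K * R ^ CARD('n) * b + inverse C * R powr (- \<delta>) * a)
      (B :: ('n, 'h::complex_hilbert_space) op_matrix)"
proof -
  obtain K where K: "0 < K" and count: "\<And>R x. 1 \<le> R \<Longrightarrow>
      finite (X \<inter> cball x R) \<and> real (card (X \<inter> cball x R)) \<le> K * R ^ CARD('n)"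
    using relatively_separated_growth[OF separated] by blast
  have "schur_le (\<lambda>_ _. 1) X (K * R ^ CARD('n) * b + inverse C * R powr (- \<delta>) * a) B"
    if b: "\<And>k l. norm (B k l) \<le> b" "0 \<le> b" and a: "schur_le W X a B" and R: "1 \<le> R"
    for B :: "('n, 'h) op_matrix" and a b R
  proof -
    define V :: "real ^ 'n \<Rightarrow> real ^ 'n \<Rightarrow> real" where "V k l = (if dist k l \<le> R then 1 else 0)" for k l
    have row: "row_le V X (K * R ^ CARD('n) * b) B" if b: "\<And>k l. norm (B k l) \<le> b"
      for B :: "('n, 'h) op_matrix"
      unfolding row_le_def
    proof (intro ballI allI impI)
      fix k F assume F: "finite F \<and> F \<subseteq> X"
      have "(\<Sum>l\<in>F. norm (B k l) * V k l) \<le> (\<Sum>l\<in>F. if l \<in> cball k R then b else 0)"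
        using b by (intro sum_mono) (auto simp: V_def)
      also have "\<dots> = real (card (F \<inter> cball k R)) * b"
        using F by (simp add: sum.If_cases Int_def)
      also have "\<dots> \<le> real (card (X \<inter> cball k R)) * b"
        using F count[OF R, of k] \<open>0 \<le> b\<close> by (intro mult_right_mono of_nat_mono card_mono) auto
      also have "\<dots> \<le> K * R ^ CARD('n) * b" using count[OF R, of k] \<open>0 \<le> b\<close> by (intro mult_right_mono) auto
      finally show "(\<Sum>l\<in>F. norm (B k l) * V k l) \<le> K * R ^ CARD('n) * b" .
    qed
    have V: "schur_le V X (K * R ^ CARD('n) * b) B"
    proof -
      have "(\<lambda>k l. V l k) = V" by (intro ext) (simp add: V_def dist_commute)
      then show ?thesis using row[of B] row[of "\<lambda>k l. B l k"] b by (simp add: schur_le_def)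
    qed
    \<comment> \<open>On the band \<open>V\<close> alone reaches 1; off the band the weak growth
      makes the second summand reach 1.\<close>
    have "1 \<le> 1 * V k l + inverse C * R powr (- \<delta>) * W k l" for k l
    proof (cases "dist k l \<le> R")
      case True
      then show ?thesis using C_pos weight_nonneg by (simp add: V_def)
    next
      case False
      have "C * R powr \<delta> \<le> C * (1 + norm (k - l)) powr \<delta>"
        using False R \<delta>_pos C_pos by (intro mult_left_mono powr_mono2) (auto simp: dist_norm)
      also have "\<dots> \<le> W k l" by (rule growth)
      finally have "C * R powr \<delta> \<le> W k l" .
      then show ?thesis using False C_pos R by (simp add: V_def powr_minus field_simps)
    qed
    then show ?thesis
      using schur_le_weight_add[OF V a, of "\<lambda>_ _. 1" 1 "inverse C * R powr (- \<delta>)"] C_pos by simp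
  qed
  then show ?thesis using that[OF K] by blast
qed

text \<open>Equivalent weights produce equivalent norms, hence the same rate of growth.\<close>

lemma growth_of_unweighted_bound:
  assumes A: "A \<in> carrier S" and m: "1 \<le> m" and t: "schur_le (\<lambda>_ _. 1) X t (A [^]\<^bsub>S\<^esub> (m::nat))"
    "0 \<le> t" "t < s ^ m" and s: "0 < s"
  shows "\<exists>D. \<forall>n::nat. anorm S (A [^]\<^bsub>S\<^esub> n) \<le> D * s ^ n"
proof -
  interpret B: unital_banach_star_algebra S by (rule unital_banach_star_algebra_S)
  define B where "B = A [^]\<^bsub>S\<^esub> m"
  have B: "B \<in> carrier S" using A by (simp add: B_def pow_closed)
  define N where "N = anorm S B"
  have N: "0 \<le> N" "schur_le W X N B" using B by (auto simp: N_def anorm_nonneg schur_le_anorm)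
  \<comment> \<open>The gap between \<open>t\<close> and \<open>s ^ m\<close> pays for the loss
    \<open>\<epsilon> * (t + N)\<close> in flattening; the summand 1 keeps the denominator
    positive.\<close>
  define \<epsilon> where "\<epsilon> = (s ^ m - t) / (t + N + 1)"
  have \<epsilon>: "0 < \<epsilon>" using t N by (simp add: \<epsilon>_def)
  have "\<epsilon> * (t + N) \<le> \<epsilon> * (t + N + 1)" using \<epsilon> by simp
  also have "\<dots> = s ^ m - t" using t N by (simp add: \<epsilon>_def)
  finally have \<epsilon>_le: "(1 + \<epsilon>) * t + \<epsilon> * N \<le> s ^ m" by (simp add: algebra_simps)
  obtain w c where c: "0 < c" and w0: "w 0 = 1" and w_pos: "\<And>x. 0 < w x"
    and w_sub: "\<And>x y. w (x + y) \<le> w x * w y" and \<nu>_le: "\<And>x. \<nu> x \<le> c * w x"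
    and w_le: "\<And>x. w x \<le> (1 + \<epsilon>) + \<epsilon> * \<nu> x"
    using admissible_weight_flattening[OF admissible weight_unbounded \<epsilon>] by blast
  define V where "V k l = w (k - l)" for k l
  have V: "V k k \<le> 1" "0 \<le> V k l" "V k l \<le> V k n * V n l" for k n l
    using w0 less_imp_le[OF w_pos] w_sub[of "k - n" "n - l"] by (simp_all add: V_def)
  have "schur_le V X ((1 + \<epsilon>) * t + \<epsilon> * N) B"
    using t(1) N(2) \<epsilon> w_le by (intro schur_le_weight_add[of "\<lambda>_ _. 1" X t B W N]) (auto simp: V_def B_def)
  then have VB: "schur_le V X (s ^ m) B" using \<epsilon>_le by (rule schur_le_mono)
  \<comment> \<open>The powers are estimated in the submultiplicative weight \<open>w\<close>, and
    only the result is compared with \<open>\<nu>\<close>; so \<open>c\<close> occurs once and is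
    not raised to the power \<open>j\<close>.\<close>
  have Bj: "anorm S (B [^]\<^bsub>S\<^esub> j) \<le> c * (s ^ m) ^ j" for j :: nat
  proof (rule anorm_leI)
    have "schur_le V X ((s ^ m) ^ j) (B [^]\<^bsub>S\<^esub> j)"
      using s by (intro schur_le_pow B V VB) auto
    then show "schur_le W X (c * (s ^ m) ^ j) (B [^]\<^bsub>S\<^esub> j)"
      using \<nu>_le c by (intro schur_le_weight_mono) (auto simp: V_def)
  qed (use B c s in \<open>auto simp: pow_closed\<close>)
  \<comment> \<open>\<open>E\<close> absorbs the finitely many remainders in the division of the
    exponent by \<open>m\<close>.\<close>
  define E where "E = (\<Sum>r<m. anorm S (A [^]\<^bsub>S\<^esub> r) / s ^ r)"
  have E: "anorm S (A [^]\<^bsub>S\<^esub> r) \<le> E * s ^ r" if "r < m" for r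
  proof -
    have "anorm S (A [^]\<^bsub>S\<^esub> r) / s ^ r \<le> E"
      unfolding E_def using that s by (intro member_le_sum) (auto simp: anorm_nonneg)
    then show ?thesis using s by (simp add: field_simps)
  qed
  have "anorm S (A [^]\<^bsub>S\<^esub> n) \<le> (c * E) * s ^ n" for n :: nat
  proof -
    define j r where "j = n div m" and "r = n mod m"
    have n: "n = m * j + r" "r < m" using m by (simp_all add: j_def r_def)
    have "A [^]\<^bsub>S\<^esub> n = B [^]\<^bsub>S\<^esub> j \<otimes>\<^bsub>S\<^esub> A [^]\<^bsub>S\<^esub> r"
      using A by (simp add: n(1) B_def S.nat_pow_mult S.nat_pow_pow)
    then have "anorm S (A [^]\<^bsub>S\<^esub> n) \<le> anorm S (B [^]\<^bsub>S\<^esub> j) * anorm S (A [^]\<^bsub>S\<^esub> r)"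
      using A B by (simp add: B.anorm_mult pow_closed)
    also have "\<dots> \<le> (c * (s ^ m) ^ j) * (E * s ^ r)"
      using Bj E[OF n(2)] c s by (intro mult_mono) (auto simp: anorm_nonneg)
    also have "\<dots> = (c * E) * s ^ n" by (simp add: n(1) power_add power_mult)
    finally show ?thesis .
  qed
  then show ?thesis by blast
qed

text \<open>For \<open>R = \<beta> ^ m\<close> both terms of the interpolation estimate for the
  \<open>m\<close>-th power are geometric in \<open>m\<close>, with ratios \<open>x\<close> and
  \<open>y\<close> below \<open>s'\<close>. The constants \<open>K\<close>, \<open>C\<close> and
  \<open>D\<close> are absorbed at one large \<open>m\<close>, and that power controls all
  others.\<close>

lemma growth_improvement:
  assumes A: "A \<in> carrier S" and q: "0 \<le> q" "\<And>f. f \<in> ell2 X \<Longrightarrow> ell2_norm X (matrix_op X A f) \<le> q * ell2_norm X f"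
    and D: "\<And>n::nat. anorm S (A [^]\<^bsub>S\<^esub> n) \<le> D * s ^ n" and "0 < s" and "1 < \<beta>"
    and s': "\<beta> ^ CARD('n) * q < s'" "\<beta> powr (- \<delta>) * s < s'"
  shows "\<exists>D. \<forall>n::nat. anorm S (A [^]\<^bsub>S\<^esub> n) \<le> D * s' ^ n"
proof -
  obtain K where K: "0 < K" and interp: "\<And>B b a R. \<lbrakk>\<And>k l. norm (B k l) \<le> b; 0 \<le> b; schur_le W X a B; 1 \<le> R\<rbrakk>
    \<Longrightarrow> schur_le (\<lambda>_ _. 1) X (K * R ^ CARD('n) * b + inverse C * R powr (- \<delta>) * a) (B :: ('n, 'h) op_matrix)"
    using schur_le_unweighted_interpolation by blast
  define x y where "x = \<beta> ^ CARD('n) * q" and "y = \<beta> powr (- \<delta>) * s"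
  have x: "0 \<le> x" "x < s'" and y: "0 < y" "y < s'" using q(1) s' \<open>1 < \<beta>\<close> \<open>0 < s\<close> by (auto simp: x_def y_def)
  have s'_pos: "0 < s'" using y by simp
  have D0: "0 \<le> D" using D[of 0] anorm_nonneg[of "A [^]\<^bsub>S\<^esub> (0::nat)"] by simp
  define T where "T m = K * x ^ m + inverse C * D * y ^ m" for m
  have T: "schur_le (\<lambda>_ _. 1) X (T m) (A [^]\<^bsub>S\<^esub> m)" for m :: nat
  proof -
    have "schur_le (\<lambda>_ _. 1) X
        (K * (\<beta> ^ m) ^ CARD('n) * q ^ m + inverse C * (\<beta> ^ m) powr (- \<delta>) * (D * s ^ m)) (A [^]\<^bsub>S\<^esub> m)"
    proof (rule interp)
      show "norm ((A [^]\<^bsub>S\<^esub> m) k l) \<le> q ^ m" for k l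
        using q by (intro entry_le_op_bound pow_closed A op_pow) auto
      show "schur_le W X (D * s ^ m) (A [^]\<^bsub>S\<^esub> m)"
        using D by (intro schur_le_mono[OF schur_le_anorm] pow_closed A)
    qed (use q \<open>1 < \<beta>\<close> in auto)
    moreover have "(\<beta> ^ m) ^ CARD('n) * q ^ m = x ^ m"
      by (simp add: x_def power_mult_distrib mult.commute flip: power_mult)
    moreover have "(\<beta> ^ m) powr (- \<delta>) * s ^ m = y ^ m"
    proof -
      have "(\<beta> ^ m) powr (- \<delta>) = (\<beta> powr (- \<delta>)) ^ m"
        using \<open>1 < \<beta>\<close> by (simp add: powr_power flip: powr_realpow) (simp add: powr_powr mult.commute)
      then show ?thesis by (simp add: y_def power_mult_distrib)
    qed
    ultimately show ?thesis by (simp add: T_def mult_ac)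
  qed
  have "(\<lambda>m. K * (x / s') ^ m + inverse C * D * (y / s') ^ m) \<longlonglongrightarrow> K * 0 + inverse C * D * 0"
    using x y s'_pos by (intro tendsto_intros LIMSEQ_power_zero) auto
  then have "eventually (\<lambda>m. K * (x / s') ^ m + inverse C * D * (y / s') ^ m < 1) sequentially"
    by (rule order_tendstoD(2)) simp
  then obtain m where m: "1 \<le> m" "K * (x / s') ^ m + inverse C * D * (y / s') ^ m < 1"
    using eventually_happens[OF eventually_conj[OF eventually_ge_at_top[of "1::nat"]]] by force
  have "T m = (K * (x / s') ^ m + inverse C * D * (y / s') ^ m) * s' ^ m"
    using s'_pos by (simp add: T_def power_divide field_simps)
  also have "\<dots> < 1 * s' ^ m" using m(2) s'_pos by (intro mult_strict_right_mono) auto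
  finally have "T m < s' ^ m" by simp
  moreover have "0 \<le> T m" using K x y C_pos D0 by (simp add: T_def)
  ultimately show ?thesis using growth_of_unweighted_bound[OF A m(1) T] s'_pos by blast
qed

text \<open>Each step of the iteration improves the rate by a factor bounded away from \<open>1\<close>, until it
  drops below \<open>1\<close>.\<close>

lemma one_minus_contraction_unit:
  assumes A: "A \<in> carrier S" and q: "0 \<le> q" "q < 1"
    "\<And>f. f \<in> ell2 X \<Longrightarrow> ell2_norm X (matrix_op X A f) \<le> q * ell2_norm X f"
  shows "\<one>\<^bsub>S\<^esub> \<ominus>\<^bsub>S\<^esub> A \<in> Units S"
proof -
  have "((\<lambda>\<beta>. \<beta> ^ CARD('n) * q) \<longlongrightarrow> 1 ^ CARD('n) * q) (at_right 1)"
    by (intro tendsto_intros)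
  then have "eventually (\<lambda>\<beta>. \<beta> ^ CARD('n) * q < 1) (at_right 1)"
    by (rule order_tendstoD(2)) (use q in simp)
  then obtain \<beta> :: real where \<beta>: "1 < \<beta>" "\<beta> ^ CARD('n) * q < 1"
    using eventually_happens[OF eventually_conj[OF eventually_at_right_less]] by force
  define v where "v = \<beta> ^ CARD('n) * q"
  have v: "0 \<le> v" "v < 1" using \<beta> q(1) by (auto simp: v_def)
  \<comment> \<open>\<open>u\<close> is the floor of the iteration: above \<open>v\<close>, the
    limit that the near-diagonal term sets to any pass, and below 1. The maximum in
    \<open>iter\<close> lets the induction continue after the floor is reached.\<close>
  define u where "u = (v + 1) / 2"
  have u: "v < u" "u < 1" "0 < u" using v by (auto simp: u_def)
  define \<gamma> where "\<gamma> = \<beta> powr (- \<delta>)"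
  have \<gamma>: "0 < \<gamma>" "\<gamma> < 1" using \<beta> \<delta>_pos by (auto simp: \<gamma>_def powr_less_one)
  \<comment> \<open>\<open>growth_improvement\<close> asks for strict inequalities, so each pass
    claims only the factor \<open>\<gamma>'\<close>, weaker than \<open>\<gamma>\<close> but still
    below 1.\<close>
  define \<gamma>' where "\<gamma>' = (\<gamma> + 1) / 2"
  have \<gamma>': "\<gamma> < \<gamma>'" "0 < \<gamma>'" "\<gamma>' < 1" using \<gamma> by (auto simp: \<gamma>'_def)
  define s0 where "s0 = anorm S A + 1"
  have s0: "0 < s0" using anorm_nonneg[of A] by (simp add: s0_def)
  have iter: "\<exists>D. \<forall>n::nat. anorm S (A [^]\<^bsub>S\<^esub> n) \<le> D * (max (s0 * \<gamma>' ^ j) u) ^ n" for j :: nat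
  proof (induction j)
    case 0
    have "anorm S (A [^]\<^bsub>S\<^esub> n) \<le> 1 * (max s0 u) ^ n" for n :: nat
    proof -
      have "anorm S A ^ n \<le> (max s0 u) ^ n" using anorm_nonneg by (intro power_mono) (auto simp: s0_def)
      then show ?thesis using anorm_pow_le[OF A, of n] by simp
    qed
    then show ?case by (metis mult.right_neutral power_0)
  next
    case (Suc j)
    then obtain D where D: "\<And>n::nat. anorm S (A [^]\<^bsub>S\<^esub> n) \<le> D * (max (s0 * \<gamma>' ^ j) u) ^ n" by blast
    show ?case
    proof (rule growth_improvement[OF A q(1,3) D _ \<beta>(1)])
      show "0 < max (s0 * \<gamma>' ^ j) u" using u by simp
      show "\<beta> ^ CARD('n) * q < max (s0 * \<gamma>' ^ Suc j) u" using u by (simp add: v_def)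
      have "\<gamma> * (s0 * \<gamma>' ^ j) < \<gamma>' * (s0 * \<gamma>' ^ j)" "\<gamma> * u < 1 * u"
        using \<gamma> \<gamma>' s0 u by (auto intro!: mult_strict_right_mono simp del: mult_less_cancel_right)
      then show "\<beta> powr (- \<delta>) * max (s0 * \<gamma>' ^ j) u < max (s0 * \<gamma>' ^ Suc j) u"
        unfolding \<gamma>_def[symmetric] by (auto simp: max_def mult_ac)
    qed
  qed
  have "(\<lambda>j. s0 * \<gamma>' ^ j) \<longlonglongrightarrow> s0 * 0" using \<gamma>' by (intro tendsto_intros LIMSEQ_power_zero) auto
  then have "eventually (\<lambda>j. s0 * \<gamma>' ^ j < 1) sequentially" by (rule order_tendstoD(2)) simp
  then obtain j where j: "s0 * \<gamma>' ^ j < 1" using eventually_happens'[OF sequentially_bot] by blast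
  obtain D where D: "\<And>n::nat. anorm S (A [^]\<^bsub>S\<^esub> n) \<le> D * (max (s0 * \<gamma>' ^ j) u) ^ n" using iter by blast
  show ?thesis
    by (rule unital_banach_star_algebra.neumann_series_unit[OF unital_banach_star_algebra_S A D])
       (use j u in auto)
qed

end

section \<open>Inverse-closedness and symmetry\<close>

lemma cmod_ell2_inner_commute: "cmod (ell2_inner X f g) = cmod (ell2_inner X g f)"
proof -
  have "ell2_inner X f g = (\<Sum>\<^sub>\<infinity>k\<in>X. cnj (cinner (g k) (f k)))"
    unfolding ell2_inner_def by (intro infsum_cong cinner_commute)
  then show ?thesis by (simp add: ell2_inner_def)
qed

section \<open>The bounded operators on square-summable families\<close>

lemma ell2_operators_simps [simp]:
  "carrier (ell2_operators X) = Collect (bounded_ell2_op X)"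
  "mult (ell2_operators X) = (\<lambda>S T f. S (T f))"
  "one (ell2_operators X) = (\<lambda>f. if f \<in> ell2 X then f else (\<lambda>k. 0))"
  "zero (ell2_operators X) = (\<lambda>f k. 0)"
  "add (ell2_operators X) = (\<lambda>S T f k. S f k + T f k)"
  "smult (ell2_operators X) = (\<lambda>c T f k. c *\<^sub>C T f k)"
  by (simp_all add: ell2_operators_def)

lemma bounded_ell2_op_D:
  assumes "bounded_ell2_op X T"
  shows "f \<notin> ell2 X \<Longrightarrow> T f = (\<lambda>k. 0)" "f \<in> ell2 X \<Longrightarrow> T f \<in> ell2 X" "T f \<in> ell2 X"
    "\<exists>M>0. \<forall>f\<in>ell2 X. ell2_norm X (T f) \<le> M * ell2_norm X f" "T (\<lambda>k. 0) = (\<lambda>k. 0)"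
proof -
  show 1: "f \<notin> ell2 X \<Longrightarrow> T f = (\<lambda>k. 0)" and 2: "f \<in> ell2 X \<Longrightarrow> T f \<in> ell2 X"
    using assms by (auto simp: bounded_ell2_op_def)
  then show "T f \<in> ell2 X" by (cases "f \<in> ell2 X") auto
  obtain M where M: "\<forall>f\<in>ell2 X. ell2_norm X (T f) \<le> M * ell2_norm X f"
    using assms by (auto simp: bounded_ell2_op_def)
  have "ell2_norm X (T f) \<le> (\<bar>M\<bar> + 1) * ell2_norm X f" if "f \<in> ell2 X" for f
  proof -
    have "M * ell2_norm X f \<le> (\<bar>M\<bar> + 1) * ell2_norm X f"
      by (intro mult_right_mono ell2_norm_nonneg) simp
    then show ?thesis using M that by fastforce
  qed
  then show "\<exists>M>0. \<forall>f\<in>ell2 X. ell2_norm X (T f) \<le> M * ell2_norm X f"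
    by (intro exI[of _ "\<bar>M\<bar> + 1"]) auto
  have "\<forall>c. \<forall>f\<in>ell2 X. T (\<lambda>k. c *\<^sub>C f k) = (\<lambda>k. c *\<^sub>C T f k)"
    using assms by (simp add: bounded_ell2_op_def)
  from bspec[OF spec[OF this, of 0] ell2_zero] have "T (\<lambda>k. 0 *\<^sub>C 0) = (\<lambda>k. 0 *\<^sub>C T (\<lambda>k. 0) k)" .
  then show "T (\<lambda>k. 0) = (\<lambda>k. 0)" by simp
qed

text \<open>Uniqueness of inverses in this monoid identifies \<open>inv\<close> of an operator with
  the operator of the inverse matrix.\<close>

lemma monoid_ell2_operators: "monoid (ell2_operators X)"
proof (rule monoidI)
  show "one (ell2_operators X) \<in> carrier (ell2_operators X)"
    by (auto simp: bounded_ell2_op_def ell2_add ell2_scaleC intro!: exI[of _ 1])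
  fix S T :: "('a \<Rightarrow> 'b) \<Rightarrow> 'a \<Rightarrow> 'b"
  assume "S \<in> carrier (ell2_operators X)" "T \<in> carrier (ell2_operators X)"
  then have S: "bounded_ell2_op X S" and T: "bounded_ell2_op X T" by auto
  obtain M where M: "0 < M" "\<forall>f\<in>ell2 X. ell2_norm X (S f) \<le> M * ell2_norm X f"
    using bounded_ell2_op_D(4)[OF S] by blast
  obtain N where N: "\<forall>f\<in>ell2 X. ell2_norm X (T f) \<le> N * ell2_norm X f"
    using bounded_ell2_op_D(4)[OF T] by blast
  have "ell2_norm X (S (T f)) \<le> (M * N) * ell2_norm X f" if "f \<in> ell2 X" for f
  proof -
    have "ell2_norm X (S (T f)) \<le> M * ell2_norm X (T f)" using M bounded_ell2_op_D(3)[OF T] by blast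
    also have "\<dots> \<le> M * (N * ell2_norm X f)" using M N that by (intro mult_left_mono) auto
    finally show ?thesis by simp
  qed
  then have "\<exists>M. \<forall>f\<in>ell2 X. ell2_norm X (S (T f)) \<le> M * ell2_norm X f" by blast
  then show "mult (ell2_operators X) S T \<in> carrier (ell2_operators X)"
    using S T bounded_ell2_op_D(3)[OF T] bounded_ell2_op_D(5)[OF S]
    unfolding ell2_operators_simps mem_Collect_eq bounded_ell2_op_def by simp
next
  fix T :: "('a \<Rightarrow> 'b) \<Rightarrow> 'a \<Rightarrow> 'b"
  assume "T \<in> carrier (ell2_operators X)"
  then have T: "bounded_ell2_op X T" by simp
  show "mult (ell2_operators X) (one (ell2_operators X)) T = T"
    using bounded_ell2_op_D(3)[OF T] by simp
  show "mult (ell2_operators X) T (one (ell2_operators X)) = T"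
    using bounded_ell2_op_D(1,5)[OF T] by auto
qed simp

context gelfand_weight
begin

interpretation B: unital_banach_star_algebra S
  by (rule unital_banach_star_algebra_S)

lemma smult_unit:
  assumes "T \<in> carrier S" "smult S c T \<in> Units S"
  shows "T \<in> Units S"
proof -
  obtain V where V: "V \<in> carrier S" "V \<otimes>\<^bsub>S\<^esub> smult S c T = \<one>\<^bsub>S\<^esub>" "smult S c T \<otimes>\<^bsub>S\<^esub> V = \<one>\<^bsub>S\<^esub>"
    using assms(2) by (auto simp: Units_def)
  have "smult S c V \<otimes>\<^bsub>S\<^esub> T = \<one>\<^bsub>S\<^esub>" "T \<otimes>\<^bsub>S\<^esub> smult S c V = \<one>\<^bsub>S\<^esub>"
    using V assms(1) by (simp_all add: B.smult_mult_left B.smult_mult_right)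
  then show ?thesis using V(1) assms(1) smult_closed[of V c] unfolding Units_def by blast
qed

lemma op_minus:
  assumes "A \<in> carrier S" "B \<in> carrier S" "f \<in> ell2 X"
  shows "matrix_op X (A \<ominus>\<^bsub>S\<^esub> B) f = (\<lambda>k. matrix_op X A f k - matrix_op X B f k)"
proof -
  have "A \<ominus>\<^bsub>S\<^esub> B = A \<oplus>\<^bsub>S\<^esub> smult S (-1) B" using assms by (simp add: S.minus_eq B.smult_minus_one)
  then show ?thesis using assms by (simp add: op_add op_smult smult_closed scaleC_minus_one)
qed

text \<open>For \<open>c = 1 / (\<parallel>N\<parallel> + 1)\<^sup>2\<close> the operator \<open>1 - c N\<^sup>* N\<close> is a strict contraction.\<close>

lemma star_mult_unit_of_bounded_below:
  assumes N: "N \<in> carrier S" and a: "0 < a"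
    and below: "\<And>f. f \<in> ell2 X \<Longrightarrow> a * ell2_norm X f \<le> ell2_norm X (matrix_op X N f)"
  shows "star S N \<otimes>\<^bsub>S\<^esub> N \<in> Units S"
proof -
  define T where "T = star S N \<otimes>\<^bsub>S\<^esub> N"
  have N': "star S N \<in> carrier S" using N by (rule star_closed)
  have T: "T \<in> carrier S" using N N' by (simp add: T_def mult_closed)
  define M where "M = anorm S N + 1"
  have M: "0 < M" using anorm_nonneg[of N] by (simp add: M_def)
  define c where "c = 1 / M\<^sup>2"
  have c: "0 < c" using M by (simp add: c_def)
  define B where "B = \<one>\<^bsub>S\<^esub> \<ominus>\<^bsub>S\<^esub> smult S (complex_of_real c) T"
  have B: "B \<in> carrier S" using T by (simp add: B_def smult_closed one_closed)
  \<comment> \<open>The square of the contraction factor comes out as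
    \<open>1 - c * a\<^sup>2\<close>; \<open>max 0\<close> covers a trivial \<open>ell2 X\<close>,
    where \<open>a\<close> is not limited by the norm of \<open>N\<close>.\<close>
  define q where "q = sqrt (max 0 (1 - c * a\<^sup>2))"
  have q: "0 \<le> q" "q < 1" using c a by (auto simp: q_def)
  have contr: "ell2_norm X (matrix_op X B f) \<le> q * ell2_norm X f" if f: "f \<in> ell2 X" for f
  proof -
    define h where "h = matrix_op X N f"
    define g where "g = matrix_op X T f"
    have h: "h \<in> ell2 X" using N f by (simp add: h_def op_ell2)
    have g: "g \<in> ell2 X" using T f by (simp add: g_def op_ell2)
    have g_eq: "g = matrix_op X (star S N) h" using N N' by (simp add: g_def T_def h_def op_mult)
    have "ell2_norm X g \<le> anorm S (star S N) * ell2_norm X h" unfolding g_eq using N' h by (rule op_ell2)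
    also have "\<dots> \<le> M * ell2_norm X h"
      using anorm_star_le[OF N] by (intro mult_right_mono ell2_norm_nonneg) (simp add: M_def)
    finally have g_le: "(ell2_norm X g)\<^sup>2 \<le> M\<^sup>2 * (ell2_norm X h)\<^sup>2"
      by (metis power_mono power_mult_distrib ell2_norm_nonneg)
    have "ell2_inner X f g = ell2_inner X h h"
      using op_star[OF N f h] by (simp add: g_eq h_def)
    then have inner: "Re (ell2_inner X f g) = (ell2_norm X h)\<^sup>2"
      using h by (simp add: ell2_inner_self del: of_real_power)
    have "matrix_op X B f = (\<lambda>k. f k + (- c) *\<^sub>R g k)"
      using T f by (simp add: B_def op_minus one_closed smult_closed op_one op_smult g_def scaleR_scaleC[symmetric])
    \<comment> \<open>In units of the squared norm of \<open>h\<close>, the cross term contributes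
      \<open>- 2 * c\<close> and, as \<open>c * M\<^sup>2 = 1\<close>, the quadratic term at most
      \<open>c\<close>; a gain of \<open>c\<close> remains.\<close>
    then have "(ell2_norm X (matrix_op X B f))\<^sup>2
        = (ell2_norm X f)\<^sup>2 - 2 * c * (ell2_norm X h)\<^sup>2 + c\<^sup>2 * (ell2_norm X g)\<^sup>2"
      using ell2_norm_sq_add_scaleR[OF f g, of "- c"] inner by simp
    also have "\<dots> \<le> (ell2_norm X f)\<^sup>2 - 2 * c * (ell2_norm X h)\<^sup>2 + c\<^sup>2 * (M\<^sup>2 * (ell2_norm X h)\<^sup>2)"
      using g_le by (intro add_left_mono mult_left_mono) auto
    also have "c\<^sup>2 * (M\<^sup>2 * (ell2_norm X h)\<^sup>2) = c * (ell2_norm X h)\<^sup>2"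
      using M by (simp add: c_def field_simps power2_eq_square)
    finally have 1: "(ell2_norm X (matrix_op X B f))\<^sup>2 \<le> (ell2_norm X f)\<^sup>2 - c * (ell2_norm X h)\<^sup>2" by simp
    have "(a * ell2_norm X f)\<^sup>2 \<le> (ell2_norm X h)\<^sup>2"
      using below[OF f] a by (intro power_mono) (auto simp: h_def ell2_norm_nonneg)
    then have "c * (a * ell2_norm X f)\<^sup>2 \<le> c * (ell2_norm X h)\<^sup>2" using c by simp
    then have "(ell2_norm X (matrix_op X B f))\<^sup>2 \<le> (1 - c * a\<^sup>2) * (ell2_norm X f)\<^sup>2"
      using 1 by (simp add: power_mult_distrib algebra_simps)
    also have "\<dots> \<le> (q * ell2_norm X f)\<^sup>2"
      by (simp add: q_def power_mult_distrib mult_right_mono)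
    finally show ?thesis
      using q ell2_norm_nonneg[of X f] by (simp add: power2_le_iff_abs_le)
  qed
  have "\<one>\<^bsub>S\<^esub> \<ominus>\<^bsub>S\<^esub> B \<in> Units S" using one_minus_contraction_unit[OF B q contr] .
  moreover have "\<one>\<^bsub>S\<^esub> \<ominus>\<^bsub>S\<^esub> B = smult S (complex_of_real c) T"
    using T one_closed smult_closed[OF T]
    by (intro ext) (simp add: B_def minus_apply)
  ultimately show ?thesis using smult_unit[OF T] by (simp add: T_def)
qed

text \<open>The adjoint is coercive with the same constant, since the two quadratic forms are
  conjugate. \<open>star S N\<close> times \<open>N\<close> being a unit gives a left inverse of
  \<open>N\<close>, the opposite product a right inverse, and the two coincide.\<close>

lemma unit_if_coercive:
  assumes N: "N \<in> carrier S" and c: "0 < c"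
    and coercive: "\<And>f. f \<in> ell2 X \<Longrightarrow> c * (ell2_norm X f)\<^sup>2 \<le> cmod (ell2_inner X (matrix_op X N f) f)"
  shows "N \<in> Units S"
proof -
  have below: "c * ell2_norm X f \<le> ell2_norm X g"
    if "f \<in> ell2 X" "g \<in> ell2 X" "c * (ell2_norm X f)\<^sup>2 \<le> cmod (ell2_inner X g f)" for f g
  proof (cases "ell2_norm X f = 0")
    case False
    then have pos: "0 < ell2_norm X f" using ell2_norm_nonneg[of X f] by simp
    have "c * ell2_norm X f * ell2_norm X f \<le> ell2_norm X g * ell2_norm X f"
      using ell2_inner_summable(2)[OF that(2,1)] that(3) by (simp add: power2_eq_square mult.assoc)
    then show ?thesis using pos by (simp only: mult_le_cancel_right_pos)
  qed (simp add: ell2_norm_nonneg)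
  have N': "star S N \<in> carrier S" using N by (rule star_closed)
  have L: "star S N \<otimes>\<^bsub>S\<^esub> N \<in> Units S"
    using N c by (intro star_mult_unit_of_bounded_below[of N c] below coercive op_ell2)
  have R: "star S (star S N) \<otimes>\<^bsub>S\<^esub> star S N \<in> Units S"
  proof (intro star_mult_unit_of_bounded_below[of "star S N" c] below N' c op_ell2)
    fix f :: "real ^ 'n \<Rightarrow> 'h" assume f: "f \<in> ell2 X"
    have "ell2_inner X (matrix_op X (star S N) f) f = ell2_inner X f (matrix_op X N f)"
      using op_star[OF N' f f] N by (simp add: star_star)
    then show "c * (ell2_norm X f)\<^sup>2 \<le> cmod (ell2_inner X (matrix_op X (star S N) f) f)"
      using coercive[OF f] by (simp add: cmod_ell2_inner_commute)
  qed
  obtain V where V: "V \<in> carrier S" "V \<otimes>\<^bsub>S\<^esub> (star S N \<otimes>\<^bsub>S\<^esub> N) = \<one>\<^bsub>S\<^esub>" using L by (auto simp: Units_def)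
  obtain V' where V': "V' \<in> carrier S" "(N \<otimes>\<^bsub>S\<^esub> star S N) \<otimes>\<^bsub>S\<^esub> V' = \<one>\<^bsub>S\<^esub>"
    using R N by (auto simp: Units_def star_star)
  have l: "(V \<otimes>\<^bsub>S\<^esub> star S N) \<otimes>\<^bsub>S\<^esub> N = \<one>\<^bsub>S\<^esub>" using V N N' by (simp add: S.m_assoc)
  have r: "N \<otimes>\<^bsub>S\<^esub> (star S N \<otimes>\<^bsub>S\<^esub> V') = \<one>\<^bsub>S\<^esub>" using V' N N' by (simp add: S.m_assoc)
  have "V \<otimes>\<^bsub>S\<^esub> star S N = star S N \<otimes>\<^bsub>S\<^esub> V'"
    using S.inv_unique[OF l r] V(1) V'(1) N N' by simp
  with r have "N \<otimes>\<^bsub>S\<^esub> (V \<otimes>\<^bsub>S\<^esub> star S N) = \<one>\<^bsub>S\<^esub>" by simp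
  then show ?thesis using l mult_closed[OF V(1) N'] N unfolding Units_def by blast
qed

section \<open>Matrices as a subalgebra of the bounded operators\<close>

lemma matrix_op_outside: "f \<notin> ell2 X \<Longrightarrow> matrix_op X A f = (\<lambda>k. 0)"
  by (simp add: matrix_op_def)

lemma matrix_op_one_eq: "matrix_op X (one S) = one (ell2_operators X)"
  by (rule ext) (auto simp: op_one matrix_op_outside)

lemma matrix_op_add_eq:
  "A \<in> carrier S \<Longrightarrow> B \<in> carrier S \<Longrightarrow> matrix_op X (add S A B) = add (ell2_operators X) (matrix_op X A) (matrix_op X B)"
  by (intro ext, case_tac "x \<in> ell2 X") (auto simp: op_add matrix_op_outside)

lemma matrix_op_mult_eq:
  "A \<in> carrier S \<Longrightarrow> B \<in> carrier S \<Longrightarrow> matrix_op X (mult S A B) = mult (ell2_operators X) (matrix_op X A) (matrix_op X B)"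
  by (intro ext) (simp add: op_mult)

lemma matrix_op_smult_eq:
  "A \<in> carrier S \<Longrightarrow> matrix_op X (smult S c A) = smult (ell2_operators X) c (matrix_op X A)"
  by (intro ext, case_tac "x \<in> ell2 X") (auto simp: op_smult matrix_op_outside)

text \<open>Subtraction of operators goes through \<open>a_inv\<close>, a definite description. It
  is evaluated directly, by checking that the negative of the matrix gives the only bounded operator
  cancelling \<open>matrix_op X B\<close>.\<close>

lemma matrix_op_minus_eq:
  assumes A: "A \<in> carrier S" and B: "B \<in> carrier S"
  shows "matrix_op X (A \<ominus>\<^bsub>S\<^esub> B) = matrix_op X A \<ominus>\<^bsub>ell2_operators X\<^esub> matrix_op X B"
proof -
  have "\<ominus>\<^bsub>ell2_operators X\<^esub> matrix_op X B = matrix_op X (\<ominus>\<^bsub>S\<^esub> B)"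
    unfolding a_inv_def[of "ell2_operators X"] m_inv_def
  proof (rule the_equality, goal_cases)
    case 1
    have "matrix_op X B f k + matrix_op X (\<ominus>\<^bsub>S\<^esub> B) f k = 0" for f k
      using fun_cong[OF fun_cong[OF matrix_op_add_eq[OF B S.a_inv_closed[OF B]]], of f k]
      by (simp add: B op_zero S.r_neg)
    then show ?case using op_bounded[OF S.a_inv_closed[OF B]]
      by (auto simp: add.commute)
  next
    case (2 T)
    have "T f k = - matrix_op X B f k" for f k
      using 2 by (auto dest!: fun_cong[where x = f] fun_cong[where x = k] simp: add_eq_0_iff)
    moreover have "matrix_op X (\<ominus>\<^bsub>S\<^esub> B) f k = - matrix_op X B f k" for f k
      using fun_cong[OF fun_cong[OF matrix_op_add_eq[OF B S.a_inv_closed[OF B]]], of f k]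
      by (simp add: B op_zero S.r_neg add_eq_0_iff)
    ultimately show ?case by (intro ext) simp
  qed
  then show ?thesis using A B by (simp add: a_minus_def matrix_op_add_eq)
qed

lemma matrix_op_embedding: "algebra_embedding (matrix_op X) S (ell2_operators X)"
  unfolding algebra_embedding_def
proof (intro conjI ballI allI)
  show "matrix_op X \<in> ring_hom S (ell2_operators X)"
    by (rule ring_hom_memI)
       (simp_all only: matrix_op_mult_eq matrix_op_add_eq matrix_op_one_eq,
        simp add: op_bounded)
  show "inj_on (matrix_op X) (carrier S)" by (intro inj_onI op_eqI) auto
qed (rule matrix_op_smult_eq)

text \<open>A bounded inverse \<open>T\<close> bounds the operator below by \<open>1 / M\<close>,
  which yields a left inverse \<open>L\<close> inside the algebra. On \<open>ell2 X\<close> the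
  operator of \<open>L\<close> agrees with \<open>T\<close>, so \<open>L\<close> is a right inverse
  too.\<close>

lemma matrix_op_units_iff:
  assumes A: "A \<in> carrier S"
  shows "A \<in> Units S \<longleftrightarrow> matrix_op X A \<in> Units (ell2_operators X)"
proof
  assume "A \<in> Units S"
  then obtain V where V: "V \<in> carrier S" "V \<otimes>\<^bsub>S\<^esub> A = \<one>\<^bsub>S\<^esub>" "A \<otimes>\<^bsub>S\<^esub> V = \<one>\<^bsub>S\<^esub>" by (auto simp: Units_def)
  then have "mult (ell2_operators X) (matrix_op X V) (matrix_op X A) = one (ell2_operators X)"
    "mult (ell2_operators X) (matrix_op X A) (matrix_op X V) = one (ell2_operators X)"
    using A by (simp_all only: matrix_op_mult_eq[symmetric] matrix_op_one_eq)
  then show "matrix_op X A \<in> Units (ell2_operators X)"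
    using op_bounded[OF A] op_bounded[OF V(1)] unfolding Units_def ell2_operators_simps(1) by blast
next
  assume "matrix_op X A \<in> Units (ell2_operators X)"
  then obtain T where T: "bounded_ell2_op X T"
    and TA: "\<And>f. T (matrix_op X A f) = (if f \<in> ell2 X then f else (\<lambda>k. 0))"
    and AT: "\<And>f. matrix_op X A (T f) = (if f \<in> ell2 X then f else (\<lambda>k. 0))"
    by (auto simp: Units_def fun_eq_iff)
  obtain M where M: "0 < M" "\<forall>f\<in>ell2 X. ell2_norm X (T f) \<le> M * ell2_norm X f"
    using bounded_ell2_op_D(4)[OF T] by blast
  have "star S A \<otimes>\<^bsub>S\<^esub> A \<in> Units S"
  proof (rule star_mult_unit_of_bounded_below[OF A, of "1 / M"])
    fix f :: "real ^ 'n \<Rightarrow> 'h" assume f: "f \<in> ell2 X"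
    have "ell2_norm X f \<le> M * ell2_norm X (matrix_op X A f)"
      using M(2) op_ell2(1)[OF A f] TA[of f] f by force
    then show "1 / M * ell2_norm X f \<le> ell2_norm X (matrix_op X A f)" using M(1) by (simp add: field_simps)
  qed (use M in simp)
  then obtain V where V: "V \<in> carrier S" "V \<otimes>\<^bsub>S\<^esub> (star S A \<otimes>\<^bsub>S\<^esub> A) = \<one>\<^bsub>S\<^esub>" by (auto simp: Units_def)
  define L where "L = V \<otimes>\<^bsub>S\<^esub> star S A"
  have L: "L \<in> carrier S" using V A by (simp add: L_def mult_closed star_closed)
  have LA: "L \<otimes>\<^bsub>S\<^esub> A = \<one>\<^bsub>S\<^esub>" using V A star_closed[OF A] by (simp add: L_def S.m_assoc)
  have L_eq: "matrix_op X L f = T f" if f: "f \<in> ell2 X" for f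
  proof -
    have Tf: "T f \<in> ell2 X" using bounded_ell2_op_D(2)[OF T f] .
    have "T f = matrix_op X (L \<otimes>\<^bsub>S\<^esub> A) (T f)" using Tf by (simp add: LA op_one)
    also have "\<dots> = matrix_op X L f" using AT[of f] f L A by (simp add: op_mult)
    finally show ?thesis by simp
  qed
  have "A \<otimes>\<^bsub>S\<^esub> L = \<one>\<^bsub>S\<^esub>"
    using A L by (intro op_eqI mult_closed one_closed) (simp_all add: op_mult op_one L_eq AT)
  then show "A \<in> Units S" using A L LA unfolding Units_def by blast
qed

lemma inverse_closed_matrix_op: "inverse_closed (matrix_op X) S (ell2_operators X)"
  unfolding inverse_closed_def
proof (intro conjI ballI impI matrix_op_embedding)
  fix A assume A: "A \<in> carrier S" and unit: "matrix_op X A \<in> Units (ell2_operators X)"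
  have "A \<in> Units S" using A unit by (simp add: matrix_op_units_iff)
  then obtain V where V: "V \<in> carrier S" "V \<otimes>\<^bsub>S\<^esub> A = \<one>\<^bsub>S\<^esub>" "A \<otimes>\<^bsub>S\<^esub> V = \<one>\<^bsub>S\<^esub>" by (auto simp: Units_def)
  have "mult (ell2_operators X) (matrix_op X V) (matrix_op X A) = one (ell2_operators X)"
    using A V by (simp only: matrix_op_mult_eq[symmetric] matrix_op_one_eq)
  then have "inv\<^bsub>ell2_operators X\<^esub> matrix_op X A = matrix_op X V"
    using monoid.inv_char[OF monoid_ell2_operators] V A op_bounded
    by (metis (no_types, lifting) ell2_operators_simps(1) matrix_op_mult_eq matrix_op_one_eq mem_Collect_eq)
  then show "inv\<^bsub>ell2_operators X\<^esub> matrix_op X A \<in> matrix_op X ` carrier S" using V(1) by simp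
qed

lemma spectrum_eq:
  assumes A: "A \<in> carrier S"
  shows "spectrum S A = spectrum (ell2_operators X) (matrix_op X A)"
proof -
  have "matrix_op X (z \<odot>\<^bsub>S\<^esub> \<one>\<^bsub>S\<^esub> \<ominus>\<^bsub>S\<^esub> A)
      = z \<odot>\<^bsub>ell2_operators X\<^esub> \<one>\<^bsub>ell2_operators X\<^esub> \<ominus>\<^bsub>ell2_operators X\<^esub> matrix_op X A" for z
    using A by (simp only: matrix_op_minus_eq smult_closed one_closed matrix_op_smult_eq matrix_op_one_eq)
  moreover have "z \<odot>\<^bsub>S\<^esub> \<one>\<^bsub>S\<^esub> \<ominus>\<^bsub>S\<^esub> A \<in> carrier S" for z
    using A by (intro S.minus_closed smult_closed one_closed)
  ultimately show ?thesis unfolding spectrum_def by (simp only: matrix_op_units_iff)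
qed

text \<open>The quadratic form of \<open>z\<close> minus the product is \<open>z * p - r\<close>
  with \<open>p\<close> the squared norm of \<open>f\<close> and \<open>r\<close> nonnegative, so
  its modulus is at least \<open>p\<close> times the distance from \<open>z\<close> to the
  half-line.\<close>

lemma spectrum_star_mult:
  assumes A: "A \<in> carrier S"
  shows "spectrum S (star S A \<otimes>\<^bsub>S\<^esub> A) \<subseteq> complex_of_real ` {0..}"
proof
  fix z assume z: "z \<in> spectrum S (star S A \<otimes>\<^bsub>S\<^esub> A)"
  show "z \<in> complex_of_real ` {0..}"
  proof (rule ccontr)
    assume notin: "z \<notin> complex_of_real ` {0..}"
    \<comment> \<open>A lower bound for the distance from \<open>z\<close> to the half-line: the
      distance to 0 on the negative axis, and otherwise the size of the imaginary part.\<close>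
    define c where "c = (if Im z = 0 then - Re z else \<bar>Im z\<bar>)"
    have c: "0 < c"
    proof (cases "Im z = 0")
      case True
      then have "z = complex_of_real (Re z)" by (simp add: complex_eq_iff)
      then have "Re z < 0" using notin by (metis atLeast_iff image_eqI not_le)
      then show ?thesis using True by (simp add: c_def)
    qed (simp add: c_def)
    have A': "star S A \<in> carrier S" using A by (rule star_closed)
    define T where "T = star S A \<otimes>\<^bsub>S\<^esub> A"
    have T: "T \<in> carrier S" using A A' by (simp add: T_def mult_closed)
    define N where "N = z \<odot>\<^bsub>S\<^esub> \<one>\<^bsub>S\<^esub> \<ominus>\<^bsub>S\<^esub> T"
    have N: "N \<in> carrier S" unfolding N_def using T by (intro S.minus_closed smult_closed one_closed)
    have "N \<in> Units S"
    proof (rule unit_if_coercive[OF N c])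
      fix f :: "real ^ 'n \<Rightarrow> 'h" assume f: "f \<in> ell2 X"
      define p r where "p = (ell2_norm X f)\<^sup>2" and "r = (ell2_norm X (matrix_op X A f))\<^sup>2"
      have Tf: "matrix_op X T f \<in> ell2 X" and Af: "matrix_op X A f \<in> ell2 X"
        using T A f by (simp_all add: op_ell2)
      have "ell2_inner X (matrix_op X T f) f = ell2_inner X (matrix_op X A f) (matrix_op X A f)"
        using op_star[OF A' Af f] A A' by (simp add: T_def op_mult star_star)
      then have inner_T: "ell2_inner X (matrix_op X T f) f = complex_of_real r"
        using Af by (simp add: ell2_inner_self r_def)
      have "matrix_op X N f = (\<lambda>k. z *\<^sub>C f k - matrix_op X T f k)"
        using T f by (simp add: N_def op_minus smult_closed one_closed op_smult op_one)
      then have inner_N: "ell2_inner X (matrix_op X N f) f = z * complex_of_real p - complex_of_real r"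
        using f Tf by (simp add: ell2_inner_diff_left ell2_scaleC ell2_inner_scaleC_left ell2_inner_self inner_T p_def)
      have "c * p \<le> cmod (z * complex_of_real p - complex_of_real r)"
      proof (cases "Im z = 0")
        case True
        have "c * p \<le> \<bar>Re (z * complex_of_real p - complex_of_real r)\<bar>"
          using True zero_le_power2[of "ell2_norm X (matrix_op X A f)", folded r_def] by (simp add: c_def)
        also have "\<dots> \<le> cmod (z * complex_of_real p - complex_of_real r)" by (rule abs_Re_le_cmod)
        finally show ?thesis .
      next
        case False
        have "c * p = \<bar>Im (z * complex_of_real p - complex_of_real r)\<bar>"
          using False by (simp add: c_def p_def abs_mult)
        also have "\<dots> \<le> cmod (z * complex_of_real p - complex_of_real r)" by (rule abs_Im_le_cmod)
        finally show ?thesis .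
      qed
      then show "c * (ell2_norm X f)\<^sup>2 \<le> cmod (ell2_inner X (matrix_op X N f) f)"
        by (simp add: inner_N p_def)
    qed
    then show False using z by (simp add: spectrum_def N_def T_def)
  qed
qed

end

theorem theorem3p10:
  fixes X :: "(real ^ 'n) set" and \<nu> :: "real ^ 'n \<Rightarrow> real"
    and S :: "('n, 'h::complex_hilbert_space) op_matrix star_algebra"
  defines "S \<equiv> schur_algebra \<nu> X"
  assumes separable: "separable_space (euclidean :: 'h topology)"
    and X: "relatively_separated X"
    and admissible: "admissible_weight \<nu>"
    and weak_growth: "\<exists>C \<delta>. 0 < C \<and> 0 < \<delta> \<and> \<delta> \<le> 1 \<and> (\<forall>x. C * (1 + norm x) powr \<delta> \<le> \<nu> x)"
  shows "(\<forall>A\<in>carrier S. star S A = A \<longrightarrow>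
            spectral_radius S A = spectral_radius (ell2_operators X) (matrix_op X A)) \<and>
         inverse_closed (matrix_op X) S (ell2_operators X) \<and>
         symmetric_banach_algebra S"
proof -
  obtain C \<delta> where "0 < C" "0 < \<delta>" "\<And>x. C * (1 + norm x) powr \<delta> \<le> \<nu> x" using weak_growth by blast
  then interpret gelfand_weight \<nu> X S C \<delta>
    using X admissible by unfold_locales (auto simp: S_def admissible_weight_properties)
  show ?thesis
    using spectrum_eq inverse_closed_matrix_op unital_banach_star_algebra_S spectrum_star_mult
    by (simp add: spectral_radius_def symmetric_banach_algebra_def)
qed

end
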